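(* Let $\Gamma=(V,E)$ and $\Gamma'=(V',E')$ be finite graphs with $V\cap V'=\emptyset$. Let $G$ be a group, and for each $v\in V\cup V'$ let $G_v$ be a nontrivial finite subgroup of $G$. Suppose that $G$ is the internal graph product of $(\Gamma,(G_v)_{v\in V})$ and also the internal graph product of $(\Gamma',(G_{v'})_{v'\in V'})$. If $G_v$ is directly indecomposable for all $v\in V\cup V'$, then $(\Gamma,(G_v)_{v\in V})$ and $(\Gamma',(G_{v'})_{v'\in V'})$ are isomorphic graphs of groups; that is, there is a graph isomorphism $\phi\colon\Gamma\to\Gamma'$ such that $G_v\cong G_{\phi(v)}$ for all $v\in V$.
   Context: A graph is a pair $(V,E)$ where $E$ is a set of two-element subsets of $V$ (so graphs are simple and undirected). A graph of groups $(\Gamma,G_v)$ here means a graph $\Gamma=(V,E)$ together with a family of groups $(G_v)_{v\in V}$ indexed by the vertices (there are no edge groups). Its graph product is $F/N$, where $F$ is the free product of the groups $G_v$ ($v\in V$) and $N$ is the normal closure in $F$ of $\{g^{-1}h^{-1}gh : g\in G_u,\ h\in G_v,\ \{u,v\}\in E\}$. If the $G_v$ are subgroups of a group $G$, then $G$ is the internal graph product of $(\Gamma,G_v)$ if the inclusions $G_v\hookrightarrow G$ induce an isomorphism from the graph product $F/N$ onto $G$. Two graphs of groups $(\Gamma,G_v)$ and $(\Gamma',G'_{v'})$ are isomorphic if there is a graph isomorphism $\phi\colon\Gamma\to\Gamma'$ with $G_v\cong G'_{\phi(v)}$ for all vertices $v$ of $\Gamma$. A nontrivial group is directly indecomposable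 if it is not isomorphic to a direct product of two nontrivial groups. *)

theory Defs
  imports "HOL-Algebra.Coset"
begin

section \<open>Graphs and graphs of groups\<close>

text \<open>A graph is given by its vertex set \<open>V\<close> and its edge set \<open>E\<close>; a family of groups is a
  function \<open>K\<close> on vertices, of which only the values on \<open>V\<close> matter.\<close>

definition is_graph :: "'v set \<Rightarrow> 'v set set \<Rightarrow> bool" where
  "is_graph V E \<longleftrightarrow> E \<subseteq> {e. e \<subseteq> V \<and> card e = 2}"

definition graph_iso :: "'v set \<Rightarrow> 'v set set \<Rightarrow> 'w set \<Rightarrow> 'w set set \<Rightarrow> ('v \<Rightarrow> 'w) \<Rightarrow> bool" where
  "graph_iso V E V' E' \<phi> \<longleftrightarrow>
     bij_betw \<phi> V V' \<and> (\<forall>u\<in>V. \<forall>v\<in>V. {u, v} \<in> E \<longleftrightarrow> {\<phi> u, \<phi> v} \<in> E')"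

definition isomorphic_graphs_of_groups ::
  "'v set \<Rightarrow> 'v set set \<Rightarrow> ('v \<Rightarrow> ('a, 'x) monoid_scheme) \<Rightarrow>
   'w set \<Rightarrow> 'w set set \<Rightarrow> ('w \<Rightarrow> ('b, 'y) monoid_scheme) \<Rightarrow> bool" where
  "isomorphic_graphs_of_groups V E K V' E' K' \<longleftrightarrow>
     (\<exists>\<phi>. graph_iso V E V' E' \<phi> \<and> (\<forall>v\<in>V. K v \<cong> K' (\<phi> v)))"


section \<open>Free products\<close>

text \<open>The free product is the monoid of words over the disjoint union of the groups, modulo the
  congruence generated by deleting a letter that is the identity of its group and by multiplying
  two adjacent letters from the same group.\<close>

definition fp_words :: "'v set \<Rightarrow> ('v \<Rightarrow> ('a, 'x) monoid_scheme) \<Rightarrow> ('v \<times> 'a) list set" where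
  "fp_words V K = lists (SIGMA v:V. carrier (K v))"

inductive fp_step ::
  "'v set \<Rightarrow> ('v \<Rightarrow> ('a, 'x) monoid_scheme) \<Rightarrow> ('v \<times> 'a) list \<Rightarrow> ('v \<times> 'a) list \<Rightarrow> bool"
  for V K where
  unit: "\<lbrakk>v \<in> V; x \<in> fp_words V K; y \<in> fp_words V K\<rbrakk>
    \<Longrightarrow> fp_step V K (x @ [(v, \<one>\<^bsub>K v\<^esub>)] @ y) (x @ y)"
| mult: "\<lbrakk>v \<in> V; g \<in> carrier (K v); h \<in> carrier (K v); x \<in> fp_words V K; y \<in> fp_words V K\<rbrakk>
    \<Longrightarrow> fp_step V K (x @ [(v, g), (v, h)] @ y) (x @ [(v, g \<otimes>\<^bsub>K v\<^esub> h)] @ y)"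

definition fp_eq ::
  "'v set \<Rightarrow> ('v \<Rightarrow> ('a, 'x) monoid_scheme) \<Rightarrow> (('v \<times> 'a) list \<times> ('v \<times> 'a) list) set" where
  "fp_eq V K = {(x, y). x \<in> fp_words V K \<and> y \<in> fp_words V K \<and> equivclp (fp_step V K) x y}"

definition free_product ::
  "'v set \<Rightarrow> ('v \<Rightarrow> ('a, 'x) monoid_scheme) \<Rightarrow> ('v \<times> 'a) list set monoid" where
  "free_product V K =
     \<lparr>carrier = fp_words V K // fp_eq V K,
      mult = (\<lambda>X Y. \<Union>x\<in>X. \<Union>y\<in>Y. fp_eq V K `` {x @ y}),
      one = fp_eq V K `` {[]}\<rparr>"

definition fp_incl ::
  "'v set \<Rightarrow> ('v \<Rightarrow> ('a, 'x) monoid_scheme) \<Rightarrow> 'v \<Rightarrow> 'a \<Rightarrow> ('v \<times> 'a) list set" where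
  "fp_incl V K v g = fp_eq V K `` {[(v, g)]}"


section \<open>Graph products\<close>

definition normal_closure :: "('a, 'x) monoid_scheme \<Rightarrow> 'a set \<Rightarrow> 'a set" where
  "normal_closure G S = \<Inter>{N. N \<lhd> G \<and> S \<subseteq> N}"

definition edge_commutators ::
  "'v set \<Rightarrow> 'v set set \<Rightarrow> ('v \<Rightarrow> ('a, 'x) monoid_scheme) \<Rightarrow> ('v \<times> 'a) list set set" where
  "edge_commutators V E K = (let F = free_product V K; \<iota> = fp_incl V K in
     {inv\<^bsub>F\<^esub> (\<iota> u g) \<otimes>\<^bsub>F\<^esub> inv\<^bsub>F\<^esub> (\<iota> v h) \<otimes>\<^bsub>F\<^esub> \<iota> u g \<otimes>\<^bsub>F\<^esub> \<iota> v h | u v g h.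
        {u, v} \<in> E \<and> g \<in> carrier (K u) \<and> h \<in> carrier (K v)})"

abbreviation graph_product_kernel ::
  "'v set \<Rightarrow> 'v set set \<Rightarrow> ('v \<Rightarrow> ('a, 'x) monoid_scheme) \<Rightarrow> ('v \<times> 'a) list set set" where
  "graph_product_kernel V E K \<equiv> normal_closure (free_product V K) (edge_commutators V E K)"

definition graph_product ::
  "'v set \<Rightarrow> 'v set set \<Rightarrow> ('v \<Rightarrow> ('a, 'x) monoid_scheme) \<Rightarrow> ('v \<times> 'a) list set set monoid" where
  "graph_product V E K = free_product V K Mod graph_product_kernel V E K"

definition graph_product_incl ::
  "'v set \<Rightarrow> 'v set set \<Rightarrow> ('v \<Rightarrow> ('a, 'x) monoid_scheme) \<Rightarrow> 'v \<Rightarrow> 'a \<Rightarrow> ('v \<times> 'a) list set set" where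
  "graph_product_incl V E K v g =
     graph_product_kernel V E K #>\<^bsub>free_product V K\<^esub> fp_incl V K v g"

abbreviation subgroup_as_group ::
  "('a, 'x) monoid_scheme \<Rightarrow> 'a set \<Rightarrow> ('a, 'x) monoid_scheme" where
  "subgroup_as_group G H \<equiv> G\<lparr>carrier := H\<rparr>"

text \<open>The vertex groups generate the graph product (\<open>graph_product_hom_unique\<close> below), so there is
  at most one homomorphism \<open>\<phi>\<close> as in the following definition, namely the one induced by the
  inclusions.\<close>

definition internal_graph_product ::
  "('a, 'x) monoid_scheme \<Rightarrow> 'v set \<Rightarrow> 'v set set \<Rightarrow> ('v \<Rightarrow> 'a set) \<Rightarrow> bool" where
  "internal_graph_product G V E H \<longleftrightarrow>
     (\<forall>v\<in>V. subgroup (H v) G) \<and>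
     (let K = (\<lambda>v. subgroup_as_group G (H v)) in
      \<exists>\<phi> \<in> iso (graph_product V E K) G. \<forall>v\<in>V. \<forall>g\<in>H v. \<phi> (graph_product_incl V E K v g) = g)"


section \<open>Directly indecomposable groups\<close>

text \<open>The possible factors range over groups on the element type of \<open>G\<close>. This is no restriction,
  as each factor embeds into \<open>G\<close>; see \<open>not_directly_indecomposable\<close> below.\<close>

definition directly_indecomposable :: "('a, 'x) monoid_scheme \<Rightarrow> bool" where
  "directly_indecomposable G \<longleftrightarrow>
     group G \<and> carrier G \<noteq> {\<one>\<^bsub>G\<^esub>} \<and>
     \<not> (\<exists>(A :: 'a monoid) (B :: 'a monoid). group A \<and> group B \<and>
          carrier A \<noteq> {\<one>\<^bsub>A\<^esub>} \<and> carrier B \<noteq> {\<one>\<^bsub>B\<^esub>} \<and> G \<cong> A \<times>\<times> B)"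


section \<open>Basic properties\<close>

lemma fp_words_simps [simp]:
  "[] \<in> fp_words V K"
  "p # x \<in> fp_words V K \<longleftrightarrow> fst p \<in> V \<and> snd p \<in> carrier (K (fst p)) \<and> x \<in> fp_words V K"
  "x @ y \<in> fp_words V K \<longleftrightarrow> x \<in> fp_words V K \<and> y \<in> fp_words V K"
  by (cases p; auto simp: fp_words_def)+

lemma equiv_fp_eq: "equiv (fp_words V K) (fp_eq V K)"
proof (rule equivI)
  show "fp_eq V K \<subseteq> fp_words V K \<times> fp_words V K" "refl_on (fp_words V K) (fp_eq V K)"
    by (auto simp: fp_eq_def refl_on_def)
  show "sym (fp_eq V K)"
    by (rule symI) (metis (no_types, lifting) case_prodD case_prodI equivclp_sym fp_eq_def mem_Collect_eq)
  show "trans (fp_eq V K)"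
    by (rule transI) (metis (no_types, lifting) case_prodD case_prodI equivclp_trans fp_eq_def mem_Collect_eq)
qed

lemma fp_eq_append:
  assumes "(x, x') \<in> fp_eq V K" "(y, y') \<in> fp_eq V K"
  shows "(x @ y, x' @ y') \<in> fp_eq V K"
proof -
  have step_ctx: "fp_step V K (p @ a @ q) (p @ b @ q)"
    if "fp_step V K a b" "p \<in> fp_words V K" "q \<in> fp_words V K" for a b p q
    using that(1)
  proof cases
    case (unit v x y)
    then show ?thesis using fp_step.unit[of v V "p @ x" K "y @ q"] that by simp
  next
    case (mult v g h x y)
    then show ?thesis using fp_step.mult[of v V g K h "p @ x" "y @ q"] that by simp
  qed
  have ctx: "equivclp (fp_step V K) (p @ a @ q) (p @ b @ q)"
    if "equivclp (fp_step V K) a b" "p \<in> fp_words V K" "q \<in> fp_words V K" for a b p q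
    using that(1)
  proof (induction rule: equivclp_induct)
    case base
    then show ?case by simp
  next
    case (step b c)
    then show ?case
      using \<open>p \<in> fp_words V K\<close> \<open>q \<in> fp_words V K\<close>
      by (meson step_ctx equivclp_into_equivclp)
  qed
  show ?thesis
    using assms ctx[of x x' "[]" y] ctx[of y y' x' "[]"]
    by (auto simp: fp_eq_def intro: equivclp_trans)
qed

lemma fp_mult_class:
  assumes "x \<in> fp_words V K" "y \<in> fp_words V K"
  shows "fp_eq V K `` {x} \<otimes>\<^bsub>free_product V K\<^esub> fp_eq V K `` {y} = fp_eq V K `` {x @ y}"
proof -
  let ?X = "fp_eq V K `` {x}" and ?Y = "fp_eq V K `` {y}"
  have eq: "fp_eq V K `` {x' @ y'} = fp_eq V K `` {x @ y}" if "x' \<in> ?X" "y' \<in> ?Y" for x' y'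
    using equiv_class_eq[OF equiv_fp_eq fp_eq_append, of x x' V K y y'] that by simp
  have ne: "?X \<noteq> {}" "?Y \<noteq> {}"
    using assms equiv_class_self[OF equiv_fp_eq] by fast+
  have "(\<Union>x'\<in>?X. \<Union>y'\<in>?Y. fp_eq V K `` {x' @ y'}) =
      (\<Union>x'\<in>?X. \<Union>y'\<in>?Y. fp_eq V K `` {x @ y})"
    by (intro SUP_cong refl eq)
  also have "\<dots> = fp_eq V K `` {x @ y}"
    using ne by (simp only: UN_constant if_False)
  finally show ?thesis
    by (simp only: free_product_def monoid.simps)
qed

lemma fp_carrierE:
  assumes "X \<in> carrier (free_product V K)"
  obtains x where "x \<in> fp_words V K" "X = fp_eq V K `` {x}"
  using assms by (auto simp: free_product_def elim: quotientE)

lemma fp_class_in_carrier [intro]: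
  "x \<in> fp_words V K \<Longrightarrow> fp_eq V K `` {x} \<in> carrier (free_product V K)"
  by (simp add: free_product_def quotientI)

lemma fp_one: "\<one>\<^bsub>free_product V K\<^esub> = fp_eq V K `` {[]}"
  by (simp add: free_product_def)

lemma fp_eq_step: "fp_step V K x y \<Longrightarrow> x \<in> fp_words V K \<Longrightarrow> y \<in> fp_words V K
    \<Longrightarrow> fp_eq V K `` {x} = fp_eq V K `` {y}"
  by (rule equiv_class_eq[OF equiv_fp_eq]) (auto simp: fp_eq_def)

lemma fp_incl_mult:
  assumes "v \<in> V" "group (K v)" "g \<in> carrier (K v)" "h \<in> carrier (K v)"
  shows "fp_incl V K v g \<otimes>\<^bsub>free_product V K\<^esub> fp_incl V K v h = fp_incl V K v (g \<otimes>\<^bsub>K v\<^esub> h)"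
proof -
  interpret group "K v" by fact
  show ?thesis
    using assms fp_mult_class[of "[(v, g)]" V K "[(v, h)]"]
      fp_eq_step[OF fp_step.mult[of v V g K h "[]" "[]"]]
    by (simp add: fp_incl_def)
qed

lemma fp_incl_one:
  assumes "v \<in> V" "group (K v)"
  shows "fp_incl V K v \<one>\<^bsub>K v\<^esub> = \<one>\<^bsub>free_product V K\<^esub>"
proof -
  interpret group "K v" by fact
  show ?thesis
    using assms fp_eq_step[OF fp_step.unit[of v V "[]" K "[]"]]
    by (simp add: fp_incl_def fp_one)
qed

lemma fp_incl_closed:
  "v \<in> V \<Longrightarrow> g \<in> carrier (K v) \<Longrightarrow> fp_incl V K v g \<in> carrier (free_product V K)"
  unfolding fp_incl_def by (rule fp_class_in_carrier) simp

lemma fp_class_Cons: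
  "v \<in> V \<Longrightarrow> g \<in> carrier (K v) \<Longrightarrow> x \<in> fp_words V K \<Longrightarrow>
    fp_eq V K `` {(v, g) # x} = fp_incl V K v g \<otimes>\<^bsub>free_product V K\<^esub> fp_eq V K `` {x}"
  using fp_mult_class[of "[(v, g)]" V K x] by (simp add: fp_incl_def)

lemma monoid_free_product: "monoid (free_product V K)"
proof (rule monoidI)
  fix X Y Z assume "X \<in> carrier (free_product V K)" "Y \<in> carrier (free_product V K)"
    "Z \<in> carrier (free_product V K)"
  then show "X \<otimes>\<^bsub>free_product V K\<^esub> Y \<otimes>\<^bsub>free_product V K\<^esub> Z =
      X \<otimes>\<^bsub>free_product V K\<^esub> (Y \<otimes>\<^bsub>free_product V K\<^esub> Z)"
    by (auto elim!: fp_carrierE simp: fp_mult_class)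
qed (auto elim!: fp_carrierE simp: fp_mult_class fp_one intro!: fp_class_in_carrier)

lemma group_free_product:
  assumes "\<And>v. v \<in> V \<Longrightarrow> group (K v)"
  shows "group (free_product V K)"
proof -
  let ?F = "free_product V K"
  interpret F: monoid ?F by (rule monoid_free_product)
  have units: "fp_eq V K `` {x} \<in> Units ?F" if "x \<in> fp_words V K" for x
    using that
  proof (induction x)
    case Nil
    then show ?case using F.Units_one_closed by (simp add: fp_one)
  next
    case (Cons p x)
    obtain v g where p: "p = (v, g)" by force
    have v: "v \<in> V" "g \<in> carrier (K v)" and x: "x \<in> fp_words V K" using Cons.prems p by auto
    interpret Kv: group "K v" using assms v by simp
    have "fp_incl V K v g \<otimes>\<^bsub>?F\<^esub> fp_incl V K v (inv\<^bsub>K v\<^esub> g) = \<one>\<^bsub>?F\<^esub>"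
      "fp_incl V K v (inv\<^bsub>K v\<^esub> g) \<otimes>\<^bsub>?F\<^esub> fp_incl V K v g = \<one>\<^bsub>?F\<^esub>"
      using v Kv.group_axioms by (simp_all add: fp_incl_mult fp_incl_one)
    then have "fp_incl V K v g \<in> Units ?F"
      unfolding Units_def using v by (auto intro!: fp_incl_closed)
    then show ?case
      unfolding p fp_class_Cons[OF v x] using Cons.IH[OF x] by (rule F.Units_m_closed)
  qed
  show ?thesis
    by unfold_locales (auto elim!: fp_carrierE intro: units)
qed

text \<open>The universal property of the free product.\<close>

lemma free_product_hom_unique:
  assumes "monoid G" "\<And>v. v \<in> V \<Longrightarrow> group (K v)"
    and "f \<in> hom (free_product V K) G" "f' \<in> hom (free_product V K) G"
    and "f \<one>\<^bsub>free_product V K\<^esub> = f' \<one>\<^bsub>free_product V K\<^esub>"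
    and "\<And>v g. v \<in> V \<Longrightarrow> g \<in> carrier (K v) \<Longrightarrow> f (fp_incl V K v g) = f' (fp_incl V K v g)"
    and "X \<in> carrier (free_product V K)"
  shows "f X = f' X"
proof -
  have "f (fp_eq V K `` {x}) = f' (fp_eq V K `` {x})" if "x \<in> fp_words V K" for x
    using that
  proof (induction x)
    case Nil
    then show ?case using assms(5) by (simp add: fp_one)
  next
    case (Cons p x)
    obtain v g where p: "p = (v, g)" by force
    with Cons have "v \<in> V" "g \<in> carrier (K v)" "x \<in> fp_words V K" by auto
    with Cons assms p show ?case
      by (simp add: fp_class_Cons hom_mult fp_incl_closed fp_class_in_carrier)
  qed
  then show ?thesis using assms(7) by (auto elim!: fp_carrierE)
qed

lemma free_product_hom_exists:
  assumes "group G" "\<And>v. v \<in> V \<Longrightarrow> group (K v)" "\<And>v. v \<in> V \<Longrightarrow> f v \<in> hom (K v) G"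
  shows "\<exists>\<phi> \<in> hom (free_product V K) G. \<forall>v\<in>V. \<forall>g\<in>carrier (K v). \<phi> (fp_incl V K v g) = f v g"
proof -
  interpret G: group G by fact
  define ev where "ev x = foldr (\<lambda>(v, g) a. f v g \<otimes>\<^bsub>G\<^esub> a) x \<one>\<^bsub>G\<^esub>" for x
  have fcl: "f v g \<in> carrier G" if "v \<in> V" "g \<in> carrier (K v)" for v g
    using assms(3)[OF that(1)] that by (auto simp: hom_def)
  have ev_cl: "ev x \<in> carrier G" if "x \<in> fp_words V K" for x
    using that by (induction x) (auto simp: ev_def fcl)
  have ev_app: "ev (x @ y) = ev x \<otimes>\<^bsub>G\<^esub> ev y"
    if "x \<in> fp_words V K" "y \<in> fp_words V K" for x y
    using that(1)
  proof (induction x)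
    case Nil
    then show ?case using ev_cl[OF that(2)] by (simp add: ev_def)
  next
    case (Cons p x)
    then show ?case using ev_cl[of x] ev_cl[OF that(2)] fcl[of "fst p" "snd p"]
      by (cases p) (simp add: ev_def G.m_assoc)
  qed
  have ev_step: "ev x = ev y" if "fp_step V K x y" for x y
    using that
  proof cases
    case (unit v a b)
    interpret Kv: group "K v" using assms unit by simp
    have "f v \<one>\<^bsub>K v\<^esub> = \<one>\<^bsub>G\<^esub>"
      using hom_one[OF assms(3)] unit Kv.group_axioms assms(1) by blast
    then have "ev [(v, \<one>\<^bsub>K v\<^esub>)] = \<one>\<^bsub>G\<^esub>" by (simp add: ev_def)
    moreover have "ev ([(v, \<one>\<^bsub>K v\<^esub>)] @ b) = ev [(v, \<one>\<^bsub>K v\<^esub>)] \<otimes>\<^bsub>G\<^esub> ev b"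
      using unit by (intro ev_app) auto
    ultimately have "ev ([(v, \<one>\<^bsub>K v\<^esub>)] @ b) = ev b" using ev_cl[of b] unit by simp
    then show ?thesis using unit ev_app[of a "[(v, \<one>\<^bsub>K v\<^esub>)] @ b"] ev_app[of a b] by simp
  next
    case (mult v g h a b)
    interpret Kv: group "K v" using assms mult by simp
    have "ev [(v, g), (v, h)] = ev [(v, g \<otimes>\<^bsub>K v\<^esub> h)]"
      using mult fcl[of v g] fcl[of v h] hom_mult[OF assms(3)]
      by (simp add: ev_def)
    then have "ev ([(v, g), (v, h)] @ b) = ev ([(v, g \<otimes>\<^bsub>K v\<^esub> h)] @ b)"
      using mult ev_app[of "[(v, g), (v, h)]" b] ev_app[of "[(v, g \<otimes>\<^bsub>K v\<^esub> h)]" b] by simp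
    then show ?thesis
      using mult ev_app[of a "[(v, g), (v, h)] @ b"] ev_app[of a "[(v, g \<otimes>\<^bsub>K v\<^esub> h)] @ b"] by simp
  qed
  have ev_eq: "ev x = ev y" if "(x, y) \<in> fp_eq V K" for x y
  proof -
    have "equivclp (fp_step V K) x y" using that by (simp add: fp_eq_def)
    then show ?thesis by (induction rule: equivclp_induct) (auto dest: ev_step)
  qed
  define \<phi> where "\<phi> X = ev (SOME x. x \<in> X)" for X
  have \<phi>: "\<phi> (fp_eq V K `` {x}) = ev x" if "x \<in> fp_words V K" for x
  proof -
    have "x \<in> fp_eq V K `` {x}" using that by (auto simp: fp_eq_def)
    then have "(SOME y. y \<in> fp_eq V K `` {x}) \<in> fp_eq V K `` {x}" by (rule someI)
    then show ?thesis unfolding \<phi>_def using ev_eq by force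
  qed
  have "\<phi> \<in> hom (free_product V K) G"
    by (rule homI) (auto elim!: fp_carrierE simp: \<phi> ev_cl fp_mult_class ev_app)
  moreover have "\<phi> (fp_incl V K v g) = f v g" if "v \<in> V" "g \<in> carrier (K v)" for v g
    unfolding fp_incl_def using that by (subst \<phi>) (auto simp: ev_def fcl)
  ultimately show ?thesis by blast
qed

lemma (in group) normal_carrier: "carrier G \<lhd> G"
  by (simp add: normal_inv_iff subgroup_self)

lemma (in group) normal_closure_normal:
  assumes "S \<subseteq> carrier G"
  shows "normal_closure G S \<lhd> G"
proof -
  have "carrier G \<in> {N. N \<lhd> G \<and> S \<subseteq> N}" using assms normal_carrier by simp
  then have "subgroup (normal_closure G S) G"
    unfolding normal_closure_def
    by (intro subgroups_Inter) (auto simp: normal_imp_subgroup)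
  then show ?thesis
    unfolding normal_inv_iff by (auto simp: normal_closure_def normal_inv_iff)
qed

lemma edge_commutators_closed:
  assumes "is_graph V E" "\<And>v. v \<in> V \<Longrightarrow> group (K v)"
  shows "edge_commutators V E K \<subseteq> carrier (free_product V K)"
proof -
  interpret F: group "free_product V K" using assms(2) by (rule group_free_product)
  have "u \<in> V \<and> v \<in> V" if "{u, v} \<in> E" for u v
    using assms(1) that by (auto simp: is_graph_def)
  then show ?thesis
    unfolding edge_commutators_def Let_def by (auto intro!: fp_incl_closed F.m_closed F.inv_closed)
qed

lemma graph_product_kernel_normal:
  assumes "is_graph V E" "\<And>v. v \<in> V \<Longrightarrow> group (K v)"
  shows "graph_product_kernel V E K \<lhd> free_product V K"
  by (intro group.normal_closure_normal group_free_product edge_commutators_closed assms)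

lemma group_graph_product:
  assumes "is_graph V E" "\<And>v. v \<in> V \<Longrightarrow> group (K v)"
  shows "group (graph_product V E K)"
  unfolding graph_product_def
  by (intro normal.factorgroup_is_group graph_product_kernel_normal assms)

lemma graph_product_hom_unique:
  assumes "is_graph V E" "\<And>v. v \<in> V \<Longrightarrow> group (K v)" "group G"
    and "f \<in> hom (graph_product V E K) G" "f' \<in> hom (graph_product V E K) G"
    and "\<And>v g. v \<in> V \<Longrightarrow> g \<in> carrier (K v) \<Longrightarrow>
      f (graph_product_incl V E K v g) = f' (graph_product_incl V E K v g)"
    and "X \<in> carrier (graph_product V E K)"
  shows "f X = f' X"
proof -
  let ?F = "free_product V K" and ?N = "graph_product_kernel V E K"
  have "?N \<lhd> ?F" by (intro graph_product_kernel_normal assms(1,2))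
  then interpret N: normal ?N ?F .
  interpret G: group G by fact
  have q: "(\<lambda>x. ?N #>\<^bsub>?F\<^esub> x) \<in> hom ?F (graph_product V E K)"
    unfolding graph_product_def by (rule N.r_coset_hom_Mod)
  have comp: "h \<circ> (\<lambda>x. ?N #>\<^bsub>?F\<^esub> x) \<in> hom ?F G" if "h \<in> hom (graph_product V E K) G" for h
    using q that by (rule hom_compose)
  obtain x where x: "x \<in> carrier ?F" "X = ?N #>\<^bsub>?F\<^esub> x"
    using assms(7) by (auto simp: graph_product_def FactGroup_def RCOSETS_def)
  have "(f \<circ> (\<lambda>x. ?N #>\<^bsub>?F\<^esub> x)) x = (f' \<circ> (\<lambda>x. ?N #>\<^bsub>?F\<^esub> x)) x"
  proof (rule free_product_hom_unique[OF G.is_monoid assms(2) comp[OF assms(4)] comp[OF assms(5)]])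
    show "(f \<circ> (\<lambda>x. ?N #>\<^bsub>?F\<^esub> x)) \<one>\<^bsub>?F\<^esub> = (f' \<circ> (\<lambda>x. ?N #>\<^bsub>?F\<^esub> x)) \<one>\<^bsub>?F\<^esub>"
      using hom_one[OF comp[OF assms(4)] N.is_group assms(3)]
        hom_one[OF comp[OF assms(5)] N.is_group assms(3)] by simp
  qed (use assms(6) x(1) in \<open>simp_all add: graph_product_incl_def\<close>)
  then show ?thesis by (simp add: x)
qed

lemma not_directly_indecomposable:
  fixes G :: "('a, 'x) monoid_scheme" and A :: "('b, 'y) monoid_scheme" and B :: "('c, 'z) monoid_scheme"
  assumes "group A" "group B" "carrier A \<noteq> {\<one>\<^bsub>A\<^esub>}" "carrier B \<noteq> {\<one>\<^bsub>B\<^esub>}"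
    and "G \<cong> A \<times>\<times> B"
  shows "\<not> directly_indecomposable G"
proof
  assume ind: "directly_indecomposable G"
  then interpret G: group G by (simp add: directly_indecomposable_def)
  interpret A: group A by fact
  interpret B: group B by fact
  interpret AB: group "A \<times>\<times> B" by (intro DirProd_group assms)
  obtain f where f: "f \<in> iso (A \<times>\<times> B) G"
    using G.iso_sym[OF assms(5)] by (auto simp: is_iso_def)
  then have fh: "f \<in> hom (A \<times>\<times> B) G" and inj: "inj_on f (carrier A \<times> carrier B)"
    by (auto simp: iso_def bij_betw_def)
  define i j where "i a = f (a, \<one>\<^bsub>B\<^esub>)" and "j b = f (\<one>\<^bsub>A\<^esub>, b)" for a b
  have ih: "i \<in> hom A G" and jh: "j \<in> hom B G"
    using hom_mult[OF fh, of "(_, \<one>\<^bsub>B\<^esub>)" "(_, \<one>\<^bsub>B\<^esub>)"] hom_mult[OF fh, of "(\<one>\<^bsub>A\<^esub>, _)" "(\<one>\<^bsub>A\<^esub>, _)"]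
      hom_in_carrier[OF fh]
    by (auto intro!: homI simp: i_def j_def)
  have iinj: "inj_on i (carrier A)" and jinj: "inj_on j (carrier B)"
    by (auto intro!: inj_onI simp: i_def j_def dest!: inj_onD[OF inj])
  define A' B' :: "'a monoid" where
    "A' = \<lparr>carrier = i ` carrier A, mult = mult G, one = \<one>\<^bsub>G\<^esub>\<rparr>" and
    "B' = \<lparr>carrier = j ` carrier B, mult = mult G, one = \<one>\<^bsub>G\<^esub>\<rparr>"
  have iso: "i \<in> iso A A'" "j \<in> iso B B'"
    using ih jh iinj jinj by (auto simp: iso_def hom_def bij_betw_def A'_def B'_def)
  have one: "i \<one>\<^bsub>A\<^esub> = \<one>\<^bsub>G\<^esub>" "j \<one>\<^bsub>B\<^esub> = \<one>\<^bsub>G\<^esub>"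
    using hom_one[OF ih A.group_axioms G.group_axioms] hom_one[OF jh B.group_axioms G.group_axioms]
    by auto
  have grp: "group A'" "group B'"
    using A.iso_imp_img_group[OF iso(1)] B.iso_imp_img_group[OF iso(2)] one
    by (simp_all add: A'_def B'_def)
  have nt: "carrier A' \<noteq> {\<one>\<^bsub>A'\<^esub>}" "carrier B' \<noteq> {\<one>\<^bsub>B'\<^esub>}"
  proof -
    obtain a where "a \<in> carrier A" "a \<noteq> \<one>\<^bsub>A\<^esub>" using assms(3) A.one_closed by blast
    then have "i a \<noteq> \<one>\<^bsub>G\<^esub>" using iinj one by (metis A.one_closed inj_onD)
    with \<open>a \<in> carrier A\<close> show "carrier A' \<noteq> {\<one>\<^bsub>A'\<^esub>}" by (auto simp: A'_def)
    obtain b where "b \<in> carrier B" "b \<noteq> \<one>\<^bsub>B\<^esub>" using assms(4) B.one_closed by blast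
    then have "j b \<noteq> \<one>\<^bsub>G\<^esub>" using jinj one by (metis B.one_closed inj_onD)
    with \<open>b \<in> carrier B\<close> show "carrier B' \<noteq> {\<one>\<^bsub>B'\<^esub>}" by (auto simp: B'_def)
  qed
  have "A \<times>\<times> B \<cong> A' \<times>\<times> B'"
    using A.DirProd_iso_set_trans[OF iso] unfolding is_iso_def by blast
  then have "G \<cong> A' \<times>\<times> B'" using assms(5) iso_trans by blast
  with grp nt ind show False unfolding directly_indecomposable_def by blast
qed

end

theory Submission
  imports Defs "HOL-Algebra.Generated_Groups" "HOL-Algebra.Bij"
begin

text \<open>Every finite subgroup of a graph product is conjugate into the subgroup \<open>G\<^bsub>C\<^esub>\<close> of a clique \<open>C\<close>. This
  is proved by induction on the graph: if some vertex \<open>v\<close> is not adjacent to all others, the group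
  acts on a tree-like space with vertex stabilizers conjugate to \<open>G\<^bsub>V - v\<^esub>\<close>, and a finite subgroup
  preserves the clique of centers of an orbit, so it is conjugate into \<open>G\<^bsub>V - v\<^esub>\<close> or into the star of \<open>v\<close>.
  With the retractions onto vertex groups it follows that the maximal cliques of the two graphs
  correspond to each other (conjugacy classes of maximal finite subgroups), and that for any set of
  maximal cliques the intersection \<open>I\<close> and the intersection \<open>I'\<close> of the corresponding cliques
  satisfy \<open>G\<^bsub>I\<^esub> \<cong> G\<^bsub>I'\<^esub>\<close>. By the Krull--Schmidt theorem \<open>I\<close> and \<open>I'\<close> contain equally many vertices
  whose group has a given isomorphism type. Inclusion-exclusion then gives equally many vertices
  of each type lying in exactly a given set of maximal cliques. A bijection matching these data is
  an isomorphism, since two vertices are adjacent iff they share a maximal clique.\<close>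

section \<open>Uniqueness of direct decompositions of finite groups\<close>

text \<open>A vertex group of one graph need not be conjugate to a vertex group of the other:
  already a product of two groups of order two has several decompositions. So no vertex map can be
  read off from conjugation; only multiplicities of isomorphism types survive, and the graph
  isomorphism has to come from counting. A second obstacle is that matched cliques are conjugate by
  elements depending on the clique, so their intersections are not conjugate for free. The
  retractions settle this, since whether \<open>\<rho> v\<close> kills an element is unaffected by
  conjugation. For the same reason a conjugate of \<open>gen C\<close> lies in \<open>gen D\<close>
  only if \<open>C \<subseteq> D\<close>. Finiteness enters once more at the end of each comparison:
  conjugation into each other in both directions becomes equality by comparing cardinalities. No
  normal form theorem is assumed; what is known about \<open>G\<close> beyond generation and
  commutation comes from the universal property, used once for the retractions and once for an
  action on words.\<close>

lemma iterate_idempotent: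
  assumes "finite A" "f \<in> A \<rightarrow> A"
  shows "\<exists>n>0. \<forall>x\<in>A. (f ^^ n) ((f ^^ n) x) = (f ^^ n) x"
proof -
  have cl: "(f ^^ n) x \<in> A" if "x \<in> A" for n x
    using assms(2) that by (induction n) auto
  \<comment> \<open>Restriction to \<open>A\<close> puts the powers into a finite set of extensional
    functions, so two of them coincide.\<close>
  have "range (\<lambda>n. restrict (f ^^ n) A) \<subseteq> A \<rightarrow>\<^sub>E A"
    using cl by auto
  then have "finite (range (\<lambda>n. restrict (f ^^ n) A))"
    using assms(1) by (meson finite_PiE finite_subset)
  then have "\<not> inj (\<lambda>n. restrict (f ^^ n) A)"
    using finite_imageD by blast
  then obtain i j where ij: "i < j" "restrict (f ^^ i) A = restrict (f ^^ j) A"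
    by (metis (mono_tags, lifting) injI linorder_neqE_nat)
  define p where "p = j - i"
  have p: "p > 0" "j = p + i" using ij by (auto simp: p_def)
  have eq: "(f ^^ (p + m)) x = (f ^^ m) x" if "m \<ge> i" "x \<in> A" for m x
  proof -
    have e: "(f ^^ j) x = (f ^^ i) x"
      using ij(2) that(2) by (metis restrict_apply')
    define d where "d = m - i"
    have d: "m = d + i" using that(1) by (simp add: d_def)
    have "(f ^^ (p + m)) x = (f ^^ (d + j)) x"
      by (simp add: d p add.left_commute)
    also have "\<dots> = (f ^^ d) ((f ^^ j) x)" by (simp add: funpow_add)
    also have "\<dots> = (f ^^ m) x" by (simp add: e d funpow_add)
    finally show ?thesis .
  qed
  have eqk: "(f ^^ (k * p + m)) x = (f ^^ m) x" if "m \<ge> i" "x \<in> A" for k m x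
  proof (induction k)
    case (Suc k)
    have "(f ^^ (p + (k * p + m))) x = (f ^^ (k * p + m)) x"
      by (rule eq) (use that in auto)
    with Suc show ?case by (simp add: algebra_simps)
  qed simp
  \<comment> \<open>The exponent must be a multiple of the period \<open>p\<close>, at least the
    preperiod \<open>i\<close>, and positive; the factor \<open>i + 1\<close> covers
    \<open>i = 0\<close>.\<close>
  have "(i + 1) * p \<ge> i" using p(1) by (cases p) auto
  then have "(f ^^ ((i + 1) * p)) ((f ^^ ((i + 1) * p)) x) = (f ^^ ((i + 1) * p)) x" if "x \<in> A" for x
    using eqk[of "(i + 1) * p" x "i + 1"] that by (simp add: funpow_add)
  moreover have "(i + 1) * p > 0" using p(1) by simp
  ultimately show ?thesis by blast
qed

text \<open>An idempotent splits \<open>A\<close> into kernel and image; commuting with inner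
  automorphisms makes the two commute elementwise, so the splitting is a direct product and one
  factor is trivial.\<close>

lemma idempotent_normal_endomorphism:
  assumes ind: "directly_indecomposable A" and e: "e \<in> hom A A"
    and nrm: "\<And>x y. x \<in> carrier A \<Longrightarrow> y \<in> carrier A \<Longrightarrow>
      e (x \<otimes>\<^bsub>A\<^esub> y \<otimes>\<^bsub>A\<^esub> inv\<^bsub>A\<^esub> x) = x \<otimes>\<^bsub>A\<^esub> e y \<otimes>\<^bsub>A\<^esub> inv\<^bsub>A\<^esub> x"
    and idem: "\<And>x. x \<in> carrier A \<Longrightarrow> e (e x) = e x"
  shows "inj_on e (carrier A) \<or> (\<forall>x\<in>carrier A. e x = \<one>\<^bsub>A\<^esub>)"
proof (rule ccontr)
  assume contr: "\<not> ?thesis"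
  interpret A: group A using ind by (simp add: directly_indecomposable_def)
  interpret e: group_hom A A e
    using e by (simp add: group_hom_def group_hom_axioms_def A.group_axioms)
  let ?K = "A\<lparr>carrier := kernel A A e\<rparr>" and ?I = "A\<lparr>carrier := e ` carrier A\<rparr>"
  have gK: "group ?K"
    by (intro subgroup.subgroup_is_group e.subgroup_kernel A.group_axioms)
  have gI: "group ?I"
    by (intro subgroup.subgroup_is_group e.img_is_subgroup A.group_axioms)
  have tK: "carrier ?K \<noteq> {\<one>\<^bsub>?K\<^esub>}"
    using contr e.inj_iff_trivial_ker by auto
  have tI: "carrier ?I \<noteq> {\<one>\<^bsub>?I\<^esub>}"
    using contr by auto
  have comm: "k \<otimes>\<^bsub>A\<^esub> e y = e y \<otimes>\<^bsub>A\<^esub> k" if "k \<in> kernel A A e" "y \<in> carrier A" for k y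
  proof -
    have k: "k \<in> carrier A" "e k = \<one>\<^bsub>A\<^esub>" using that by (auto simp: kernel_def)
    have "k \<otimes>\<^bsub>A\<^esub> e y \<otimes>\<^bsub>A\<^esub> inv\<^bsub>A\<^esub> k = e (k \<otimes>\<^bsub>A\<^esub> y \<otimes>\<^bsub>A\<^esub> inv\<^bsub>A\<^esub> k)"
      using that k(1) by (simp only: nrm)
    also have "\<dots> = e y" using k that by simp
    finally show ?thesis using k that by (metis A.inv_solve_right A.m_closed e.hom_closed)
  qed
  have "(\<lambda>(k, y). k \<otimes>\<^bsub>A\<^esub> y) \<in> iso (?K \<times>\<times> ?I) A"
  proof (rule isoI)
    show "(\<lambda>(k, y). k \<otimes>\<^bsub>A\<^esub> y) \<in> hom (?K \<times>\<times> ?I) A"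
    proof (rule homI)
      fix p q assume p: "p \<in> carrier (?K \<times>\<times> ?I)" "q \<in> carrier (?K \<times>\<times> ?I)"
      obtain k y l z where pq: "p = (k, e y)" "q = (l, e z)" "k \<in> kernel A A e" "l \<in> kernel A A e"
        "y \<in> carrier A" "z \<in> carrier A"
        using p by auto
      then have "k \<in> carrier A" "l \<in> carrier A" by (auto simp: kernel_def)
      with pq comm[of l y] show "(case p \<otimes>\<^bsub>?K \<times>\<times> ?I\<^esub> q of (k, y) \<Rightarrow> k \<otimes>\<^bsub>A\<^esub> y) =
          (case p of (k, y) \<Rightarrow> k \<otimes>\<^bsub>A\<^esub> y) \<otimes>\<^bsub>A\<^esub> (case q of (k, y) \<Rightarrow> k \<otimes>\<^bsub>A\<^esub> y)"
        by (simp add: A.m_assoc) (metis A.m_assoc e.hom_closed)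
    qed (auto simp: kernel_def)
    show "bij_betw (\<lambda>(k, y). k \<otimes>\<^bsub>A\<^esub> y) (carrier (?K \<times>\<times> ?I)) (carrier A)"
    proof (rule bij_betw_byWitness[where f' = "\<lambda>x. (x \<otimes>\<^bsub>A\<^esub> inv\<^bsub>A\<^esub> (e x), e x)"])
      show "\<forall>p\<in>carrier (?K \<times>\<times> ?I). (\<lambda>x. (x \<otimes>\<^bsub>A\<^esub> inv\<^bsub>A\<^esub> (e x), e x)) (case p of (k, y) \<Rightarrow> k \<otimes>\<^bsub>A\<^esub> y) = p"
        by (auto simp: kernel_def idem A.m_assoc)
      show "\<forall>x\<in>carrier A. (case (x \<otimes>\<^bsub>A\<^esub> inv\<^bsub>A\<^esub> (e x), e x) of (k, y) \<Rightarrow> k \<otimes>\<^bsub>A\<^esub> y) = x"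
        by (auto simp: A.m_assoc)
    qed (auto simp: kernel_def idem)
  qed
  then have "A \<cong> ?K \<times>\<times> ?I"
    using is_isoI group.iso_sym[OF DirProd_group[OF gK gI]] by blast
  with not_directly_indecomposable[OF gK gI tK tI] ind show False by blast
qed

text \<open>Some positive power of \<open>f\<close> is idempotent and still commutes with inner
  automorphisms, so it is injective or trivial; injectivity passes from the power down to
  \<open>f\<close>.\<close>

lemma Fitting_dichotomy:
  assumes ind: "directly_indecomposable A" and fin: "finite (carrier A)" and f: "f \<in> hom A A"
    and nrm: "\<And>x y. x \<in> carrier A \<Longrightarrow> y \<in> carrier A \<Longrightarrow>
      f (x \<otimes>\<^bsub>A\<^esub> y \<otimes>\<^bsub>A\<^esub> inv\<^bsub>A\<^esub> x) = x \<otimes>\<^bsub>A\<^esub> f y \<otimes>\<^bsub>A\<^esub> inv\<^bsub>A\<^esub> x"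
  shows "inj_on f (carrier A) \<or> (\<exists>n. \<forall>x\<in>carrier A. (f ^^ n) x = \<one>\<^bsub>A\<^esub>)"
proof -
  have fcl: "f \<in> carrier A \<rightarrow> carrier A" using f by (simp add: hom_def)
  obtain n where n: "n > 0" "\<And>x. x \<in> carrier A \<Longrightarrow> (f ^^ n) ((f ^^ n) x) = (f ^^ n) x"
    using iterate_idempotent[OF fin fcl] by blast
  have cl: "(f ^^ m) x \<in> carrier A" if "x \<in> carrier A" for m x
    using fcl that by (induction m) auto
  have hom: "f ^^ m \<in> hom A A" for m
  proof (rule homI)
    show "(f ^^ m) (x \<otimes>\<^bsub>A\<^esub> y) = (f ^^ m) x \<otimes>\<^bsub>A\<^esub> (f ^^ m) y" if "x \<in> carrier A" "y \<in> carrier A" for x y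
      using that by (induction m) (simp_all add: cl hom_mult[OF f])
  qed (rule cl)
  have "(f ^^ m) (x \<otimes>\<^bsub>A\<^esub> y \<otimes>\<^bsub>A\<^esub> inv\<^bsub>A\<^esub> x) = x \<otimes>\<^bsub>A\<^esub> (f ^^ m) y \<otimes>\<^bsub>A\<^esub> inv\<^bsub>A\<^esub> x"
    if "x \<in> carrier A" "y \<in> carrier A" for m x y
    using that by (induction m) (simp_all add: cl nrm)
  from idempotent_normal_endomorphism[OF ind hom this n(2)]
  show ?thesis
  proof
    assume inj: "inj_on (f ^^ n) (carrier A)"
    have "inj_on f (carrier A)"
    proof (rule inj_onI)
      fix x y assume "x \<in> carrier A" "y \<in> carrier A" "f x = f y"
      moreover have "(f ^^ n) z = (f ^^ (n - 1)) (f z)" for z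
        using n(1) by (cases n) (simp_all add: funpow_swap1)
      ultimately show "x = y" using inj by (metis inj_onD)
    qed
    then show ?thesis ..
  next
    assume "\<forall>x\<in>carrier A. (f ^^ n) x = \<one>\<^bsub>A\<^esub>"
    then show ?thesis by blast
  qed
qed

lemma DirProd_trivial_iso:
  assumes "group A" "group B" "carrier A = {\<one>\<^bsub>A\<^esub>}"
  shows "A \<times>\<times> B \<cong> B"
proof -
  interpret A: group A by fact
  interpret B: group B by fact
  have "snd \<in> iso (A \<times>\<times> B) B"
    using assms(3) by (intro isoI homI) (auto simp: bij_betw_def inj_on_def image_def mult_DirProd')
  then show ?thesis by (rule is_isoI)
qed

section \<open>Cancelling an indecomposable factor from a product of two groups\<close>

locale product_iso = A: group A + B: group B + C: group C + D: group D
  for A :: "('a, 'k) monoid_scheme" and B :: "('b, 'l) monoid_scheme"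
    and C :: "('c, 'm) monoid_scheme" and D :: "('d, 'n) monoid_scheme" +
  fixes f and g
  assumes f_hom: "f \<in> hom (A \<times>\<times> B) (C \<times>\<times> D)"
    and g_hom: "g \<in> hom (C \<times>\<times> D) (A \<times>\<times> B)"
    and g_f: "p \<in> carrier (A \<times>\<times> B) \<Longrightarrow> g (f p) = p"
    and f_g: "q \<in> carrier (C \<times>\<times> D) \<Longrightarrow> f (g q) = q"
begin

text \<open>Matrix entries of the isomorphism and its inverse: \<open>\<alpha>\<close> and
  \<open>\<delta>\<close> are the components of \<open>f\<close> on \<open>A\<close>, while
  \<open>\<gamma>\<close> and \<open>\<epsilon>\<close> are the \<open>A\<close> components of
  \<open>g\<close> on \<open>C\<close> and on \<open>D\<close>.\<close>

definition "\<alpha> a = fst (f (a, \<one>\<^bsub>B\<^esub>))"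
definition "\<delta> a = snd (f (a, \<one>\<^bsub>B\<^esub>))"
definition "\<gamma> c = fst (g (c, \<one>\<^bsub>D\<^esub>))"
definition "\<epsilon> d = fst (g (\<one>\<^bsub>C\<^esub>, d))"

lemma f_closed: "a \<in> carrier A \<Longrightarrow> b \<in> carrier B \<Longrightarrow> f (a, b) \<in> carrier C \<times> carrier D"
  using hom_in_carrier[OF f_hom, of "(a, b)"] by simp

lemma g_closed: "c \<in> carrier C \<Longrightarrow> d \<in> carrier D \<Longrightarrow> g (c, d) \<in> carrier A \<times> carrier B"
  using hom_in_carrier[OF g_hom, of "(c, d)"] by simp

lemma f_mult:
  assumes "a \<in> carrier A" "b \<in> carrier B" "a' \<in> carrier A" "b' \<in> carrier B"
  shows "fst (f (a \<otimes>\<^bsub>A\<^esub> a', b \<otimes>\<^bsub>B\<^esub> b')) = fst (f (a, b)) \<otimes>\<^bsub>C\<^esub> fst (f (a', b'))"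
    and "snd (f (a \<otimes>\<^bsub>A\<^esub> a', b \<otimes>\<^bsub>B\<^esub> b')) = snd (f (a, b)) \<otimes>\<^bsub>D\<^esub> snd (f (a', b'))"
  using hom_mult[OF f_hom, of "(a, b)" "(a', b')"] assms by (simp_all add: mult_DirProd')

lemma g_mult:
  assumes "a \<in> carrier C" "b \<in> carrier D" "a' \<in> carrier C" "b' \<in> carrier D"
  shows "fst (g (a \<otimes>\<^bsub>C\<^esub> a', b \<otimes>\<^bsub>D\<^esub> b')) = fst (g (a, b)) \<otimes>\<^bsub>A\<^esub> fst (g (a', b'))"
    and "snd (g (a \<otimes>\<^bsub>C\<^esub> a', b \<otimes>\<^bsub>D\<^esub> b')) = snd (g (a, b)) \<otimes>\<^bsub>B\<^esub> snd (g (a', b'))"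
  using hom_mult[OF g_hom, of "(a, b)" "(a', b')"] assms by (simp_all add: mult_DirProd')

lemma closed [simp]:
  "a \<in> carrier A \<Longrightarrow> \<alpha> a \<in> carrier C" "a \<in> carrier A \<Longrightarrow> \<delta> a \<in> carrier D"
  "c \<in> carrier C \<Longrightarrow> \<gamma> c \<in> carrier A" "d \<in> carrier D \<Longrightarrow> \<epsilon> d \<in> carrier A"
  using f_closed[of a "\<one>\<^bsub>B\<^esub>"] g_closed[of c "\<one>\<^bsub>D\<^esub>"] g_closed[of "\<one>\<^bsub>C\<^esub>" d]
  by (auto simp: \<alpha>_def \<delta>_def \<gamma>_def \<epsilon>_def)

lemma homs: "\<alpha> \<in> hom A C" "\<delta> \<in> hom A D" "\<gamma> \<in> hom C A" "\<epsilon> \<in> hom D A"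
proof -
  show "\<alpha> \<in> hom A C" by (intro homI closed) (use f_mult[of _ "\<one>\<^bsub>B\<^esub>" _ "\<one>\<^bsub>B\<^esub>"] in \<open>simp_all add: \<alpha>_def\<close>)
  show "\<delta> \<in> hom A D" by (intro homI closed) (use f_mult[of _ "\<one>\<^bsub>B\<^esub>" _ "\<one>\<^bsub>B\<^esub>"] in \<open>simp_all add: \<delta>_def\<close>)
  show "\<gamma> \<in> hom C A" by (intro homI closed) (use g_mult[of _ "\<one>\<^bsub>D\<^esub>" _ "\<one>\<^bsub>D\<^esub>"] in \<open>simp_all add: \<gamma>_def\<close>)
  show "\<epsilon> \<in> hom D A" by (intro homI closed) (use g_mult[of "\<one>\<^bsub>C\<^esub>" _ "\<one>\<^bsub>C\<^esub>"] in \<open>simp_all add: \<epsilon>_def\<close>)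
qed

sublocale \<alpha>: group_hom A C \<alpha> by unfold_locales (rule homs)
sublocale \<gamma>: group_hom C A \<gamma> by unfold_locales (rule homs)

lemma f_axis: "f (a, \<one>\<^bsub>B\<^esub>) = (\<alpha> a, \<delta> a)"
  by (simp add: \<alpha>_def \<delta>_def)

lemma \<gamma>\<alpha>_\<epsilon>\<delta>: 
  assumes "a \<in> carrier A"
  shows "\<gamma> (\<alpha> a) \<otimes>\<^bsub>A\<^esub> \<epsilon> (\<delta> a) = a"
  using g_mult(1)[of "\<alpha> a" "\<one>\<^bsub>D\<^esub>" "\<one>\<^bsub>C\<^esub>" "\<delta> a"] g_f[of "(a, \<one>\<^bsub>B\<^esub>)"] assms
  by (simp add: \<gamma>_def \<epsilon>_def f_axis)

text \<open>The pair \<open>(\<alpha> x \<otimes> \<alpha> y, \<delta> x)\<close> factors as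
  \<open>f (x, \<one>)\<close> times \<open>(\<alpha> y, \<one>)\<close>, and also as
  \<open>(\<alpha> (x \<otimes> y \<otimes> inv x), \<one>)\<close> times
  \<open>f (x, \<one>)\<close>. Comparing the \<open>A\<close> components under \<open>g\<close>
  gives the claim.\<close>

lemma \<gamma>\<alpha>_normal:
  assumes "x \<in> carrier A" "y \<in> carrier A"
  shows "\<gamma> (\<alpha> (x \<otimes>\<^bsub>A\<^esub> y \<otimes>\<^bsub>A\<^esub> inv\<^bsub>A\<^esub> x)) = x \<otimes>\<^bsub>A\<^esub> \<gamma> (\<alpha> y) \<otimes>\<^bsub>A\<^esub> inv\<^bsub>A\<^esub> x"
proof -
  have g1: "fst (g (\<alpha> x, \<delta> x)) = x" using g_f[of "(x, \<one>\<^bsub>B\<^esub>)"] assms by (simp add: f_axis)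
  have "fst (g (\<alpha> x \<otimes>\<^bsub>C\<^esub> \<alpha> y, \<delta> x)) = x \<otimes>\<^bsub>A\<^esub> \<gamma> (\<alpha> y)"
    using g_mult(1)[of "\<alpha> x" "\<delta> x" "\<alpha> y" "\<one>\<^bsub>D\<^esub>"] assms by (simp add: g1 \<gamma>_def)
  moreover have "\<alpha> x \<otimes>\<^bsub>C\<^esub> \<alpha> y = \<alpha> (x \<otimes>\<^bsub>A\<^esub> y \<otimes>\<^bsub>A\<^esub> inv\<^bsub>A\<^esub> x) \<otimes>\<^bsub>C\<^esub> \<alpha> x"
    using assms by (simp flip: \<alpha>.hom_mult add: A.m_assoc)
  moreover have "fst (g (\<alpha> (x \<otimes>\<^bsub>A\<^esub> y \<otimes>\<^bsub>A\<^esub> inv\<^bsub>A\<^esub> x) \<otimes>\<^bsub>C\<^esub> \<alpha> x, \<delta> x)) =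
      \<gamma> (\<alpha> (x \<otimes>\<^bsub>A\<^esub> y \<otimes>\<^bsub>A\<^esub> inv\<^bsub>A\<^esub> x)) \<otimes>\<^bsub>A\<^esub> x"
    using g_mult(1)[of "\<alpha> (x \<otimes>\<^bsub>A\<^esub> y \<otimes>\<^bsub>A\<^esub> inv\<^bsub>A\<^esub> x)" "\<one>\<^bsub>D\<^esub>" "\<alpha> x" "\<delta> x"] assms
    by (simp add: g1 \<gamma>_def)
  ultimately have "\<gamma> (\<alpha> (x \<otimes>\<^bsub>A\<^esub> y \<otimes>\<^bsub>A\<^esub> inv\<^bsub>A\<^esub> x)) \<otimes>\<^bsub>A\<^esub> x = x \<otimes>\<^bsub>A\<^esub> \<gamma> (\<alpha> y)"
    by simp
  then show ?thesis using assms by (metis A.inv_closed A.inv_solve_right A.m_closed closed(1) closed(3))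
qed

text \<open>Since \<open>\<gamma> \<circ> \<alpha>\<close> is bijective on the finite
  \<open>A\<close>, \<open>\<alpha>\<close> embeds \<open>A\<close> into \<open>C\<close> as a
  complement of the kernel \<open>K\<close> of \<open>\<gamma>\<close>. The \<open>B\<close>
  component of \<open>g\<close> then identifies \<open>K \<times>\<times> D\<close> with
  \<open>B\<close>.\<close>

lemma exchange_left:
  assumes inj: "inj_on (\<gamma> \<circ> \<alpha>) (carrier A)" and fin: "finite (carrier A)"
  defines "K \<equiv> C\<lparr>carrier := kernel C A \<gamma>\<rparr>"
  shows "group K" "C \<cong> A \<times>\<times> K" "B \<cong> K \<times>\<times> D"
proof -
  show gK: "group K" unfolding K_def
    by (intro subgroup.subgroup_is_group \<gamma>.subgroup_kernel C.group_axioms)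
  have K: "carrier K = {c \<in> carrier C. \<gamma> c = \<one>\<^bsub>A\<^esub>}" "mult K = mult C" "one K = one C"
    by (auto simp: K_def kernel_def)
  have \<gamma>\<alpha>_inj: "x = y" if "\<gamma> (\<alpha> x) = \<gamma> (\<alpha> y)" "x \<in> carrier A" "y \<in> carrier A" for x y
    using inj_onD[OF inj, of x y] that by simp
  have surj: "\<exists>a\<in>carrier A. \<gamma> (\<alpha> a) = x" if "x \<in> carrier A" for x
  proof -
    have "(\<gamma> \<circ> \<alpha>) ` carrier A = carrier A"
      by (rule endo_inj_surj[OF fin _ inj]) auto
    then have "x \<in> (\<gamma> \<circ> \<alpha>) ` carrier A" using that by blast
    then show ?thesis by auto
  qed
  \<comment> \<open>An element \<open>c\<close> of \<open>K\<close> satisfies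
    \<open>g (c, \<one>) = (\<one>, b)\<close>, so it is the \<open>C\<close> component of
    \<open>f (\<one>, b)\<close>; and \<open>(\<one>, b)\<close> commutes with
    \<open>(a, \<one>)\<close>.\<close>
  have comm: "\<alpha> a \<otimes>\<^bsub>C\<^esub> c = c \<otimes>\<^bsub>C\<^esub> \<alpha> a" if a: "a \<in> carrier A" and c: "c \<in> carrier K" for a c
  proof -
    have c': "c \<in> carrier C" "\<gamma> c = \<one>\<^bsub>A\<^esub>" using c by (auto simp: K)
    obtain b where b: "b \<in> carrier B" "g (c, \<one>\<^bsub>D\<^esub>) = (\<one>\<^bsub>A\<^esub>, b)"
      using g_closed[of c "\<one>\<^bsub>D\<^esub>"] c' by (cases "g (c, \<one>\<^bsub>D\<^esub>)") (auto simp: \<gamma>_def)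
    have "f (\<one>\<^bsub>A\<^esub>, b) = (c, \<one>\<^bsub>D\<^esub>)" using f_g[of "(c, \<one>\<^bsub>D\<^esub>)"] b c' by simp
    then show ?thesis
      using f_mult(1)[of a "\<one>\<^bsub>B\<^esub>" "\<one>\<^bsub>A\<^esub>" b] f_mult(1)[of "\<one>\<^bsub>A\<^esub>" b a "\<one>\<^bsub>B\<^esub>"] a b by (simp add: f_axis)
  qed
  have "(\<lambda>(a, c). \<alpha> a \<otimes>\<^bsub>C\<^esub> c) \<in> iso (A \<times>\<times> K) C"
  proof (intro isoI homI)
    fix p q assume "p \<in> carrier (A \<times>\<times> K)" "q \<in> carrier (A \<times>\<times> K)"
    then obtain a c b d where pq: "p = (a, c)" "q = (b, d)" "a \<in> carrier A" "b \<in> carrier A"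
      "c \<in> carrier K" "d \<in> carrier K" by auto
    then have "c \<in> carrier C" "d \<in> carrier C" by (auto simp: K)
    with pq comm[of b c] show "(case p \<otimes>\<^bsub>A \<times>\<times> K\<^esub> q of (a, c) \<Rightarrow> \<alpha> a \<otimes>\<^bsub>C\<^esub> c) =
        (case p of (a, c) \<Rightarrow> \<alpha> a \<otimes>\<^bsub>C\<^esub> c) \<otimes>\<^bsub>C\<^esub> (case q of (a, c) \<Rightarrow> \<alpha> a \<otimes>\<^bsub>C\<^esub> c)"
      by (simp add: C.m_assoc K) (metis C.m_assoc closed(1))
  next
    show "bij_betw (\<lambda>(a, c). \<alpha> a \<otimes>\<^bsub>C\<^esub> c) (carrier (A \<times>\<times> K)) (carrier C)"
    proof (rule bij_betw_imageI)
      show "inj_on (\<lambda>(a, c). \<alpha> a \<otimes>\<^bsub>C\<^esub> c) (carrier (A \<times>\<times> K))"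
      proof (rule inj_onI, clarsimp simp: K)
        fix a c b d assume h: "a \<in> carrier A" "b \<in> carrier A" "c \<in> carrier C" "d \<in> carrier C"
          "\<gamma> c = \<one>\<^bsub>A\<^esub>" "\<gamma> d = \<one>\<^bsub>A\<^esub>" "\<alpha> a \<otimes>\<^bsub>C\<^esub> c = \<alpha> b \<otimes>\<^bsub>C\<^esub> d"
        have "\<gamma> (\<alpha> a) = \<gamma> (\<alpha> a \<otimes>\<^bsub>C\<^esub> c)" using h(1-6) by simp
        also have "\<dots> = \<gamma> (\<alpha> b \<otimes>\<^bsub>C\<^esub> d)" by (simp only: h(7))
        also have "\<dots> = \<gamma> (\<alpha> b)" using h(1-6) by simp
        finally have "a = b" using \<gamma>\<alpha>_inj h by blast
        with h show "a = b \<and> c = d" by simp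
      qed
      show "(\<lambda>(a, c). \<alpha> a \<otimes>\<^bsub>C\<^esub> c) ` carrier (A \<times>\<times> K) = carrier C"
      proof (intro equalityI subsetI)
        fix c assume c: "c \<in> carrier C"
        obtain a where a: "a \<in> carrier A" "\<gamma> (\<alpha> a) = \<gamma> c" using surj c by (metis closed(3))
        have "\<gamma> (inv\<^bsub>C\<^esub> (\<alpha> a) \<otimes>\<^bsub>C\<^esub> c) = \<one>\<^bsub>A\<^esub>" using a c by simp
        then have "(a, inv\<^bsub>C\<^esub> (\<alpha> a) \<otimes>\<^bsub>C\<^esub> c) \<in> carrier (A \<times>\<times> K)" using a c by (simp add: K)
        moreover have "c = \<alpha> a \<otimes>\<^bsub>C\<^esub> (inv\<^bsub>C\<^esub> (\<alpha> a) \<otimes>\<^bsub>C\<^esub> c)"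
          using a c by (simp flip: C.m_assoc)
        ultimately show "c \<in> (\<lambda>(a, c). \<alpha> a \<otimes>\<^bsub>C\<^esub> c) ` carrier (A \<times>\<times> K)"
          by (metis (no_types, lifting) case_prod_conv image_eqI)
      qed (auto simp: K)
    qed
  qed (auto simp: K)
  then show "C \<cong> A \<times>\<times> K"
    using is_isoI group.iso_sym[OF DirProd_group[OF A.group_axioms gK]] by blast
  have "(snd \<circ> g) \<in> iso (K \<times>\<times> D) B"
  proof (intro isoI homI)
    show "(snd \<circ> g) p \<in> carrier B" if "p \<in> carrier (K \<times>\<times> D)" for p
      using that g_closed by (cases p) (force simp: K)
    show "(snd \<circ> g) (p \<otimes>\<^bsub>K \<times>\<times> D\<^esub> q) = (snd \<circ> g) p \<otimes>\<^bsub>B\<^esub> (snd \<circ> g) q"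
      if "p \<in> carrier (K \<times>\<times> D)" "q \<in> carrier (K \<times>\<times> D)" for p q
      using that g_mult(2) by (auto simp: K)
    show "bij_betw (snd \<circ> g) (carrier (K \<times>\<times> D)) (carrier B)"
    proof (rule bij_betw_imageI)
      have gKD: "group (K \<times>\<times> D)" by (intro DirProd_group gK D.group_axioms)
      have "(snd \<circ> g) \<in> hom (K \<times>\<times> D) B"
        using g_closed g_mult(2) by (intro homI) (force simp: K)+
      then interpret h: group_hom "K \<times>\<times> D" B "snd \<circ> g"
        using gKD B.group_axioms by (simp add: group_hom_def group_hom_axioms_def)
      \<comment> \<open>If \<open>g p\<close> has trivial \<open>B\<close> component, then
        \<open>p = f (x, \<one>)\<close> for some \<open>x\<close>; membership in \<open>K\<close>
        gives \<open>\<gamma> (\<alpha> x) = \<one>\<close>, hence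
        \<open>x = \<one>\<close>.\<close>
      have "p = \<one>\<^bsub>K \<times>\<times> D\<^esub>" if p: "p \<in> carrier (K \<times>\<times> D)" "(snd \<circ> g) p = \<one>\<^bsub>B\<^esub>" for p
      proof -
        obtain c d where cd: "p = (c, d)" "c \<in> carrier C" "d \<in> carrier D" "\<gamma> c = \<one>\<^bsub>A\<^esub>"
          using p(1) by (auto simp: K)
        define x where "x = fst (g (c, d))"
        have x: "x \<in> carrier A" using g_closed cd by (force simp: x_def)
        have gx: "g (c, d) = (x, \<one>\<^bsub>B\<^esub>)" using p(2) by (auto simp: cd x_def prod_eq_iff)
        then have cd': "(c, d) = (\<alpha> x, \<delta> x)" using f_g[of "(c, d)"] cd by (simp add: f_axis)
        then have "\<gamma> (\<alpha> x) = \<one>\<^bsub>A\<^esub>" using cd by simp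
        then have "x = \<one>\<^bsub>A\<^esub>" using \<gamma>\<alpha>_inj[of x "\<one>\<^bsub>A\<^esub>"] x by simp
        then have "(c, d) = f \<one>\<^bsub>A \<times>\<times> B\<^esub>" using cd' by (simp add: f_axis)
        also have "\<dots> = (\<one>\<^bsub>C\<^esub>, \<one>\<^bsub>D\<^esub>)"
          using hom_one[OF f_hom] DirProd_group A.group_axioms B.group_axioms C.group_axioms D.group_axioms
          by (metis one_DirProd)
        finally show ?thesis by (simp add: cd K)
      qed
      then show "inj_on (snd \<circ> g) (carrier (K \<times>\<times> D))" using h.inj_on_one_iff by blast
      show "(snd \<circ> g) ` carrier (K \<times>\<times> D) = carrier B"
      proof (intro equalityI subsetI)
        fix b assume b: "b \<in> carrier B"
        obtain c d where cd: "f (\<one>\<^bsub>A\<^esub>, b) = (c, d)" "c \<in> carrier C" "d \<in> carrier D"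
          using f_closed[of "\<one>\<^bsub>A\<^esub>" b] b by force
        obtain x where x: "x \<in> carrier A" "\<gamma> (\<alpha> x) = \<gamma> c" using surj cd by (metis closed(3))
        \<comment> \<open>Multiplying by \<open>(y, \<one>)\<close> keeps the \<open>B\<close>
          component \<open>b\<close> and moves the \<open>C\<close> component of
          \<open>f (\<one>, b)\<close> into the kernel of \<open>\<gamma>\<close>.\<close>
        define y where "y = inv\<^bsub>A\<^esub> x"
        have y: "y \<in> carrier A" "\<gamma> (\<alpha> y) = inv\<^bsub>A\<^esub> (\<gamma> c)" using x by (simp_all add: y_def)
        have fy: "f (y, b) = (\<alpha> y \<otimes>\<^bsub>C\<^esub> c, \<delta> y \<otimes>\<^bsub>D\<^esub> d)"
          using f_mult[of y "\<one>\<^bsub>B\<^esub>" "\<one>\<^bsub>A\<^esub>" b] y b cd by (simp add: f_axis prod_eq_iff)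
        have "f (y, b) \<in> carrier (K \<times>\<times> D)"
          using y cd by (simp add: fy K)
        moreover have "(snd \<circ> g) (f (y, b)) = b" using g_f[of "(y, b)"] y b by simp
        ultimately show "b \<in> (snd \<circ> g) ` carrier (K \<times>\<times> D)" by (metis image_eqI)
      qed (use h.hom_closed in blast)
    qed
  qed
  then show "B \<cong> K \<times>\<times> D"
    using is_isoI group.iso_sym[OF DirProd_group[OF gK D.group_axioms]] by blast
qed

text \<open>The identity of \<open>A\<close> is the pointwise product of \<open>\<gamma> \<circ> \<alpha>\<close> and \<open>\<epsilon> \<circ> \<delta>\<close>; if the first is nilpotent,
  then an element killed by the second is fixed by the first, hence trivial.\<close>

lemma one_component_injective:
  assumes "directly_indecomposable A" "finite (carrier A)"
  shows "inj_on (\<gamma> \<circ> \<alpha>) (carrier A) \<or> inj_on (\<epsilon> \<circ> \<delta>) (carrier A)"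
proof -
  have h: "\<gamma> \<circ> \<alpha> \<in> hom A A" "\<epsilon> \<circ> \<delta> \<in> hom A A" by (rule hom_compose[OF homs(1,3)], rule hom_compose[OF homs(2,4)])
  interpret e: group_hom A A "\<epsilon> \<circ> \<delta>" by unfold_locales (rule h)
  have "inj_on (\<epsilon> \<circ> \<delta>) (carrier A)" if "\<forall>x\<in>carrier A. ((\<gamma> \<circ> \<alpha>) ^^ n) x = \<one>\<^bsub>A\<^esub>" for n
  proof -
    have "x = \<one>\<^bsub>A\<^esub>" if x: "x \<in> carrier A" "(\<epsilon> \<circ> \<delta>) x = \<one>\<^bsub>A\<^esub>" for x
    proof -
      have "(\<gamma> \<circ> \<alpha>) x = x" using \<gamma>\<alpha>_\<epsilon>\<delta>[OF x(1)] x by simp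
      then have "((\<gamma> \<circ> \<alpha>) ^^ m) x = x" for m by (induction m) (simp_all del: comp_apply, simp add: comp_def)
      then show ?thesis using \<open>\<forall>x\<in>carrier A. ((\<gamma> \<circ> \<alpha>) ^^ n) x = \<one>\<^bsub>A\<^esub>\<close> x by metis
    qed
    then show ?thesis using e.inj_on_one_iff by blast
  qed
  then show ?thesis
    using Fitting_dichotomy[OF assms h(1)] \<gamma>\<alpha>_normal by auto
qed

end

text \<open>The complement comes as a carrier \<open>S\<close> inside \<open>C\<close> or
  \<open>D\<close>, not as a group on a new type, so that \<open>decomposition\<close> can be
  applied to it again.\<close>

lemma exchange:
  assumes "group A" "group B" "group C" "group D" "A \<times>\<times> B \<cong> C \<times>\<times> D"
    and "directly_indecomposable A" "finite (carrier A)"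
  obtains (left) S where "group (C\<lparr>carrier := S\<rparr>)" "C \<cong> A \<times>\<times> C\<lparr>carrier := S\<rparr>" "B \<cong> C\<lparr>carrier := S\<rparr> \<times>\<times> D"
  | (right) S where "group (D\<lparr>carrier := S\<rparr>)" "D \<cong> A \<times>\<times> D\<lparr>carrier := S\<rparr>" "B \<cong> D\<lparr>carrier := S\<rparr> \<times>\<times> C"
proof -
  obtain f where f: "f \<in> iso (A \<times>\<times> B) (C \<times>\<times> D)" using assms(5) by (auto simp: is_iso_def)
  define g where "g = inv_into (carrier (A \<times>\<times> B)) f"
  have g: "g \<in> iso (C \<times>\<times> D) (A \<times>\<times> B)"
    unfolding g_def using group.iso_set_sym[OF DirProd_group[OF assms(1,2)] f] .
  have bij: "bij_betw f (carrier (A \<times>\<times> B)) (carrier (C \<times>\<times> D))" using f by (simp add: iso_def)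
  have fg: "product_iso A B C D f g"
    unfolding product_iso_def product_iso_axioms_def using assms f g
    by (auto simp: iso_def g_def bij_betw_inv_into_left[OF bij[simplified]] bij_betw_inv_into_right[OF bij[simplified]])
  \<comment> \<open>Exchanging \<open>C\<close> and \<open>D\<close> turns the case where
    \<open>\<epsilon> \<circ> \<delta>\<close> is injective into the one treated by
    \<open>exchange_left\<close>.\<close>
  let ?s = "\<lambda>(x, y). (y, x)"
  have sw: "?s \<in> hom (C \<times>\<times> D) (D \<times>\<times> C)" "?s \<in> hom (D \<times>\<times> C) (C \<times>\<times> D)"
    using DirProd_commute_iso_set by (auto simp: iso_def)
  have "product_iso A B D C (?s \<circ> f) (g \<circ> ?s)"
  proof -
    interpret product_iso A B C D f g by fact
    show ?thesis
    proof
      show "?s \<circ> f \<in> hom (A \<times>\<times> B) (D \<times>\<times> C)" by (rule hom_compose[OF f_hom sw(1)])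
      show "g \<circ> ?s \<in> hom (D \<times>\<times> C) (A \<times>\<times> B)" by (rule hom_compose[OF sw(2) g_hom])
      show "(g \<circ> ?s) ((?s \<circ> f) p) = p" if "p \<in> carrier (A \<times>\<times> B)" for p
        using g_f[OF that] by (simp add: case_prod_unfold)
      show "(?s \<circ> f) ((g \<circ> ?s) q) = q" if "q \<in> carrier (D \<times>\<times> C)" for q
        using f_g[of "?s q"] that by (cases q) auto
    qed
  qed
  note fg' = this
  interpret L: product_iso A B C D f g by (rule fg)
  interpret R: product_iso A B D C "?s \<circ> f" "g \<circ> ?s" by (rule fg')
  have eq: "R.\<gamma> = L.\<epsilon>" "R.\<alpha> = L.\<delta>"
    unfolding fun_eq_iff R.\<gamma>_def L.\<epsilon>_def R.\<alpha>_def L.\<delta>_def by (simp_all add: case_prod_unfold)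
  from L.one_component_injective[OF assms(6,7)] show thesis
  proof
    assume "inj_on (L.\<gamma> \<circ> L.\<alpha>) (carrier A)"
    from L.exchange_left[OF this assms(7)] show thesis by (rule left)
  next
    assume "inj_on (L.\<epsilon> \<circ> L.\<delta>) (carrier A)"
    then have "inj_on (R.\<gamma> \<circ> R.\<alpha>) (carrier A)" by (simp only: eq)
    from R.exchange_left[OF this assms(7)] show thesis by (rule right)
  qed
qed

text \<open>Iterated binary products up to isomorphism replace a product over the index set; every
  intermediate factor keeps the element type of \<open>P\<close>.\<close>

inductive decomposition :: "('i \<Rightarrow> ('a, 'x) monoid_scheme) \<Rightarrow> 'i set \<Rightarrow> ('a, 'x) monoid_scheme \<Rightarrow> bool" for L where
  empty: "group P \<Longrightarrow> carrier P = {\<one>\<^bsub>P\<^esub>} \<Longrightarrow> decomposition L {} P"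
| insert: "decomposition L J Q \<Longrightarrow> j \<notin> J \<Longrightarrow> group P \<Longrightarrow> P \<cong> L j \<times>\<times> Q \<Longrightarrow> decomposition L (insert j J) P"

lemma decomposition_group: "decomposition L J P \<Longrightarrow> group P"
  by (induction rule: decomposition.induct) auto

lemma decomposition_iso:
  assumes "decomposition L J P" "group P'" "P \<cong> P'"
  shows "decomposition L J P'"
  using assms(1)
proof cases
  case empty
  obtain h where h: "h \<in> iso P P'" using assms(3) by (auto simp: is_iso_def)
  then have "carrier P' = h ` {\<one>\<^bsub>P\<^esub>}" using empty by (auto simp: iso_def bij_betw_def)
  moreover have "\<one>\<^bsub>P'\<^esub> \<in> carrier P'" using assms(2) by (simp add: group.is_monoid)
  ultimately have "carrier P' = {\<one>\<^bsub>P'\<^esub>}" by auto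
  with empty assms(2) show ?thesis by (simp add: decomposition.empty)
next
  case (insert J Q j)
  have "P' \<cong> P" using insert(4) assms(3) by (rule group.iso_sym)
  then have "P' \<cong> L j \<times>\<times> Q" using insert(5) by (rule iso_trans)
  with insert assms(2) show ?thesis by (auto intro: decomposition.insert)
qed

text \<open>Peel off one factor \<open>L j\<close> and exchange \<open>A\<close>. Either
  \<open>A\<close> goes into \<open>L j\<close>, and the complement is trivial because
  \<open>L j\<close> is indecomposable; or \<open>A\<close> divides the remaining product, and
  induction applies to the complement there.\<close>

lemma decomposition_exchange:
  assumes "decomposition L J P" "P \<cong> A \<times>\<times> B" "group B"
    and "directly_indecomposable A" "finite (carrier A)"
    and "\<And>j. j \<in> J \<Longrightarrow> directly_indecomposable (L j)"
  shows "\<exists>j\<in>J. A \<cong> L j \<and> decomposition L (J - {j}) B"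
  using assms
proof (induction arbitrary: B rule: decomposition.induct)
  case (empty P)
  have gA: "group A" and nt: "carrier A \<noteq> {\<one>\<^bsub>A\<^esub>}" using empty by (auto simp: directly_indecomposable_def)
  interpret A: group A by fact
  interpret B: group B by fact
  obtain h where "bij_betw h (carrier P) (carrier (A \<times>\<times> B))" using empty by (auto simp: is_iso_def iso_def)
  then have z: "carrier A \<times> carrier B = {h \<one>\<^bsub>P\<^esub>}" using empty by (auto simp: bij_betw_def)
  have "carrier A \<subseteq> {\<one>\<^bsub>A\<^esub>}"
  proof
    fix a assume "a \<in> carrier A"
    then have "(a, \<one>\<^bsub>B\<^esub>) = h \<one>\<^bsub>P\<^esub>" "(\<one>\<^bsub>A\<^esub>, \<one>\<^bsub>B\<^esub>) = h \<one>\<^bsub>P\<^esub>" using z by blast+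
    then show "a \<in> {\<one>\<^bsub>A\<^esub>}" by (metis prod.inject singletonI)
  qed
  with nt show ?case by auto
next
  case (insert J D j P)
  let ?C = "L j"
  have gA: "group A" using insert by (simp add: directly_indecomposable_def)
  have indC: "directly_indecomposable ?C" using insert by simp
  then have gC: "group ?C" by (simp add: directly_indecomposable_def)
  have gD: "group D" using insert decomposition_group by blast
  have "A \<times>\<times> B \<cong> P" using group.iso_sym insert by blast
  then have "A \<times>\<times> B \<cong> ?C \<times>\<times> D" using iso_trans insert by blast
  from gA \<open>group B\<close> gC gD this insert.prems(3,4) show ?case
  proof (cases rule: exchange)
    case (left S)
    let ?K = "?C\<lparr>carrier := S\<rparr>"
    have "carrier A \<noteq> {\<one>\<^bsub>A\<^esub>}" using insert by (simp add: directly_indecomposable_def)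
    then have tr: "carrier ?K = {\<one>\<^bsub>?K\<^esub>}"
      using not_directly_indecomposable[OF gA left(1) _ _ left(2)] indC by blast
    have "A \<times>\<times> ?K \<cong> A"
      using iso_trans[OF DirProd_commute_iso DirProd_trivial_iso[OF left(1) gA tr]] .
    then have CA: "?C \<cong> A" using left(2) iso_trans by blast
    have "B \<cong> D" using iso_trans[OF left(3) DirProd_trivial_iso[OF left(1) gD tr]] .
    then have "decomposition L J B"
      using decomposition_iso insert.hyps(1) group.iso_sym \<open>group B\<close> by blast
    moreover have "insert j J - {j} = J" using insert by auto
    ultimately show ?thesis using group.iso_sym[OF gC CA] by auto
  next
    case (right S)
    let ?K = "D\<lparr>carrier := S\<rparr>"
    obtain i where i: "i \<in> J" "A \<cong> L i" "decomposition L (J - {i}) ?K"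
      using insert.IH[OF right(2) right(1)] insert.prems by auto
    have "B \<cong> L j \<times>\<times> ?K" using iso_trans[OF right(3) DirProd_commute_iso] .
    then have "decomposition L (insert j (J - {i})) B"
      using decomposition.insert[OF i(3)] insert \<open>group B\<close> by blast
    moreover have "insert j (J - {i}) = insert j J - {i}" using i insert by auto
    ultimately show ?thesis using i by auto
  qed
qed

text \<open>Each factor of the first decomposition is cancelled against an isomorphic one of the
  second, and the cofactor \<open>Q\<close> is decomposed by what remains.\<close>

theorem Krull_Schmidt:
  assumes "decomposition K I P" "decomposition L J P"
    and "\<And>i. i \<in> I \<Longrightarrow> directly_indecomposable (K i) \<and> finite (carrier (K i))"
    and "\<And>j. j \<in> J \<Longrightarrow> directly_indecomposable (L j) \<and> finite (carrier (L j))"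
  shows "\<exists>\<sigma>. bij_betw \<sigma> I J \<and> (\<forall>i\<in>I. K i \<cong> L (\<sigma> i))"
  using assms
proof (induction arbitrary: J rule: decomposition.induct)
  case (empty P)
  from empty.prems(1) have "J = {}"
  proof cases
    case (insert J' Q j)
    have "group Q" using insert decomposition_group by blast
    then show ?thesis
      using decomposition_exchange[OF decomposition.empty[OF empty.hyps, of K] insert(5)] insert(1) empty.prems(3)
      by auto
  qed simp
  then show ?case by (simp add: bij_betw_def)
next
  case (insert I Q i P)
  have "group Q" using insert.hyps(1) by (rule decomposition_group)
  then obtain j where j: "j \<in> J" "K i \<cong> L j" "decomposition L (J - {j}) Q"
    using decomposition_exchange[OF insert.prems(1) insert.hyps(4)] insert.prems(2,3) by blast
  then obtain \<sigma> where \<sigma>: "bij_betw \<sigma> I (J - {j})" "\<And>i. i \<in> I \<Longrightarrow> K i \<cong> L (\<sigma> i)"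
    using insert.IH[OF j(3)] insert.prems(2,3) by auto
  have "bij_betw (\<sigma>(i := j)) I (J - {j})"
    using \<sigma>(1) insert.hyps(2) by (metis bij_betw_cong fun_upd_other)
  then have "bij_betw (\<sigma>(i := j)) (insert i I) (insert j (J - {j}))"
    using notIn_Un_bij_betw3[of i I "\<sigma>(i := j)" "J - {j}"] insert.hyps(2) by simp
  then have "bij_betw (\<sigma>(i := j)) (insert i I) J" using j(1) by (simp add: insert_absorb)
  moreover have "\<forall>k\<in>insert i I. K k \<cong> L ((\<sigma>(i := j)) k)" using j \<sigma>(2) insert.hyps(2) by auto
  ultimately show ?case by blast
qed

section \<open>Internal graph products\<close>

locale graph_product_group = group G for G :: "('a, 'x) monoid_scheme" (structure) +
  fixes V :: "'v set" and E :: "'v set set" and H :: "'v \<Rightarrow> 'a set"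
  assumes finite_V: "finite V" and graph: "is_graph V E" and internal: "internal_graph_product G V E H"
begin

lemma subgroup_H: "v \<in> V \<Longrightarrow> subgroup (H v) G"
  using internal by (simp add: internal_graph_product_def)

lemma H_closed: "v \<in> V \<Longrightarrow> g \<in> H v \<Longrightarrow> g \<in> carrier G"
  using subgroup_H subgroup.subset by blast

abbreviation "K v \<equiv> subgroup_as_group G (H v)"
abbreviation "F \<equiv> free_product V K"
abbreviation "N \<equiv> graph_product_kernel V E K"

lemma group_K: "v \<in> V \<Longrightarrow> group (K v)"
  using subgroup_H subgroup.subgroup_is_group group_axioms by blast

lemma edge_in_V: "{u, v} \<in> E \<Longrightarrow> u \<in> V \<and> v \<in> V"
  using graph by (auto simp: is_graph_def)

lemma not_loop: "{v, v} \<notin> E"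
  using graph by (auto simp: is_graph_def)

text \<open>Replaces the quotient in \<open>internal_graph_product\<close> by a surjection from the
  free product with kernel \<open>N\<close>; commutation along edges, generation and the universal
  property are all read off from it.\<close>

lemma free_product_projection:
  obtains \<psi> where "\<psi> \<in> hom F G" "\<psi> ` carrier F = carrier G" "kernel F G \<psi> = N"
    "\<And>v g. v \<in> V \<Longrightarrow> g \<in> H v \<Longrightarrow> \<psi> (fp_incl V K v g) = g"
proof -
  obtain \<phi> where \<phi>: "\<phi> \<in> iso (graph_product V E K) G"
    "\<And>v g. v \<in> V \<Longrightarrow> g \<in> H v \<Longrightarrow> \<phi> (graph_product_incl V E K v g) = g"
    using internal unfolding internal_graph_product_def Let_def by blast
  have "N \<lhd> F" by (intro graph_product_kernel_normal graph group_K)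
  then interpret N: normal N F .
  have q: "(\<lambda>x. N #>\<^bsub>F\<^esub> x) \<in> hom F (graph_product V E K)"
    unfolding graph_product_def by (rule N.r_coset_hom_Mod)
  have \<phi>h: "\<phi> \<in> hom (graph_product V E K) G" using \<phi>(1) by (simp add: iso_def)
  define \<psi> where "\<psi> = \<phi> \<circ> (\<lambda>x. N #>\<^bsub>F\<^esub> x)"
  have h: "\<psi> \<in> hom F G" unfolding \<psi>_def by (rule Group.hom_compose[OF q \<phi>h])
  have c: "carrier (graph_product V E K) = (\<lambda>x. N #>\<^bsub>F\<^esub> x) ` carrier F"
    by (auto simp: graph_product_def FactGroup_def RCOSETS_def)
  have bij: "bij_betw \<phi> (carrier (graph_product V E K)) (carrier G)" using \<phi>(1) by (simp add: iso_def)
  then have s: "\<psi> ` carrier F = carrier G"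
    unfolding \<psi>_def bij_betw_def c by (simp add: image_comp)
  have one: "\<phi> N = \<one>"
    using hom_one[OF \<phi>h group_graph_product[OF graph group_K] group_axioms]
    by (simp add: graph_product_def FactGroup_def)
  have Ncar: "N \<in> carrier (graph_product V E K)"
    using N.subgroup_axioms N.coset_join2[of "\<one>\<^bsub>F\<^esub>" N] unfolding c by (auto intro!: image_eqI[of _ _ "\<one>\<^bsub>F\<^esub>"])
  have "\<psi> x = \<one> \<longleftrightarrow> x \<in> N" if x: "x \<in> carrier F" for x
  proof -
    have "\<psi> x = \<one> \<longleftrightarrow> \<phi> (N #>\<^bsub>F\<^esub> x) = \<phi> N" by (simp add: \<psi>_def one)
    also have "\<dots> \<longleftrightarrow> N #>\<^bsub>F\<^esub> x = N"
      using bij x Ncar unfolding bij_betw_def c by (auto dest: inj_onD)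
    also have "\<dots> \<longleftrightarrow> x \<in> N"
      using N.coset_join1[of N x] N.coset_join2[of x N] x N.subgroup_axioms N.subset by blast
    finally show ?thesis .
  qed
  then have k: "kernel F G \<psi> = N" using N.subset by (auto simp: kernel_def)
  show thesis
    by (rule that[OF h s k]) (use \<phi>(2) in \<open>simp add: \<psi>_def graph_product_incl_def\<close>)
qed

lemma edge_commute:
  assumes "{u, v} \<in> E" "g \<in> H u" "h \<in> H v"
  shows "g \<otimes> h = h \<otimes> g"
proof -
  obtain \<psi> where \<psi>: "\<psi> \<in> hom F G" "kernel F G \<psi> = N"
    "\<And>v g. v \<in> V \<Longrightarrow> g \<in> H v \<Longrightarrow> \<psi> (fp_incl V K v g) = g"
    by (rule free_product_projection) blast
  have uv: "u \<in> V" "v \<in> V" using edge_in_V assms by auto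
  interpret Fr: group F by (rule group_free_product[OF group_K])
  interpret \<psi>: group_hom F G \<psi> by unfold_locales (rule \<psi>)
  let ?c = "inv\<^bsub>F\<^esub> (fp_incl V K u g) \<otimes>\<^bsub>F\<^esub> inv\<^bsub>F\<^esub> (fp_incl V K v h) \<otimes>\<^bsub>F\<^esub> fp_incl V K u g \<otimes>\<^bsub>F\<^esub> fp_incl V K v h"
  have "?c \<in> edge_commutators V E K" unfolding edge_commutators_def Let_def using assms by fastforce
  then have "?c \<in> N" by (auto simp: normal_closure_def)
  then have "\<psi> ?c = \<one>" using \<psi>(2) by (auto simp: kernel_def)
  moreover have cl: "fp_incl V K u g \<in> carrier F" "fp_incl V K v h \<in> carrier F"
    using uv assms by (auto intro: fp_incl_closed)
  ultimately have "inv g \<otimes> inv h \<otimes> g \<otimes> h = \<one>" using \<psi>(3) uv assms by simp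
  moreover have "g \<in> carrier G" "h \<in> carrier G" using uv assms H_closed by auto
  ultimately show ?thesis
    by (metis inv_closed inv_equality inv_inv inv_mult_group m_assoc m_closed)
qed

definition "gen S = generate G (\<Union>v\<in>S. H v)"

lemma carrier_eq_gen: "carrier G = gen V"
proof -
  obtain \<psi> where \<psi>: "\<psi> \<in> hom F G" "\<psi> ` carrier F = carrier G"
    "\<And>v g. v \<in> V \<Longrightarrow> g \<in> H v \<Longrightarrow> \<psi> (fp_incl V K v g) = g"
    by (rule free_product_projection) blast
  have sub: "(\<Union>v\<in>V. H v) \<subseteq> carrier G" using H_closed by blast
  then have sg: "subgroup (gen V) G" unfolding gen_def by (rule generate_is_subgroup)
  interpret Fr: group F by (rule group_free_product[OF group_K])
  interpret \<psi>: group_hom F G \<psi> by unfold_locales (rule \<psi>)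
  have "\<psi> (fp_eq V K `` {x}) \<in> gen V" if "x \<in> fp_words V K" for x
    using that
  proof (induction x)
    case Nil
    then show ?case using \<psi>.hom_one subgroup.one_closed[OF sg] by (simp add: fp_one)
  next
    case (Cons p x)
    obtain v g where p: "p = (v, g)" by force
    with Cons have vg: "v \<in> V" "g \<in> H v" "x \<in> fp_words V K" by auto
    then have "g \<in> gen V" unfolding gen_def by (auto intro: generate.incl)
    moreover have "\<psi> (fp_eq V K `` {p # x}) = g \<otimes> \<psi> (fp_eq V K `` {x})"
      unfolding p using vg by (subst fp_class_Cons) (auto simp: fp_incl_closed fp_class_in_carrier \<psi>(3))
    ultimately show ?case using Cons vg subgroup.m_closed[OF sg] by simp
  qed
  then have "carrier G \<subseteq> gen V"
    unfolding \<psi>(2)[symmetric] by (auto elim!: fp_carrierE)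
  then show ?thesis using subgroup.subset[OF sg] by blast
qed

text \<open>The universal property of \<open>G\<close>. It supplies the maps out of \<open>G\<close>
  by which elements are later shown to be nontrivial or distinct.\<close>

lemma hom_extension:
  fixes M :: "('b, 'y) monoid_scheme"
  assumes M: "group M" and f: "\<And>v. v \<in> V \<Longrightarrow> f v \<in> hom (K v) M"
    and comm: "\<And>u v g h. {u, v} \<in> E \<Longrightarrow> g \<in> H u \<Longrightarrow> h \<in> H v \<Longrightarrow> f u g \<otimes>\<^bsub>M\<^esub> f v h = f v h \<otimes>\<^bsub>M\<^esub> f u g"
  shows "\<exists>\<Phi>\<in>hom G M. \<forall>v\<in>V. \<forall>g\<in>H v. \<Phi> g = f v g"
proof -
  interpret M: group M by fact
  interpret Fr: group F by (rule group_free_product[OF group_K])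
  obtain \<psi> where \<psi>: "\<psi> \<in> hom F G" "\<psi> ` carrier F = carrier G" "kernel F G \<psi> = N"
    "\<And>v g. v \<in> V \<Longrightarrow> g \<in> H v \<Longrightarrow> \<psi> (fp_incl V K v g) = g"
    by (rule free_product_projection) blast
  interpret \<psi>: group_hom F G \<psi> by unfold_locales (rule \<psi>)
  obtain \<theta> where \<theta>: "\<theta> \<in> hom F M" "\<And>v g. v \<in> V \<Longrightarrow> g \<in> H v \<Longrightarrow> \<theta> (fp_incl V K v g) = f v g"
    using free_product_hom_exists[OF M, of V K f] group_K f by auto
  interpret \<theta>: group_hom F M \<theta> by unfold_locales (rule \<theta>)
  have fc: "f v g \<in> carrier M" if "v \<in> V" "g \<in> H v" for v g
    using f that by (auto simp: hom_def)
  have "edge_commutators V E K \<subseteq> kernel F M \<theta>"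
  proof
    fix c assume "c \<in> edge_commutators V E K"
    then obtain u v g h where c: "c = inv\<^bsub>F\<^esub> (fp_incl V K u g) \<otimes>\<^bsub>F\<^esub> inv\<^bsub>F\<^esub> (fp_incl V K v h) \<otimes>\<^bsub>F\<^esub> fp_incl V K u g \<otimes>\<^bsub>F\<^esub> fp_incl V K v h"
      and e: "{u, v} \<in> E" "g \<in> H u" "h \<in> H v"
      unfolding edge_commutators_def Let_def by auto
    have uv: "u \<in> V" "v \<in> V" using edge_in_V e by auto
    have cl: "fp_incl V K u g \<in> carrier F" "fp_incl V K v h \<in> carrier F"
      using uv e by (auto intro: fp_incl_closed)
    have "\<theta> c = inv\<^bsub>M\<^esub> f u g \<otimes>\<^bsub>M\<^esub> inv\<^bsub>M\<^esub> f v h \<otimes>\<^bsub>M\<^esub> (f u g \<otimes>\<^bsub>M\<^esub> f v h)"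
      using cl uv e fc by (simp add: c \<theta>(2) M.m_assoc)
    also have "\<dots> = inv\<^bsub>M\<^esub> (f v h \<otimes>\<^bsub>M\<^esub> f u g) \<otimes>\<^bsub>M\<^esub> (f v h \<otimes>\<^bsub>M\<^esub> f u g)"
      using comm[OF e] fc uv e by (simp add: M.inv_mult_group)
    also have "\<dots> = \<one>\<^bsub>M\<^esub>" using fc uv e by simp
    finally show "c \<in> kernel F M \<theta>" using cl by (simp add: kernel_def c)
  qed
  then have sub: "N \<subseteq> kernel F M \<theta>" using \<theta>.normal_kernel by (auto simp: normal_closure_def)
  \<comment> \<open>Two preimages of the same element differ by an element of \<open>N\<close>,
    which \<open>\<theta>\<close> kills; this makes the choice in \<open>\<Phi>\<close>
    harmless.\<close>
  have wd: "\<theta> x = \<theta> y" if "x \<in> carrier F" "y \<in> carrier F" "\<psi> x = \<psi> y" for x y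
  proof -
    have "x \<otimes>\<^bsub>F\<^esub> inv\<^bsub>F\<^esub> y \<in> kernel F G \<psi>" using that by (simp add: kernel_def)
    then have "x \<otimes>\<^bsub>F\<^esub> inv\<^bsub>F\<^esub> y \<in> kernel F M \<theta>" using sub \<psi>(3) by blast
    then have "\<theta> (x \<otimes>\<^bsub>F\<^esub> inv\<^bsub>F\<^esub> y) = \<one>\<^bsub>M\<^esub>" by (simp add: kernel_def)
    then have "\<theta> x \<otimes>\<^bsub>M\<^esub> inv\<^bsub>M\<^esub> \<theta> y = \<one>\<^bsub>M\<^esub>" using that by simp
    then show ?thesis using that by (metis M.inv_closed M.inv_equality M.inv_inv \<theta>.hom_closed)
  qed
  define \<Phi> where "\<Phi> g = \<theta> (SOME x. x \<in> carrier F \<and> \<psi> x = g)" for g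
  have \<Phi>: "\<Phi> (\<psi> x) = \<theta> x" if "x \<in> carrier F" for x
  proof -
    have "(SOME y. y \<in> carrier F \<and> \<psi> y = \<psi> x) \<in> carrier F \<and> \<psi> (SOME y. y \<in> carrier F \<and> \<psi> y = \<psi> x) = \<psi> x"
      by (rule someI[of _ x]) (use that in simp)
    then show ?thesis unfolding \<Phi>_def using wd that by blast
  qed
  have "\<Phi> \<in> hom G M"
  proof (rule homI)
    fix x assume "x \<in> carrier G"
    then obtain x' where "x' \<in> carrier F" "x = \<psi> x'" using \<psi>(2) by auto
    then show "\<Phi> x \<in> carrier M" by (simp add: \<Phi>)
  next
    fix x y assume "x \<in> carrier G" "y \<in> carrier G"
    then obtain x' y' where xy: "x' \<in> carrier F" "x = \<psi> x'" "y' \<in> carrier F" "y = \<psi> y'"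
      unfolding \<psi>(2)[symmetric] by blast
    then have "\<Phi> (x \<otimes> y) = \<Phi> (\<psi> (x' \<otimes>\<^bsub>F\<^esub> y'))" by simp
    also have "\<dots> = \<theta> (x' \<otimes>\<^bsub>F\<^esub> y')" using xy by (intro \<Phi>) simp
    finally show "\<Phi> (x \<otimes> y) = \<Phi> x \<otimes>\<^bsub>M\<^esub> \<Phi> y" using xy by (simp add: \<Phi>)
  qed
  moreover have "\<Phi> g = f v g" if "v \<in> V" "g \<in> H v" for v g
    using \<Phi>[of "fp_incl V K v g"] that \<psi>(4) \<theta>(2) by (simp add: fp_incl_closed)
  ultimately show ?thesis by blast
qed

section \<open>Subgroups generated by vertex groups, and retractions onto vertex groups\<close>

lemma UN_H_closed: "S \<subseteq> V \<Longrightarrow> (\<Union>v\<in>S. H v) \<subseteq> carrier G"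
  using H_closed by blast

lemma subgroup_gen: "S \<subseteq> V \<Longrightarrow> subgroup (gen S) G"
  unfolding gen_def by (intro generate_is_subgroup UN_H_closed)

lemma gen_closed: "S \<subseteq> V \<Longrightarrow> x \<in> gen S \<Longrightarrow> x \<in> carrier G"
  using subgroup_gen subgroup.subset by blast

lemma gen_mono: "S \<subseteq> T \<Longrightarrow> gen S \<subseteq> gen T"
  unfolding gen_def by (intro mono_generate) blast

lemma H_subset_gen: "v \<in> S \<Longrightarrow> H v \<subseteq> gen S"
  unfolding gen_def by (auto intro: generate.incl)

lemma gen_minimal: "subgroup U G \<Longrightarrow> (\<And>v. v \<in> S \<Longrightarrow> H v \<subseteq> U) \<Longrightarrow> gen S \<subseteq> U"
  unfolding gen_def by (intro generate_subgroup_incl) blast+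

lemma generate_commute:
  assumes "A \<subseteq> carrier G" "h \<in> carrier G" "\<And>a. a \<in> A \<Longrightarrow> h \<otimes> a = a \<otimes> h" "x \<in> generate G A"
  shows "h \<otimes> x = x \<otimes> h"
  using assms(4)
proof (induction rule: generate.induct)
  case (inv a)
  then have "a \<in> carrier G" "h \<otimes> a = a \<otimes> h" using assms by auto
  then show ?case using assms(2) by (metis inv_closed inv_solve_left inv_solve_right m_assoc m_closed)
next
  case (eng x y)
  then have "x \<in> carrier G" "y \<in> carrier G" using generate_in_carrier[OF assms(1)] by auto
  with eng assms(2) show ?case by (metis m_assoc)
qed (use assms in auto)

text \<open>The identity on \<open>H v\<close> and the trivial map on the other vertex groups
  respect the edge relations: the ends of an edge differ, so at least one of the two images is
  \<open>\<one>\<close>.\<close>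

lemma vertex_retraction:
  assumes "v \<in> V"
  shows "\<exists>\<rho>\<in>hom G G. (\<forall>g\<in>H v. \<rho> g = g) \<and> (\<forall>u\<in>V - {v}. \<forall>g\<in>H u. \<rho> g = \<one>)"
proof -
  have "\<exists>\<rho>\<in>hom G G. \<forall>u\<in>V. \<forall>g\<in>H u. \<rho> g = (if u = v then g else \<one>)"
  proof (rule hom_extension[OF group_axioms])
    show "(\<lambda>g. if u = v then g else \<one>) \<in> hom (K u) G" if "u \<in> V" for u
      using H_closed that by (auto intro!: homI)
    show "(if u = v then g else \<one>) \<otimes> (if w = v then h else \<one>) =
        (if w = v then h else \<one>) \<otimes> (if u = v then g else \<one>)"
      if e: "{u, w} \<in> E" "g \<in> H u" "h \<in> H w" for u w g h
      using e not_loop edge_in_V[OF e(1)] H_closed[of u g] H_closed[of w h] by auto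
  qed
  then obtain \<rho> where "\<rho> \<in> hom G G" "\<And>u g. u \<in> V \<Longrightarrow> g \<in> H u \<Longrightarrow> \<rho> g = (if u = v then g else \<one>)"
    by blast
  then show ?thesis using assms by (intro bexI[of _ \<rho>]) auto
qed

definition "\<rho> v = (SOME \<rho>. \<rho> \<in> hom G G \<and> (\<forall>g\<in>H v. \<rho> g = g) \<and> (\<forall>u\<in>V - {v}. \<forall>g\<in>H u. \<rho> g = \<one>))"

lemma \<rho>:
  assumes "v \<in> V"
  shows "\<rho> v \<in> hom G G" "g \<in> H v \<Longrightarrow> \<rho> v g = g" "u \<in> V \<Longrightarrow> u \<noteq> v \<Longrightarrow> g \<in> H u \<Longrightarrow> \<rho> v g = \<one>"
proof -
  have "\<exists>\<rho>. \<rho> \<in> hom G G \<and> (\<forall>g\<in>H v. \<rho> g = g) \<and> (\<forall>u\<in>V - {v}. \<forall>g\<in>H u. \<rho> g = \<one>)"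
    using vertex_retraction[OF assms] by blast
  from someI_ex[OF this, folded \<rho>_def] show "\<rho> v \<in> hom G G" "g \<in> H v \<Longrightarrow> \<rho> v g = g"
    "u \<in> V \<Longrightarrow> u \<noteq> v \<Longrightarrow> g \<in> H u \<Longrightarrow> \<rho> v g = \<one>" by blast+
qed

lemma group_hom_\<rho>: "v \<in> V \<Longrightarrow> group_hom G G (\<rho> v)"
  by unfold_locales (rule \<rho>)

lemma \<rho>_gen:
  assumes "v \<in> V" "S \<subseteq> V" "v \<notin> S" "x \<in> gen S"
  shows "\<rho> v x = \<one>"
proof -
  interpret group_hom G G "\<rho> v" using assms(1) by (rule group_hom_\<rho>)
  have "gen S \<subseteq> kernel G G (\<rho> v)"
    using assms \<rho>(3)[OF assms(1)] H_closed
    by (intro gen_minimal subgroup_kernel) (auto simp: kernel_def)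
  with assms(4) show ?thesis by (auto simp: kernel_def)
qed

section \<open>Cliques and their direct products\<close>

definition "clique C \<longleftrightarrow> C \<subseteq> V \<and> (\<forall>u\<in>C. \<forall>v\<in>C. u \<noteq> v \<longrightarrow> {u, v} \<in> E)"

lemma clique_subset: "clique C \<Longrightarrow> D \<subseteq> C \<Longrightarrow> clique D"
  by (auto simp: clique_def)

lemma clique_finite: "clique C \<Longrightarrow> finite C"
  using finite_V finite_subset by (auto simp: clique_def)

lemma vertex_gen_commute:
  assumes "S \<subseteq> V" "v \<in> V" "\<And>u. u \<in> S \<Longrightarrow> {v, u} \<in> E" "h \<in> H v" "x \<in> gen S"
  shows "h \<otimes> x = x \<otimes> h"
  using assms(5) unfolding gen_def
  by (rule generate_commute[rotated 3]) (use assms(1,2,4) edge_commute[OF assms(3) assms(4)] H_closed in auto)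

text \<open>\<open>H v\<close> commutes with \<open>gen S\<close> because \<open>v\<close> is
  adjacent to all of \<open>S\<close>, so the product set is already closed under
  multiplication.\<close>

lemma gen_insert:
  assumes "insert v S \<subseteq> V" "\<And>u. u \<in> S \<Longrightarrow> {v, u} \<in> E" "x \<in> gen (insert v S)"
  shows "\<exists>h\<in>H v. \<exists>g\<in>gen S. x = h \<otimes> g"
proof -
  have v: "subgroup (H v) G" "subgroup (gen S) G" using assms subgroup_H subgroup_gen by auto
  have comm: "h \<otimes> g = g \<otimes> h" if "h \<in> H v" "g \<in> gen S" for h g
    using vertex_gen_commute[of S v h g] assms that by auto
  have S: "insert v S \<subseteq> V" "v \<in> V" "S \<subseteq> V" using assms(1) by auto
  show ?thesis
    using assms(3) unfolding gen_def[of "insert v S"]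
  proof (induction rule: generate.induct)
    case one
    show ?case using subgroup.one_closed[OF v(1)] subgroup.one_closed[OF v(2)] by force
  next
    case (incl a)
    then have "a \<in> H v \<or> a \<in> gen S" "a \<in> carrier G" using S H_subset_gen H_closed by auto
    then show ?case using subgroup.one_closed[OF v(1)] subgroup.one_closed[OF v(2)]
      by (metis l_one r_one)
  next
    case (inv a)
    then have "a \<in> H v \<or> a \<in> gen S" "a \<in> carrier G" using S H_subset_gen H_closed by auto
    then have "inv a \<in> H v \<or> inv a \<in> gen S" "inv a \<in> carrier G"
      using subgroup.m_inv_closed[OF v(1)] subgroup.m_inv_closed[OF v(2)] by auto
    then show ?case using subgroup.one_closed[OF v(1)] subgroup.one_closed[OF v(2)]
      by (metis l_one r_one)
  next
    case (eng x y)
    then obtain h g h' g' where *: "x = h \<otimes> g" "y = h' \<otimes> g'" "h \<in> H v" "h' \<in> H v" "g \<in> gen S" "g' \<in> gen S"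
      by blast
    then have c: "h \<in> carrier G" "h' \<in> carrier G" "g \<in> carrier G" "g' \<in> carrier G"
      using H_closed[OF S(2)] gen_closed[OF S(3)] by auto
    have "x \<otimes> y = h \<otimes> (g \<otimes> h') \<otimes> g'" using c by (simp add: * m_assoc)
    also have "\<dots> = (h \<otimes> h') \<otimes> (g \<otimes> g')" using c comm[of h' g] * by (metis m_assoc m_closed)
    finally show ?case using subgroup.m_closed[OF v(1)] subgroup.m_closed[OF v(2)] * by blast
  qed
qed

lemma clique_insert:
  assumes "clique (insert v C)" "v \<notin> C"
  shows "clique C" "v \<in> V" "C \<subseteq> V" "insert v C \<subseteq> V" "\<And>u. u \<in> C \<Longrightarrow> {v, u} \<in> E"
  using assms by (auto simp: clique_def)

text \<open>An element of \<open>gen C\<close> is a product of coordinates in the vertex groups, and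
  \<open>\<rho> v\<close> reads off the one at \<open>v\<close>; those outside \<open>D\<close> are
  therefore trivial.\<close>

lemma gen_Int:
  assumes "clique C" "x \<in> gen C" "\<And>v. v \<in> C - D \<Longrightarrow> \<rho> v x = \<one>"
  shows "x \<in> gen (C \<inter> D)"
  using clique_finite[OF assms(1)] assms
proof (induction C arbitrary: x rule: finite_induct)
  case (insert v C)
  note C = clique_insert[OF insert.prems(1) insert.hyps(2)]
  obtain h g where x: "h \<in> H v" "g \<in> gen C" "x = h \<otimes> g"
    using gen_insert[OF C(4,5) insert.prems(2)] by blast
  have hg: "h \<in> carrier G" "g \<in> carrier G" using x C H_closed gen_closed by auto
  have "\<rho> u g = \<one>" if u: "u \<in> C - D" for u
  proof -
    interpret \<rho>: group_hom G G "\<rho> u" using u C by (intro group_hom_\<rho>) auto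
    have "\<rho> u x = \<rho> u h \<otimes> \<rho> u g" using hg by (simp add: x)
    moreover have "\<rho> u h = \<one>" using \<rho>(3)[of u v h] u C x insert.hyps(2) by blast
    ultimately show ?thesis using insert.prems(3)[of u] u hg by auto
  qed
  then have g: "g \<in> gen (C \<inter> D)" using insert.IH C(1) x by blast
  show ?case
  proof (cases "v \<in> D")
    case True
    have "h \<in> gen (insert v C \<inter> D)" using True x H_subset_gen[of v "insert v C \<inter> D"] by auto
    moreover have "g \<in> gen (insert v C \<inter> D)" using g gen_mono[of "C \<inter> D" "insert v C \<inter> D"] by auto
    moreover have "subgroup (gen (insert v C \<inter> D)) G" using C by (intro subgroup_gen) auto
    ultimately show ?thesis unfolding x by (metis subgroup.m_closed)
  next
    case False
    interpret \<rho>: group_hom G G "\<rho> v" using C by (intro group_hom_\<rho>)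
    have "\<rho> v x = h" using hg \<rho>_gen[of v C g] \<rho>(2)[of v h] C x insert.hyps(2) by simp
    then have "h = \<one>" using insert.prems(3)[of v] False by simp
    then show ?thesis using g False hg by (simp add: x)
  qed
qed simp

lemma finite_gen:
  assumes "clique C" "\<And>v. v \<in> C \<Longrightarrow> finite (H v)"
  shows "finite (gen C)"
  using clique_finite[OF assms(1)] assms
proof (induction C rule: finite_induct)
  case (insert v C)
  note C = clique_insert[OF insert.prems(1) insert.hyps(2)]
  have "gen (insert v C) \<subseteq> (\<lambda>(h, g). h \<otimes> g) ` (H v \<times> gen C)"
    using gen_insert[OF C(4,5)] by (force simp: image_iff)
  moreover have "finite (H v \<times> gen C)" using insert C by simp
  ultimately show ?case using finite_surj by blast
qed (simp add: gen_def generate_empty)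

text \<open>Multiplying elements of \<open>H v\<close> and \<open>gen C\<close> is a homomorphism
  because the factors commute, and it is injective because \<open>\<rho> v\<close> recovers the
  first factor.\<close>

lemma gen_decomposition:
  assumes "clique C"
  shows "decomposition K C (subgroup_as_group G (gen C))"
  using clique_finite[OF assms(1)] assms
proof (induction C rule: finite_induct)
  case empty
  have "group (subgroup_as_group G (gen {}))"
    by (intro subgroup.subgroup_is_group subgroup_gen group_axioms) simp
  then show ?case by (rule decomposition.empty) (simp add: gen_def generate_empty)
next
  case (insert v C)
  note C = clique_insert[OF insert.prems(1) insert.hyps(2)]
  let ?P = "subgroup_as_group G (gen (insert v C))" and ?Q = "subgroup_as_group G (gen C)"
  have g: "group ?P" "group ?Q" "group (K v)"
    using C by (auto intro!: subgroup.subgroup_is_group subgroup_gen subgroup_H group_axioms)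
  have comm: "h \<otimes> g = g \<otimes> h" if "h \<in> H v" "g \<in> gen C" for h g
    using vertex_gen_commute[of C v h g] C that by auto
  have c: "h \<in> carrier G" "g \<in> carrier G" if "h \<in> H v" "g \<in> gen C" for h g
    using that C H_closed gen_closed by auto
  have hom: "(\<lambda>(h, g). h \<otimes> g) \<in> hom (K v \<times>\<times> ?Q) ?P"
  proof (rule homI)
    fix p assume "p \<in> carrier (K v \<times>\<times> ?Q)"
    moreover have "subgroup (gen (insert v C)) G" using C by (intro subgroup_gen) auto
    moreover have "H v \<subseteq> gen (insert v C)" "gen C \<subseteq> gen (insert v C)"
      by (rule H_subset_gen, simp, rule gen_mono, blast)
    ultimately show "(case p of (h, g) \<Rightarrow> h \<otimes> g) \<in> carrier ?P"
      by (auto intro!: subgroup.m_closed)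
  next
    fix p q assume "p \<in> carrier (K v \<times>\<times> ?Q)" "q \<in> carrier (K v \<times>\<times> ?Q)"
    then obtain h g h' g' where *: "p = (h, g)" "q = (h', g')" "h \<in> H v" "h' \<in> H v" "g \<in> gen C" "g' \<in> gen C"
      by auto
    have "(h \<otimes> h') \<otimes> (g \<otimes> g') = h \<otimes> (h' \<otimes> g) \<otimes> g'" using c * by (simp add: m_assoc)
    also have "\<dots> = (h \<otimes> g) \<otimes> (h' \<otimes> g')" using c * comm[of h' g] by (simp add: m_assoc)
    finally show "(case p \<otimes>\<^bsub>K v \<times>\<times> ?Q\<^esub> q of (h, g) \<Rightarrow> h \<otimes> g) =
        (case p of (h, g) \<Rightarrow> h \<otimes> g) \<otimes>\<^bsub>?P\<^esub> (case q of (h, g) \<Rightarrow> h \<otimes> g)"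
      by (simp add: *)
  qed
  interpret group_hom "K v \<times>\<times> ?Q" ?P "\<lambda>(h, g). h \<otimes> g"
    using hom g DirProd_group unfolding group_hom_def group_hom_axioms_def by blast
  have "(\<lambda>(h, g). h \<otimes> g) \<in> iso (K v \<times>\<times> ?Q) ?P"
  proof (rule isoI[OF hom], rule bij_betw_imageI)
    show "inj_on (\<lambda>(h, g). h \<otimes> g) (carrier (K v \<times>\<times> ?Q))"
    proof (subst inj_on_one_iff, intro allI impI)
      fix p assume p: "p \<in> carrier (K v \<times>\<times> ?Q)" "(case p of (h, g) \<Rightarrow> h \<otimes> g) = \<one>\<^bsub>?P\<^esub>"
      then obtain h g where *: "p = (h, g)" "h \<in> H v" "g \<in> gen C" "h \<otimes> g = \<one>" by auto
      interpret \<rho>: group_hom G G "\<rho> v" using C by (intro group_hom_\<rho>)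
      have "h \<in> carrier G" "g \<in> carrier G" using c * by blast+
      moreover have "\<rho> v g = \<one>" "\<rho> v h = h" using \<rho>_gen[of v C g] \<rho>(2)[of v h] C(2,3) *(2,3) insert.hyps(2) by simp_all
      ultimately have "\<rho> v (h \<otimes> g) = h" by simp
      then have "h = \<one>" using * by simp
      with * c show "p = \<one>\<^bsub>K v \<times>\<times> ?Q\<^esub>" by simp
    qed
    have "gen (insert v C) \<subseteq> (\<lambda>(h, g). h \<otimes> g) ` (H v \<times> gen C)"
      using gen_insert[OF C(4,5)] by (force simp: image_iff)
    moreover have "(\<lambda>(h, g). h \<otimes> g) ` carrier (K v \<times>\<times> ?Q) \<subseteq> carrier ?P"
      using hom_in_carrier[OF hom] by blast
    ultimately show "(\<lambda>(h, g). h \<otimes> g) ` carrier (K v \<times>\<times> ?Q) = carrier ?P" by simp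
  qed
  then have "?P \<cong> K v \<times>\<times> ?Q" using is_isoI group.iso_sym[OF DirProd_group[OF g(3,2)]] by blast
  then show ?case using insert C g by (intro decomposition.insert) auto
qed

lemma conj_eq_one:
  assumes "g \<in> carrier G" "x \<in> carrier G" "g \<otimes> x \<otimes> inv g = \<one>"
  shows "x = \<one>"
proof -
  have "g \<otimes> x \<otimes> inv g = g \<otimes> \<one> \<otimes> inv g" using assms by simp
  then show ?thesis using assms(1,2) by (metis inv_closed l_cancel_one m_closed one_closed r_one right_cancel)
qed

definition "conjugate g X = (\<lambda>x. g \<otimes> x \<otimes> inv g) ` X"

text \<open>For \<open>v\<close> outside \<open>D\<close> the retraction \<open>\<rho> v\<close>
  kills \<open>gen D\<close>, yet it sends a conjugate of a nontrivial element of \<open>H v\<close>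
  to a conjugate of that element.\<close>

lemma conj_subset_clique:
  assumes "C \<subseteq> V" "D \<subseteq> V" "\<And>v. v \<in> C \<Longrightarrow> H v \<noteq> {\<one>}" "g \<in> carrier G" "conjugate g (gen C) \<subseteq> gen D"
  shows "C \<subseteq> D"
proof
  fix v assume v: "v \<in> C"
  show "v \<in> D"
  proof (rule ccontr)
    assume "v \<notin> D"
    have vV: "v \<in> V" using v assms(1) by blast
    have "\<one> \<in> H v" using subgroup_H[OF vV] by (rule subgroup.one_closed)
    then obtain h where h: "h \<in> H v" "h \<noteq> \<one>" using assms(3)[OF v] by blast
    have hG: "h \<in> carrier G" using h vV H_closed by blast
    have "g \<otimes> h \<otimes> inv g \<in> gen D" using assms(5) h H_subset_gen[OF v] by (auto simp: conjugate_def)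
    then have "\<rho> v (g \<otimes> h \<otimes> inv g) = \<one>" using \<rho>_gen[OF vV assms(2) \<open>v \<notin> D\<close>] by blast
    moreover interpret \<rho>: group_hom G G "\<rho> v" using vV by (rule group_hom_\<rho>)
    have "\<rho> v (g \<otimes> h \<otimes> inv g) = \<rho> v g \<otimes> h \<otimes> inv (\<rho> v g)"
      using assms(4) hG \<rho>(2)[OF vV h(1)] by simp
    ultimately have "\<rho> v g \<otimes> h \<otimes> inv (\<rho> v g) = \<one>" by simp
    then have "h = \<one>" using conj_eq_one[OF \<rho>.hom_closed[OF assms(4)] hG] by blast
    with h show False by blast
  qed
qed

end

section \<open>Splitting off a vertex\<close>

text \<open>Elements of \<open>BijGroup R\<close> are extensional, hence the restriction;
  bijectivity comes from the action of inverses.\<close>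

lemma hom_BijGroup_restrict:
  assumes "\<And>g w. g \<in> carrier G \<Longrightarrow> w \<in> R \<Longrightarrow> h g w \<in> R"
    and "\<And>w. w \<in> R \<Longrightarrow> h \<one>\<^bsub>G\<^esub> w = w"
    and "\<And>g g' w. g \<in> carrier G \<Longrightarrow> g' \<in> carrier G \<Longrightarrow> w \<in> R \<Longrightarrow> h (g \<otimes>\<^bsub>G\<^esub> g') w = h g (h g' w)"
    and "group G"
  shows "(\<lambda>g. restrict (h g) R) \<in> hom G (BijGroup R)"
proof -
  interpret group G by fact
  have bij: "restrict (h g) R \<in> Bij R" if "g \<in> carrier G" for g
  proof -
    have "bij_betw (h g) R R"
      by (rule bij_betw_byWitness[where f' = "h (inv\<^bsub>G\<^esub> g)"])
        (use assms(1,2) assms(3)[symmetric] that in auto)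
    then show ?thesis by (simp add: Bij_def bij_betw_restrict_eq)
  qed
  show ?thesis
    by (rule homI) (auto simp: BijGroup_def bij compose_def assms(1,3) intro!: ext)
qed

text \<open>With \<open>Q = G\<^bsub>S - v\<^esub>\<close> and \<open>L = G\<^bsub>link v\<^esub>\<close>, the group \<open>G\<^bsub>S\<^esub>\<close> is a semidirect product of the free
  product of copies of \<open>H v\<close> indexed by the cosets \<open>qL\<close> in \<open>Q\<close> with \<open>Q\<close>. Instead of proving this, one
  lets it act on the would-be normal forms: a letter \<open>(qL, a)\<close> stands for \<open>q a q\<^sup>-\<^sup>1\<close>, which is
  well defined because \<open>L\<close> commutes with \<open>H v\<close>, and the set \<open>R\<close> of reduced words is in bijection with
  \<open>G\<^bsub>S\<^esub> / Q\<close>. Words at distance one form a tree of complete graphs.\<close>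

locale vertex_splitting = graph_product_group +
  fixes S v
  assumes S: "S \<subseteq> V" and v: "v \<in> S"
begin

definition "Q = gen (S - {v})"
definition "link = {u \<in> S - {v}. {v, u} \<in> E}"
definition "L = gen link"
definition "X = (\<lambda>q. q <# L) ` Q"

definition "R = {w. set w \<subseteq> X \<times> (H v - {\<one>}) \<and> successively (\<lambda>p q. fst p \<noteq> fst q) w}"

text \<open>Van der Waerden's trick: left multiplication by the letter \<open>(x, a)\<close> in the
  free product, with the reduction built in. A first letter at the same coset is merged with it and
  dropped if the two cancel.\<close>

definition letter where
  "letter x a w = (case w of
     [] \<Rightarrow> if a = \<one> then [] else [(x, a)]
   | (y, b) # w' \<Rightarrow> if y = x then (if a \<otimes> b = \<one> then w' else (x, a \<otimes> b) # w')
       else (if a = \<one> then w else (x, a) # w))"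

definition translate where "translate q w = map (\<lambda>(x, a). (q <# x, a)) w"

lemma vV: "v \<in> V" using S v by blast
lemma SvV: "S - {v} \<subseteq> V" using S by blast
lemma linkV: "link \<subseteq> V" using S by (auto simp: link_def)

lemma subgroups: "subgroup Q G" "subgroup L G" "subgroup (H v) G" "subgroup (gen S) G"
  unfolding Q_def L_def using SvV linkV vV S by (auto intro: subgroup_gen subgroup_H)

lemma L_subset_Q: "L \<subseteq> Q"
  unfolding L_def Q_def by (rule gen_mono) (auto simp: link_def)

lemma Q_subset: "Q \<subseteq> gen S"
  unfolding Q_def by (rule gen_mono) auto

lemma Hv_subset: "H v \<subseteq> gen S"
  using v by (rule H_subset_gen)

lemma inG:
  "a \<in> H v \<Longrightarrow> a \<in> carrier G" "q \<in> Q \<Longrightarrow> q \<in> carrier G" "l \<in> L \<Longrightarrow> l \<in> carrier G"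
  "g \<in> gen S \<Longrightarrow> g \<in> carrier G"
  using subgroups[THEN subgroup.subset] by blast+

lemma Q_closed: "p \<in> Q \<Longrightarrow> q \<in> Q \<Longrightarrow> p \<otimes> q \<in> Q" "q \<in> Q \<Longrightarrow> inv q \<in> Q" "\<one> \<in> Q"
  using subgroups(1) by (auto simp: subgroup.m_closed subgroup.m_inv_closed subgroup.one_closed)

lemma Hv_closed: "a \<in> H v \<Longrightarrow> b \<in> H v \<Longrightarrow> a \<otimes> b \<in> H v" "a \<in> H v \<Longrightarrow> inv a \<in> H v" "\<one> \<in> H v"
  using subgroups(3) by (auto simp: subgroup.m_closed subgroup.m_inv_closed subgroup.one_closed)

lemma genS_closed:
  "a \<in> gen S \<Longrightarrow> b \<in> gen S \<Longrightarrow> a \<otimes> b \<in> gen S" "a \<in> gen S \<Longrightarrow> inv a \<in> gen S" "\<one> \<in> gen S"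
  using subgroups(4) by (auto simp: subgroup.m_closed subgroup.m_inv_closed subgroup.one_closed)

lemma L_commute: "a \<in> H v \<Longrightarrow> l \<in> L \<Longrightarrow> a \<otimes> l = l \<otimes> a"
  using vertex_gen_commute[OF linkV vV] by (auto simp: link_def L_def)

lemma L_carrier: "L \<subseteq> carrier G" using inG by blast

lemma X_carrier: "x \<in> X \<Longrightarrow> x \<subseteq> carrier G"
  unfolding X_def using l_coset_subset_G[OF L_carrier] inG by blast

lemma coset_mult: "p \<in> Q \<Longrightarrow> q \<in> Q \<Longrightarrow> p <# (q <# L) = (p \<otimes> q) <# L"
  using lcos_m_assoc[OF L_carrier] inG by blast

lemma coset_assoc: "x \<in> X \<Longrightarrow> p \<in> Q \<Longrightarrow> q \<in> Q \<Longrightarrow> p <# (q <# x) = (p \<otimes> q) <# x"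
  using lcos_m_assoc[OF X_carrier] inG by blast

lemma coset_one: "x \<in> X \<Longrightarrow> \<one> <# x = x"
  using lcos_mult_one[OF X_carrier] by blast

lemma coset_closed: "x \<in> X \<Longrightarrow> q \<in> Q \<Longrightarrow> q <# x \<in> X"
  unfolding X_def using coset_mult Q_closed by auto

lemma L_in_X: "L \<in> X"
  unfolding X_def using lcos_mult_one[OF L_carrier] Q_closed(3) by (metis imageI)

lemma coset_inj: "x \<in> X \<Longrightarrow> y \<in> X \<Longrightarrow> q \<in> Q \<Longrightarrow> q <# x = q <# y \<longleftrightarrow> x = y"
  by (metis coset_assoc coset_one l_inv Q_closed(2) inG(2))

lemma coset_L: "l \<in> L \<Longrightarrow> l <# L = L"
  using subgroups(2) by (simp add: coset_join3 inG)

text \<open>The stabilizer computation for cosets, needed to place a group preserving one complete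
  graph into a conjugate of the subgroup of the star of \<open>v\<close>.\<close>

lemma coset_fix:
  assumes "p \<in> Q" "q \<in> Q" "q <# (p <# L) = p <# L"
  shows "inv p \<otimes> q \<otimes> p \<in> L"
proof -
  have "(inv p \<otimes> q \<otimes> p) <# L = inv p <# (q <# (p <# L))"
    using assms(1,2) Q_closed by (simp add: coset_mult inG m_assoc)
  also have "\<dots> = inv p <# (p <# L)" by (simp only: assms(3))
  also have "\<dots> = L"
    using assms(1) Q_closed by (simp add: coset_mult inG lcos_mult_one[OF L_carrier])
  finally have "(inv p \<otimes> q \<otimes> p) <# L = L" .
  moreover have "(inv p \<otimes> q \<otimes> p) \<otimes> \<one> \<in> (inv p \<otimes> q \<otimes> p) <# L"
    unfolding l_coset_def using subgroup.one_closed[OF subgroups(2)] by blast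
  ultimately show ?thesis using assms inG by simp
qed

section \<open>Insertion of letters and translation on reduced words\<close>

lemma R_Nil: "[] \<in> R" by (simp add: R_def)

lemma R_Cons: "(x, a) # w \<in> R \<longleftrightarrow>
    x \<in> X \<and> a \<in> H v \<and> a \<noteq> \<one> \<and> w \<in> R \<and> (w = [] \<or> fst (hd w) \<noteq> x)"
  by (cases w) (auto simp: R_def)

lemma letter_Nil: "letter x a [] = (if a = \<one> then [] else [(x, a)])"
  by (simp add: letter_def)

lemma letter_Cons: "letter x a ((y, b) # w) = (if y = x then (if a \<otimes> b = \<one> then w else (x, a \<otimes> b) # w)
       else (if a = \<one> then (y, b) # w else (x, a) # (y, b) # w))"
  by (simp add: letter_def)

lemma letter_reduced: "a \<noteq> \<one> \<Longrightarrow> w = [] \<or> fst (hd w) \<noteq> x \<Longrightarrow> letter x a w = (x, a) # w"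
  by (cases w) (auto simp: letter_def split: prod.split)

lemma letter_closed: "x \<in> X \<Longrightarrow> a \<in> H v \<Longrightarrow> w \<in> R \<Longrightarrow> letter x a w \<in> R"
  using Hv_closed by (cases w) (auto simp: letter_Nil letter_Cons R_Cons R_Nil)

lemma letter_one: "w \<in> R \<Longrightarrow> letter x \<one> w = w"
  by (cases w) (auto simp: letter_Nil letter_Cons R_Cons inG)

lemma letter_mult:
  assumes "a \<in> H v" "b \<in> H v" "w \<in> R"
  shows "letter x (a \<otimes> b) w = letter x a (letter x b w)"
proof (cases w)
  case Nil
  then show ?thesis using assms inG by (auto simp: letter_Nil letter_Cons)
next
  case (Cons p w')
  obtain y c where w: "w = (y, c) # w'" using Cons by (cases p) auto
  have c: "a \<in> carrier G" "b \<in> carrier G" "c \<in> carrier G" using assms w inG by (auto simp: R_Cons)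
  have w': "w' = [] \<or> fst (hd w') \<noteq> y" using assms(3) w by (simp add: R_Cons)
  show ?thesis
  proof (cases "y = x")
    case True
    show ?thesis
    proof (cases "b \<otimes> c = \<one>")
      \<comment> \<open>After the cancellation \<open>w'\<close> does not start with the coset
        \<open>x\<close>, so \<open>a\<close> is put in front without merging.\<close>
      case bc: True
      then have abc: "a \<otimes> b \<otimes> c = a" using c by (simp add: m_assoc)
      then show ?thesis using bc True w' letter_reduced[of a w' x] letter_one[of w' x] assms(3)
        by (cases "a = \<one>") (simp_all add: w letter_Cons R_Cons)
    next
      case False
      then show ?thesis using True c by (simp add: w letter_Cons m_assoc)
    qed
  next
    case False
    then show ?thesis using c by (auto simp: w letter_Cons)
  qed
qed

lemma translate_Nil: "translate q [] = []" and
  translate_Cons: "translate q ((x, a) # w) = (q <# x, a) # translate q w" and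
  length_translate: "length (translate q w) = length w"
  by (simp_all add: translate_def)

lemma translate_closed: "w \<in> R \<Longrightarrow> q \<in> Q \<Longrightarrow> translate q w \<in> R"
proof (induction w)
  case (Cons p w)
  then obtain x a where p: "p = (x, a)" by (cases p)
  with Cons show ?case
    by (cases w) (auto simp: translate_Nil translate_Cons R_Cons coset_closed coset_inj)
qed (simp add: translate_Nil)

lemma translate_one: "w \<in> R \<Longrightarrow> translate \<one> w = w"
  by (induction w) (auto simp: translate_Nil translate_Cons R_Cons coset_one)

lemma translate_mult: "w \<in> R \<Longrightarrow> p \<in> Q \<Longrightarrow> q \<in> Q \<Longrightarrow> translate (p \<otimes> q) w = translate p (translate q w)"
  by (induction w) (auto simp: translate_Nil translate_Cons R_Cons coset_assoc)

lemma translate_letter: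
  assumes "x \<in> X" "w \<in> R" "q \<in> Q"
  shows "translate q (letter x a w) = letter (q <# x) a (translate q w)"
  using assms
  by (cases w) (auto simp: translate_Nil translate_Cons letter_Nil letter_Cons R_Cons coset_inj)

text \<open>The vertex \<open>v\<close> acts at the base coset \<open>L\<close>. Vertices outside
  \<open>S\<close> act trivially because the universal property speaks about the whole graph; this
  amounts to retracting \<open>G\<close> onto \<open>gen S\<close>.\<close>

definition "vertex_act u g = (if u = v then letter L g else if u \<in> S then translate g else id)"

lemma vertex_act_hom:
  assumes "u \<in> V"
  shows "(\<lambda>g. restrict (vertex_act u g) R) \<in> hom (K u) (BijGroup R)"
proof -
  consider "u = v" | "u \<in> S - {v}" | "u \<notin> S" using v by blast
  then show ?thesis
  proof cases
    case 1
    then show ?thesis unfolding vertex_act_def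
      by (intro hom_BijGroup_restrict) (auto simp: L_in_X letter_closed letter_one letter_mult group_K vV)
  next
    case 2
    then have "H u \<subseteq> Q" unfolding Q_def by (rule H_subset_gen)
    with 2 show ?thesis unfolding vertex_act_def
      by (intro hom_BijGroup_restrict group_K assms) (auto simp: translate_closed translate_one translate_mult subset_iff)
  next
    case 3
    with v show ?thesis unfolding vertex_act_def
      by (intro hom_BijGroup_restrict group_K assms) auto
  qed
qed

lemma vertex_act_Bij: "u \<in> V \<Longrightarrow> g \<in> H u \<Longrightarrow> restrict (vertex_act u g) R \<in> Bij R"
  using hom_in_carrier[OF vertex_act_hom] by (fastforce simp: BijGroup_def)

lemma vertex_act_closed: "u \<in> V \<Longrightarrow> g \<in> H u \<Longrightarrow> w \<in> R \<Longrightarrow> vertex_act u g w \<in> R"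
  using funcset_mem[OF Bij_imp_funcset[OF vertex_act_Bij]] by fastforce

text \<open>Elements of \<open>L\<close> fix the coset \<open>L\<close>, so translating by them does
  not change the place where the letter is inserted. This is how the edges at \<open>v\<close> are
  respected.\<close>

lemma vertex_act_commute_link:
  assumes "u \<in> link" "l \<in> H u" "a \<in> H v" "w \<in> R"
  shows "translate l (letter L a w) = letter L a (translate l w)"
proof -
  have "l \<in> L" using assms H_subset_gen[of u link] unfolding L_def by auto
  then show ?thesis using translate_letter[OF L_in_X assms(4), of l a] L_subset_Q by (auto simp: coset_L)
qed

lemma vertex_act_commute:
  assumes "{u, u'} \<in> E" "g \<in> H u" "g' \<in> H u'" "w \<in> R"
  shows "vertex_act u g (vertex_act u' g' w) = vertex_act u' g' (vertex_act u g w)"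
proof -
  have ne: "u \<noteq> u'" using assms not_loop by auto
  have sub: "H u \<subseteq> Q" if "u \<in> S - {v}" for u using that unfolding Q_def by (rule H_subset_gen)
  show ?thesis
  proof (cases "u \<in> S \<and> u' \<in> S")
    case True
    consider "u = v" | "u' = v" | "u \<noteq> v" "u' \<noteq> v" by blast
    then show ?thesis
    proof cases
      case 1
      then have "u' \<in> link" using True assms ne by (auto simp: link_def)
      then show ?thesis using vertex_act_commute_link[of u' g' g w] 1 True ne assms by (simp add: vertex_act_def)
    next
      case 2
      then have "u \<in> link" using True assms ne by (auto simp: link_def insert_commute)
      then show ?thesis using vertex_act_commute_link[of u g g' w] 2 True ne assms by (simp add: vertex_act_def)
    next
      case 3
      then have "g \<in> Q" "g' \<in> Q" using sub True assms by blast+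
      then show ?thesis using 3 True edge_commute[OF assms(1-3)] translate_mult[OF assms(4)]
        by (simp add: vertex_act_def) metis
    qed
  qed (use v in \<open>auto simp: vertex_act_def\<close>)
qed

section \<open>The action of \<open>G\<close> on reduced words\<close>

definition "act = (SOME \<phi>. \<phi> \<in> hom G (BijGroup R) \<and> (\<forall>u\<in>V. \<forall>g\<in>H u. \<phi> g = restrict (vertex_act u g) R))"

lemma act_hom: "act \<in> hom G (BijGroup R)"
  and act_vertex: "u \<in> V \<Longrightarrow> g \<in> H u \<Longrightarrow> w \<in> R \<Longrightarrow> act g w = vertex_act u g w"
proof -
  have "\<exists>\<phi>\<in>hom G (BijGroup R). \<forall>u\<in>V. \<forall>g\<in>H u. \<phi> g = restrict (vertex_act u g) R"
  proof (rule hom_extension[OF group_BijGroup vertex_act_hom])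
    show "restrict (vertex_act u g) R \<otimes>\<^bsub>BijGroup R\<^esub> restrict (vertex_act u' g') R =
        restrict (vertex_act u' g') R \<otimes>\<^bsub>BijGroup R\<^esub> restrict (vertex_act u g) R"
      if e: "{u, u'} \<in> E" "g \<in> H u" "g' \<in> H u'" for u u' g g'
      using e edge_in_V[OF e(1)] vertex_act_Bij vertex_act_closed vertex_act_commute[OF e]
      by (auto simp: BijGroup_def compose_def)
  qed
  then have "\<exists>\<phi>. \<phi> \<in> hom G (BijGroup R) \<and> (\<forall>u\<in>V. \<forall>g\<in>H u. \<phi> g = restrict (vertex_act u g) R)" by blast
  from someI_ex[OF this, folded act_def]
  show "act \<in> hom G (BijGroup R)" "u \<in> V \<Longrightarrow> g \<in> H u \<Longrightarrow> w \<in> R \<Longrightarrow> act g w = vertex_act u g w"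
    by auto
qed

lemma act_Bij: "g \<in> carrier G \<Longrightarrow> act g \<in> Bij R"
  using hom_in_carrier[OF act_hom] by (simp add: BijGroup_def)

lemma act_closed: "g \<in> carrier G \<Longrightarrow> w \<in> R \<Longrightarrow> act g w \<in> R"
  using Bij_imp_funcset[OF act_Bij] by blast

lemma act_mult: "g \<in> carrier G \<Longrightarrow> h \<in> carrier G \<Longrightarrow> w \<in> R \<Longrightarrow> act (g \<otimes> h) w = act g (act h w)"
  using hom_mult[OF act_hom] by (simp add: BijGroup_def act_Bij compose_def)

lemma act_one: "w \<in> R \<Longrightarrow> act \<one> w = w"
  using hom_one[OF act_hom group_axioms group_BijGroup] by (simp add: BijGroup_def)

lemma act_inv: "g \<in> carrier G \<Longrightarrow> w \<in> R \<Longrightarrow> act (inv g) (act g w) = w"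
  by (simp add: act_one flip: act_mult)

lemma act_v: "a \<in> H v \<Longrightarrow> w \<in> R \<Longrightarrow> act a w = letter L a w"
  using act_vertex[OF vV] by (simp add: vertex_act_def)

lemma act_Q: "q \<in> Q \<Longrightarrow> w \<in> R \<Longrightarrow> act q w = translate q w"
  unfolding Q_def gen_def
proof (induction arbitrary: w rule: generate.induct)
  have gens: "act h w = translate h w" if "u \<in> S - {v}" "h \<in> H u" "w \<in> R" for u h w
    using act_vertex[of u h w] that S by (auto simp: vertex_act_def)
  {
    case one
    then show ?case by (simp add: act_one translate_one)
  next
    case (incl h)
    then show ?case using gens by blast
  next
    case (inv h)
    then obtain u where "u \<in> S - {v}" "h \<in> H u" by blast
    moreover from this have "inv h \<in> H u" using subgroup_H[of u] S by (auto intro: subgroup.m_inv_closed)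
    ultimately show ?case using gens inv by blast
  next
    case (eng p q)
    then have "p \<in> Q" "q \<in> Q" by (auto simp: Q_def gen_def)
    then show ?case using eng.prems eng.IH(2)[OF eng.prems] eng.IH(1)[OF translate_closed[OF eng.prems]]
      by (simp add: act_mult inG translate_mult)
  }
qed

section \<open>Evaluation of reduced words in \<open>G\<close>\<close>

definition "rep x = (SOME q. q \<in> Q \<and> x = q <# L)"
definition "lt x a = rep x \<otimes> a \<otimes> inv (rep x)"
definition "ev w = foldr (\<lambda>(x, a) g. lt x a \<otimes> g) w \<one>"

lemma rep: "x \<in> X \<Longrightarrow> rep x \<in> Q" "x \<in> X \<Longrightarrow> x = rep x <# L"
proof -
  assume "x \<in> X"
  then have "\<exists>q. q \<in> Q \<and> x = q <# L" by (auto simp: X_def)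
  from someI_ex[OF this, folded rep_def] show "rep x \<in> Q" "x = rep x <# L" by blast+
qed

lemma lt_coset:
  assumes "q \<in> Q" "a \<in> H v"
  shows "lt (q <# L) a = q \<otimes> a \<otimes> inv q"
proof -
  let ?p = "rep (q <# L)"
  have X: "q <# L \<in> X" using assms by (auto simp: X_def)
  have p: "?p \<in> Q" using rep X by blast
  have "?p \<otimes> \<one> \<in> ?p <# L"
    unfolding l_coset_def using subgroup.one_closed[OF subgroups(2)] by blast
  then have "?p \<in> q <# L" using rep(2)[OF X] p inG by auto
  then obtain l where l: "l \<in> L" "?p = q \<otimes> l" by (auto simp: l_coset_def)
  have c: "q \<in> carrier G" "a \<in> carrier G" "l \<in> carrier G" using l assms inG by auto
  have "lt (q <# L) a = q \<otimes> (l \<otimes> a \<otimes> inv l) \<otimes> inv q"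
    unfolding lt_def l(2) using c by (simp add: m_assoc inv_mult_group)
  also have "l \<otimes> a \<otimes> inv l = a"
    using L_commute[OF assms(2) l(1), symmetric] c by (simp add: m_assoc)
  finally show ?thesis .
qed

lemma lt_L: "a \<in> H v \<Longrightarrow> lt L a = a"
  using lt_coset[of \<one> a] Q_closed(3) inG lcos_mult_one[OF L_carrier] by simp

lemma lt_closed: "x \<in> X \<Longrightarrow> a \<in> H v \<Longrightarrow> lt x a \<in> gen S"
  unfolding lt_def using rep(1) Q_subset Hv_subset by (intro genS_closed) auto

lemma lt_mult: "x \<in> X \<Longrightarrow> a \<in> H v \<Longrightarrow> b \<in> H v \<Longrightarrow> lt x (a \<otimes> b) = lt x a \<otimes> lt x b"
  unfolding lt_def using rep(1) inG by (simp add: m_assoc inv_solve_left)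

lemma lt_one: "x \<in> X \<Longrightarrow> lt x \<one> = \<one>"
  unfolding lt_def using rep(1) inG by simp

lemma lt_inv: "x \<in> X \<Longrightarrow> a \<in> H v \<Longrightarrow> inv (lt x a) = lt x (inv a)"
  using lt_mult[of x "inv a" a] lt_one[of x] Hv_closed inG lt_closed by (intro inv_equality) auto

lemma lt_translate:
  assumes "x \<in> X" "a \<in> H v" "q \<in> Q"
  shows "q \<otimes> lt x a = lt (q <# x) a \<otimes> q"
proof -
  have r: "rep x \<in> Q" "x = rep x <# L" using assms rep by auto
  have "q <# x = (q \<otimes> rep x) <# L" using coset_mult[OF assms(3) r(1)] r(2) by simp
  then have "lt (q <# x) a = (q \<otimes> rep x) \<otimes> a \<otimes> inv (q \<otimes> rep x)"
    using lt_coset[of "q \<otimes> rep x" a] Q_closed(1) r(1) assms by simp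
  then show ?thesis unfolding lt_def using assms r(1) inG by (simp add: m_assoc inv_mult_group)
qed

text \<open>The inverse of the representative moves the coset \<open>x\<close> to the base coset
  \<open>L\<close>, where \<open>act_v\<close> describes the action, and the representative moves it
  back.\<close>

lemma act_lt:
  assumes "x \<in> X" "a \<in> H v" "w \<in> R"
  shows "act (lt x a) w = letter x a w"
proof -
  have r: "rep x \<in> Q" "rep x <# L = x" using assms rep by auto
  have ri: "inv (rep x) \<in> Q" using r Q_closed by blast
  have c: "rep x \<in> carrier G" "a \<in> carrier G" "inv (rep x) \<in> carrier G" using r ri assms inG by blast+
  have R': "translate (inv (rep x)) w \<in> R" using translate_closed assms ri by blast
  have "act (lt x a) w = translate (rep x) (letter L a (translate (inv (rep x)) w))"
    unfolding lt_def using c assms r ri R' L_in_X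
    by (simp add: act_mult act_closed act_Q act_v letter_closed)
  also have "\<dots> = letter x a (translate (rep x \<otimes> inv (rep x)) w)"
    using R' r(1) ri assms(3) by (simp only: translate_letter L_in_X r(2) translate_mult)
  finally show ?thesis using c assms by (simp add: translate_one)
qed

lemma ev_Nil: "ev [] = \<one>" and ev_Cons: "ev ((x, a) # w) = lt x a \<otimes> ev w"
  by (simp_all add: ev_def)

lemma ev_closed: "w \<in> R \<Longrightarrow> ev w \<in> gen S"
  by (induction w) (auto simp: ev_Nil ev_Cons R_Cons lt_closed genS_closed)

lemma R_append: "w @ w' \<in> R \<longleftrightarrow> w \<in> R \<and> w' \<in> R \<and> (w = [] \<or> w' = [] \<or> fst (last w) \<noteq> fst (hd w'))"
  by (auto simp: R_def successively_append_iff)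

text \<open>Building up a reduced word never causes a merge. With \<open>w'\<close> empty,
  \<open>ev w\<close> sends the empty word to \<open>w\<close>, so different reduced words evaluate
  into different cosets of \<open>Q\<close>.\<close>

lemma act_ev: "w @ w' \<in> R \<Longrightarrow> act (ev w) w' = w @ w'"
proof (induction w)
  case Nil
  then show ?case by (simp add: ev_Nil act_one)
next
  case (Cons p w)
  obtain x a where p: "p = (x, a)" by (cases p)
  have xa: "x \<in> X" "a \<in> H v" "a \<noteq> \<one>" "w @ w' \<in> R" "w @ w' = [] \<or> fst (hd (w @ w')) \<noteq> x"
    using Cons.prems by (auto simp: p R_Cons)
  then have "w \<in> R" "w' \<in> R" by (simp_all add: R_append)
  then have "act (ev (p # w)) w' = letter x a (w @ w')"
    unfolding p ev_Cons using xa Cons.IH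
    by (simp add: act_mult inG(4) lt_closed ev_closed act_lt)
  also have "letter x a (w @ w') = (x, a) # w @ w'" using xa by (intro letter_reduced)
  finally show ?case by (simp add: p)
qed

definition "winv w = rev (map (\<lambda>(x, a). (x, inv a)) w)"

lemma ev_append: "u \<in> R \<Longrightarrow> w \<in> R \<Longrightarrow> ev (u @ w) = ev u \<otimes> ev w"
  by (induction u) (auto simp: ev_Nil ev_Cons R_Cons inG(4) ev_closed lt_closed m_assoc)

lemma winv_closed: "w \<in> R \<Longrightarrow> winv w \<in> R"
proof -
  assume "w \<in> R"
  then have "set w \<subseteq> X \<times> (H v - {\<one>})" "successively (\<lambda>p q. fst q \<noteq> fst p) w"
    by (auto simp: R_def elim: successively_mono)
  moreover have "set (winv w) \<subseteq> X \<times> (H v - {\<one>})" if "set w \<subseteq> X \<times> (H v - {\<one>})"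
    using that Hv_closed(2) inG(1) by (auto simp: winv_def inv_eq_1_iff dest!: subsetD)
  moreover have "successively (\<lambda>p q. fst p \<noteq> fst q) (winv w)" if "successively (\<lambda>p q. fst q \<noteq> fst p) w"
    using that by (simp add: winv_def successively_map case_prod_unfold)
  ultimately show "winv w \<in> R" by (simp add: R_def)
qed

lemma winv_last: "w \<noteq> [] \<Longrightarrow> fst (last (winv w)) = fst (hd w)"
  by (cases w) (auto simp: winv_def)

lemma winv_Nil: "winv w = [] \<longleftrightarrow> w = []"
  by (simp add: winv_def)

lemma inv_ev: "w \<in> R \<Longrightarrow> inv (ev w) = ev (winv w)"
proof (induction w)
  case (Cons p w)
  obtain x a where p: "p = (x, a)" by (cases p)
  have xa: "x \<in> X" "a \<in> H v" "a \<noteq> \<one>" "w \<in> R" using Cons.prems by (auto simp: p R_Cons)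
  then have "[(x, inv a)] \<in> R" using Hv_closed by (auto simp: R_Cons R_Nil inG)
  moreover have "winv (p # w) = winv w @ [(x, inv a)]" by (simp add: p winv_def)
  ultimately show ?case using xa Cons.IH winv_closed
    by (simp add: p ev_Cons ev_append ev_Nil inv_mult_group inG(4) lt_closed ev_closed lt_inv Hv_closed)
qed (simp add: ev_Nil winv_def)

text \<open>Up to a factor in \<open>Q\<close> on the right, \<open>ev\<close> is equivariant: words
  describe cosets of \<open>Q\<close> in \<open>gen S\<close>. A generator in \<open>H v\<close>
  needs no correction, while an element of \<open>Q\<close> passes through the word and reappears on
  its right.\<close>

lemma ev_cocycle: "g \<in> gen S \<Longrightarrow> w \<in> R \<Longrightarrow> \<exists>q\<in>Q. g \<otimes> ev w = ev (act g w) \<otimes> q"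
  unfolding gen_def
proof (induction arbitrary: w rule: generate.induct)
  have Hv: "\<exists>q\<in>Q. a \<otimes> ev w = ev (act a w) \<otimes> q" if "a \<in> H v" "w \<in> R" for a w
  proof -
    have a: "a \<in> carrier G" "act a w = letter L a w" using that inG act_v by auto
    have "a \<otimes> ev w = ev (letter L a w)"
    proof (cases w)
      case Nil
      then show ?thesis using a that by (auto simp: letter_Nil ev_Nil ev_Cons lt_L)
    next
      case (Cons p w')
      obtain y b where w: "w = (y, b) # w'" using Cons by (cases p) auto
      have yb: "y \<in> X" "b \<in> H v" "b \<in> carrier G" "w' \<in> R" "ev w' \<in> carrier G" "lt y b \<in> carrier G"
        using that w inG ev_closed lt_closed by (auto simp: R_Cons)
      show ?thesis
      proof (cases "y = L")
        case True
        have "a \<otimes> ev w = (a \<otimes> b) \<otimes> ev w'" using yb a that by (simp add: w ev_Cons True lt_L m_assoc)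
        then show ?thesis using yb a that True by (simp add: w letter_Cons ev_Cons lt_L Hv_closed)
      next
        case False
        then show ?thesis using yb a that by (simp add: w letter_Cons ev_Cons lt_L)
      qed
    qed
    moreover have "ev (letter L a w) \<in> carrier G"
      using ev_closed[OF letter_closed[OF L_in_X that]] inG by blast
    ultimately show ?thesis using a Q_closed(3) by (intro bexI[of _ \<one>]) auto
  qed
  have Hu: "\<exists>q\<in>Q. q' \<otimes> ev w = ev (act q' w) \<otimes> q" if "q' \<in> Q" "w \<in> R" for q' w
  proof -
    have q': "q' \<in> carrier G" using that inG by blast
    have "q' \<otimes> ev w = ev (translate q' w) \<otimes> q'" using that(2)
    proof (induction w)
      case Nil
      then show ?case using q' by (simp add: translate_Nil ev_Nil)
    next
      case (Cons p w)
      obtain x a where p: "p = (x, a)" by (cases p)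
      have xa: "x \<in> X" "a \<in> H v" "w \<in> R" using Cons.prems by (auto simp: p R_Cons)
      then have c: "lt x a \<in> carrier G" "ev w \<in> carrier G" "ev (translate q' w) \<in> carrier G" "lt (q' <# x) a \<in> carrier G"
        using lt_closed ev_closed translate_closed coset_closed that(1) inG(4) by blast+
      have "q' \<otimes> ev (p # w) = (q' \<otimes> lt x a) \<otimes> ev w" using q' c by (simp add: p ev_Cons m_assoc)
      also have "\<dots> = lt (q' <# x) a \<otimes> (q' \<otimes> ev w)"
        using q' c lt_translate[OF xa(1,2) that(1)] by (simp add: m_assoc)
      also have "\<dots> = lt (q' <# x) a \<otimes> (ev (translate q' w) \<otimes> q')" using Cons.IH xa by simp
      finally show ?case using q' c by (simp add: p ev_Cons translate_Cons m_assoc)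
    qed
    then show ?thesis using act_Q that by (intro bexI[of _ q']) auto
  qed
  have gens: "\<exists>q\<in>Q. h \<otimes> ev w = ev (act h w) \<otimes> q" if "u \<in> S" "h \<in> H u" "w \<in> R" for u h w
  proof (cases "u = v")
    case True
    then show ?thesis using Hv that by blast
  next
    case False
    then have "h \<in> Q" using that H_subset_gen[of u "S - {v}"] by (auto simp: Q_def)
    then show ?thesis using Hu that by blast
  qed
  {
    case one
    then show ?case using Hu Q_closed(3) by blast
  next
    case (incl h)
    then show ?case using gens by blast
  next
    case (inv h)
    then obtain u where "u \<in> S" "h \<in> H u" by blast
    moreover from this have "inv h \<in> H u" using subgroup_H[of u] S by (auto intro: subgroup.m_inv_closed)
    ultimately show ?case using gens inv by blast
  next
    case (eng g h)
    then have gh: "g \<in> carrier G" "h \<in> carrier G" using inG(4) by (auto simp: gen_def)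
    have wR: "act h w \<in> R" using act_closed gh eng.prems by blast
    obtain q where q: "q \<in> Q" "h \<otimes> ev w = ev (act h w) \<otimes> q" using eng by blast
    obtain p where p: "p \<in> Q" "g \<otimes> ev (act h w) = ev (act g (act h w)) \<otimes> p" using eng.IH(1)[OF wR] by blast
    have c: "ev w \<in> carrier G" "ev (act h w) \<in> carrier G" "ev (act g (act h w)) \<in> carrier G"
      "p \<in> carrier G" "q \<in> carrier G"
      using wR act_closed gh eng.prems ev_closed inG p q by blast+
    have "(g \<otimes> h) \<otimes> ev w = (g \<otimes> ev (act h w)) \<otimes> q" using gh c q(2) by (simp add: m_assoc)
    also have "\<dots> = ev (act (g \<otimes> h) w) \<otimes> (p \<otimes> q)"
      unfolding p(2) act_mult[OF gh eng.prems] using c by (simp add: m_assoc)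
    finally show ?case using p q Q_closed by blast
  }
qed

lemma decompose: "g \<in> gen S \<Longrightarrow> \<exists>q\<in>Q. g = ev (act g []) \<otimes> q"
  using ev_cocycle[of g "[]"] R_Nil by (auto simp: ev_Nil inG)

text \<open>The distance from \<open>Q\<close> to \<open>g <# Q\<close> in the tree of complete
  graphs; thus \<open>len (inv g \<otimes> h)\<close> is the distance between the cosets of
  \<open>g\<close> and \<open>h\<close>.\<close>

definition "len g = length (act g [])"

text \<open>The paths from the base point to \<open>g\<close> and to \<open>h\<close> leave it
  through different complete graphs, unless one is empty, so joining them needs no reduction. The
  factor of \<open>g\<close> in \<open>Q\<close> only translates the joined word and keeps its
  length.\<close>

lemma len_disjoint:
  assumes "g \<in> gen S" "h \<in> gen S"
    and "act g [] = [] \<or> act h [] = [] \<or> fst (hd (act g [])) \<noteq> fst (hd (act h []))"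
  shows "len (inv g \<otimes> h) = len g + len h"
proof -
  let ?w = "act g []" and ?w' = "act h []"
  obtain q where q: "q \<in> Q" "g = ev ?w \<otimes> q" using decompose assms(1) by blast
  have gh: "g \<in> carrier G" "h \<in> carrier G" using assms inG by auto
  have w: "?w \<in> R" "?w' \<in> R" using gh act_closed R_Nil by auto
  have qG: "q \<in> carrier G" "inv q \<in> Q" using q inG Q_closed by auto
  have wi: "winv ?w \<in> R" using w winv_closed by blast
  have c: "ev ?w \<in> carrier G" "ev (winv ?w) \<in> carrier G" using w wi ev_closed inG by blast+
  have "winv ?w @ ?w' \<in> R"
    using wi w(2) assms(3) winv_last[of ?w] by (auto simp: R_append winv_Nil)
  then have "act (ev (winv ?w)) ?w' = winv ?w @ ?w'" by (rule act_ev)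
  moreover have "inv g = inv q \<otimes> ev (winv ?w)"
  proof -
    have "inv g = inv (ev ?w \<otimes> q)" using q(2) by simp
    then show ?thesis using c qG inv_ev[OF w(1)] by (simp add: inv_mult_group)
  qed
  ultimately have "act (inv g \<otimes> h) [] = translate (inv q) (winv ?w @ ?w')"
    using gh c qG w \<open>winv ?w @ ?w' \<in> R\<close> R_Nil by (simp add: act_mult act_Q act_closed)
  then show ?thesis by (simp add: len_def length_translate winv_def)
qed

end

section \<open>Finite subgroups are conjugate into cliques\<close>

context vertex_splitting
begin

lemma R_lengths:
  assumes "w \<in> R" "length w \<ge> 2"
  obtains x a y b w' where "w = (x, a) # (y, b) # w'" "x \<in> X" "a \<in> H v" "x \<noteq> y" "(y, b) # w' \<in> R" "[(x, a)] \<in> R"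
proof -
  obtain p q w' where "w = p # q # w'" using assms(2) by (cases w; cases "tl w") auto
  moreover obtain x a y b where "p = (x, a)" "q = (y, b)" by (cases p, cases q)
  ultimately show thesis using assms(1) that by (auto simp: R_Cons R_Nil)
qed

text \<open>A point strictly between two points separates one of them from any third point, hence is closer
  to the third point. So two centers of a finite set are at distance at most one.\<close>

lemma midpoint:
  assumes "g \<in> gen S" "h \<in> gen S" "len (inv g \<otimes> h) \<ge> 2"
  obtains s where "s \<in> gen S"
    "\<And>k. k \<in> gen S \<Longrightarrow> len (inv s \<otimes> k) < len (inv g \<otimes> k) \<or> len (inv s \<otimes> k) < len (inv h \<otimes> k)"
proof -
  let ?n = "inv g \<otimes> h"
  have n: "?n \<in> gen S" using assms genS_closed by blast
  have "act ?n [] \<in> R" using n act_closed R_Nil inG by blast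
  then obtain x a y b w' where w: "act ?n [] = (x, a) # (y, b) # w'" "x \<in> X" "a \<in> H v" "x \<noteq> y" "(y, b) # w' \<in> R" "[(x, a)] \<in> R"
    using R_lengths[of "act ?n []"] assms(3) by (metis len_def)
  define t where "t = lt x a"
  have t: "t \<in> gen S" "t \<in> carrier G" "inv t \<in> gen S"
    using w lt_closed inG(4) genS_closed by (auto simp: t_def)
  \<comment> \<open>The first point after \<open>g\<close> on the path to \<open>h\<close>: seen
    from \<open>s\<close>, \<open>g\<close> lies in the direction \<open>x\<close> and
    \<open>h\<close> in the direction \<open>y\<close>.\<close>
  define s where "s = g \<otimes> t"
  have s: "s \<in> gen S" using assms t genS_closed by (simp add: s_def)
  have c: "g \<in> carrier G" "h \<in> carrier G" using assms inG by auto
  have a: "a \<noteq> \<one>" "a \<in> carrier G" "inv a \<in> H v" using w(6) inG Hv_closed by (auto simp: R_Cons)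
  have sg: "inv s \<otimes> g = inv t" using c t by (simp add: s_def inv_mult_group m_assoc)
  have sh: "inv s \<otimes> h = inv t \<otimes> ?n" using c t by (simp add: s_def inv_mult_group m_assoc)
  have "inv t = lt x (inv a)" using lt_inv[OF w(2,3)] by (simp add: t_def)
  then have Asg: "act (inv s \<otimes> g) [] = [(x, inv a)]"
    using act_lt[OF w(2) a(3) R_Nil] a by (simp add: sg letter_Nil)
  have "act t ((y, b) # w') = act ?n []"
    using act_lt[OF w(2,3,5)] letter_reduced[OF a(1), of "(y, b) # w'" x] w(1,4) by (simp add: t_def)
  then have "act (inv t) (act ?n []) = (y, b) # w'"
    using act_inv[OF t(2) w(5)] by simp
  then have Ash: "act (inv s \<otimes> h) [] = (y, b) # w'"
    using act_mult[of "inv t" ?n "[]"] t(2) c R_Nil by (simp add: sh)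
  have "len (inv s \<otimes> k) < len (inv g \<otimes> k) \<or> len (inv s \<otimes> k) < len (inv h \<otimes> k)" if k: "k \<in> gen S" for k
  proof -
    have kc: "k \<in> carrier G" "s \<in> carrier G" using k s inG by auto
    have cl: "inv s \<otimes> k \<in> gen S" "inv s \<otimes> g \<in> gen S" "inv s \<otimes> h \<in> gen S"
      using s k assms genS_closed by auto
    have cancel: "inv (inv s \<otimes> z) \<otimes> (inv s \<otimes> k) = inv z \<otimes> k" if "z \<in> carrier G" for z
    proof -
      have "inv (inv s \<otimes> z) \<otimes> (inv s \<otimes> k) = inv z \<otimes> (s \<otimes> (inv s \<otimes> k))"
        using that kc by (simp add: inv_mult_group m_assoc)
      also have "s \<otimes> (inv s \<otimes> k) = k" using kc by (simp flip: m_assoc)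
      finally show ?thesis .
    qed
    \<comment> \<open>The path from \<open>s\<close> to \<open>k\<close> starts in at most one
      direction, so it avoids that of \<open>g\<close> or that of \<open>h\<close>; the path from
      that point to \<open>k\<close> then passes through \<open>s\<close> and is longer.\<close>
    let ?o = "act (inv s \<otimes> k) []"
    show ?thesis
    proof (cases "?o = [] \<or> fst (hd ?o) \<noteq> x")
      case True
      then have "len (inv (inv s \<otimes> g) \<otimes> (inv s \<otimes> k)) = len (inv s \<otimes> g) + len (inv s \<otimes> k)"
        by (intro len_disjoint cl) (auto simp: Asg)
      then show ?thesis by (simp add: cancel c len_def[of "inv s \<otimes> g"] Asg)
    next
      case False
      then have "len (inv (inv s \<otimes> h) \<otimes> (inv s \<otimes> k)) = len (inv s \<otimes> h) + len (inv s \<otimes> k)"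
        using w(4) by (intro len_disjoint cl) (auto simp: Ash)
      then show ?thesis by (simp add: cancel c len_def[of "inv s \<otimes> h"] Ash)
    qed
  qed
  with s show thesis by (rule that)
qed

text \<open>Take a center \<open>g\<close> of the orbit of the base point under \<open>U\<close>,
  that is, a minimum of the radius \<open>r\<close>. Left multiplication by \<open>U\<close>
  permutes the orbit, so \<open>k \<otimes> g\<close> is a center too; at distance two or more a
  midpoint would have smaller radius.\<close>

lemma finite_subgroup_small_displacement:
  assumes U: "subgroup U G" "finite U" "U \<subseteq> gen S"
  obtains g where "g \<in> gen S" "\<And>k. k \<in> U \<Longrightarrow> len (inv g \<otimes> k \<otimes> g) \<le> 1"
proof -
  define r where "r g = Max ((\<lambda>k. len (inv g \<otimes> k)) ` U)" for g
  have "U \<noteq> {}" using subgroup.one_closed[OF U(1)] by blast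
  have r: "r g \<le> m \<longleftrightarrow> (\<forall>k\<in>U. len (inv g \<otimes> k) \<le> m)" for g m
    unfolding r_def using U(2) \<open>U \<noteq> {}\<close> by simp
  obtain g where g: "g \<in> gen S" "\<And>h. h \<in> gen S \<Longrightarrow> r g \<le> r h"
    using ex_has_least_nat[of "\<lambda>g. g \<in> gen S" \<one> r] genS_closed(3) by blast
  have "len (inv g \<otimes> k \<otimes> g) \<le> 1" if k: "k \<in> U" for k
  proof (rule ccontr)
    assume far: "\<not> ?thesis"
    have kS: "k \<in> gen S" using k U by blast
    have c: "g \<in> carrier G" "k \<in> carrier G" using g kS inG by auto
    have "len (inv g \<otimes> (k \<otimes> g)) \<ge> 2" using far c by (simp add: m_assoc)
    then obtain s where s: "s \<in> gen S"
      "\<And>l. l \<in> gen S \<Longrightarrow> len (inv s \<otimes> l) < len (inv g \<otimes> l) \<or> len (inv s \<otimes> l) < len (inv (k \<otimes> g) \<otimes> l)"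
      using midpoint[of g "k \<otimes> g"] g(1) kS genS_closed(1) by metis
    have bound: "len (inv s \<otimes> l) < r g" if l: "l \<in> U" for l
    proof -
      have lS: "l \<in> gen S" "l \<in> carrier G" using l U inG by auto
      have kl: "inv k \<otimes> l \<in> U" using U(1) k l by (auto intro: subgroup.m_closed subgroup.m_inv_closed)
      have "inv (k \<otimes> g) \<otimes> l = inv g \<otimes> (inv k \<otimes> l)" using c lS by (simp add: inv_mult_group m_assoc)
      then have "len (inv (k \<otimes> g) \<otimes> l) \<le> r g" using r[of g "r g"] kl by simp
      moreover have "len (inv g \<otimes> l) \<le> r g" using r[of g "r g"] l by simp
      ultimately show ?thesis using s(2)[OF lS(1)] by linarith
    qed
    \<comment> \<open>Subtraction of natural numbers is safe here: the strict bounds make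
      \<open>r g\<close> positive.\<close>
    then have "r s \<le> r g - 1" using r[of s "r g - 1"] by fastforce
    moreover have "r g > 0" using bound \<open>U \<noteq> {}\<close> by fastforce
    ultimately show False using g(2)[OF s(1)] by linarith
  qed
  with g(1) show thesis by (rule that)
qed

text \<open>The orbit of the base point has diameter at most one. If it is a single point,
  \<open>U\<close> lies in the stabilizer \<open>Q\<close>. Otherwise it lies in a single complete
  graph, given by the coset \<open>x\<close>, which \<open>U\<close> preserves; the stabilizer of
  that graph is conjugate to \<open>gen (insert v link)\<close>.\<close>

lemma small_displacement_cases:
  assumes U: "subgroup U G" "U \<subseteq> gen S" and small: "\<And>k. k \<in> U \<Longrightarrow> len k \<le> 1"
  shows "U \<subseteq> Q \<or> (\<exists>p\<in>Q. conjugate (inv p) U \<subseteq> gen (insert v link))"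
proof (cases "\<forall>k\<in>U. len k = 0")
  case True
  have "k \<in> Q" if k: "k \<in> U" for k
    using decompose[of k] True k U by (auto simp: len_def ev_Nil inG)
  then show ?thesis by blast
next
  case False
  then obtain k0 where k0: "k0 \<in> U" "len k0 = 1" using small le_less by fastforce
  have UG: "U \<subseteq> carrier G" using U(1) by (rule subgroup.subset)
  have actR: "act k [] \<in> R" if "k \<in> U" for k using that UG act_closed R_Nil by blast
  obtain x a0 where x0: "act k0 [] = [(x, a0)]"
    using k0(2) unfolding len_def by (cases "act k0 []") auto
  have x: "x \<in> X" using actR[OF k0(1)] by (simp add: x0 R_Cons)
  let ?p = "rep x"
  have p: "?p \<in> Q" "?p \<in> carrier G" "?p <# L = x" using rep[OF x] inG by auto
  have "inv ?p \<otimes> k \<otimes> ?p \<in> gen (insert v link)" if k: "k \<in> U" for k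
  proof -
    have kk0: "k \<otimes> k0 \<in> U" using U(1) k k0 by (auto intro: subgroup.m_closed)
    have inS: "k \<in> gen S" "k0 \<in> gen S" "k \<otimes> k0 \<in> gen S" using k k0 kk0 U(2) by auto
    have inC: "k \<in> carrier G" "k0 \<in> carrier G" using k k0 UG by auto
    \<comment> \<open>A point in a direction other than \<open>x\<close> would be at distance at
      least two from the image of the base point under \<open>k0\<close>, by
      \<open>len_disjoint\<close>.\<close>
    have near: "act l [] = [] \<or> fst (hd (act l [])) = x" if "l \<in> U" for l
    proof (rule ccontr)
      assume l: "\<not> ?thesis"
      have "len (inv k0 \<otimes> l) = len k0 + len l"
        by (rule len_disjoint) (use inS that U(2) l x0 in auto)
      moreover have "len l > 0" using l by (simp add: len_def)
      moreover have "inv k0 \<otimes> l \<in> U" using U(1) k0 that by (auto intro: subgroup.m_closed subgroup.m_inv_closed)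
      ultimately show False using small[of "inv k0 \<otimes> l"] k0 by simp
    qed
    obtain q where q: "q \<in> Q" "k = ev (act k []) \<otimes> q" using decompose inS by blast
    have qG: "q \<in> carrier G" using q inG by blast
    have k0R: "[(x, a0)] \<in> R" using actR[OF k0(1)] x0 by simp
    obtain a where a: "a \<in> H v" "k = lt x a \<otimes> q"
    proof (cases "act k []")
      case Nil
      then show thesis using that[of \<one>] q qG lt_one[OF x] Hv_closed(3) by (simp add: ev_Nil)
    next
      case (Cons z w)
      then have "w = []" using small[OF k] by (simp add: len_def)
      moreover have "fst z = x" using near[OF k] Cons by simp
      ultimately have "act k [] = [(x, snd z)]" using Cons by (cases z) auto
      moreover from this have "snd z \<in> H v" using actR[OF k] by (simp add: R_Cons)
      ultimately show thesis using that[of "snd z"] q inG(4) lt_closed[OF x] by (simp add: ev_Cons ev_Nil)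
    qed
    have aG: "a \<in> carrier G" "lt x a \<in> carrier G" using a(1) lt_closed[OF x] inG by auto
    have "act (k \<otimes> k0) [] = letter x a [(q <# x, a0)]"
      using inC R_Nil k0R aG qG q(1) translate_closed[OF k0R q(1)] act_lt[OF x a(1)]
      by (simp add: act_mult x0 a(2) act_Q translate_Cons translate_Nil)
    \<comment> \<open>Otherwise \<open>k \<otimes> k0\<close> moves the base point either in the
      direction \<open>q <# x\<close> or to distance two; \<open>near\<close> and
      \<open>small\<close> exclude both.\<close>
    moreover have "q <# x = x" if "act (k \<otimes> k0) [] = letter x a [(q <# x, a0)]"
    proof (rule ccontr)
      assume "q <# x \<noteq> x"
      then have "act (k \<otimes> k0) [] = (if a = \<one> then [(q <# x, a0)] else [(x, a), (q <# x, a0)])"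
        using that by (simp add: letter_Cons)
      then show False using near[OF kk0] small[OF kk0] \<open>q <# x \<noteq> x\<close>
        by (simp add: len_def split: if_splits)
    qed
    ultimately have "q <# x = x" by blast
    then have l: "inv ?p \<otimes> q \<otimes> ?p \<in> L" using coset_fix[OF p(1) q(1)] p(3) by simp
    have "inv ?p \<otimes> k \<otimes> ?p = a \<otimes> (inv ?p \<otimes> q \<otimes> ?p)"
    proof -
      have "inv ?p \<otimes> k \<otimes> ?p = inv ?p \<otimes> (?p \<otimes> (a \<otimes> (inv ?p \<otimes> (q \<otimes> ?p))))"
        using p(2) aG qG by (simp add: a(2) lt_def m_assoc)
      also have "\<dots> = a \<otimes> (inv ?p \<otimes> (q \<otimes> ?p))" using p(2) aG qG by (simp flip: m_assoc)
      finally show ?thesis using p(2) qG by (simp add: m_assoc)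
    qed
    moreover have "a \<in> gen (insert v link)" using a(1) H_subset_gen[of v "insert v link"] by auto
    moreover have "L \<subseteq> gen (insert v link)" unfolding L_def by (rule gen_mono) auto
    moreover have "subgroup (gen (insert v link)) G" using vV linkV by (intro subgroup_gen) auto
    ultimately show ?thesis using l by (auto intro: subgroup.m_closed)
  qed
  then have "conjugate (inv ?p) U \<subseteq> gen (insert v link)" using p(2) by (auto simp: conjugate_def)
  then show ?thesis using p(1) by blast
qed

end

context graph_product_group
begin

section \<open>Conjugation of subgroups and the induction on the graph\<close>

lemma conjugate_mult:
  "g \<in> carrier G \<Longrightarrow> h \<in> carrier G \<Longrightarrow> U \<subseteq> carrier G \<Longrightarrow> conjugate g (conjugate h U) = conjugate (g \<otimes> h) U"
  unfolding conjugate_def image_image by (intro image_cong) (auto simp: m_assoc inv_mult_group)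

lemma conjugate_one: "U \<subseteq> carrier G \<Longrightarrow> conjugate \<one> U = U"
  unfolding conjugate_def by force

lemma conjugate_mono: "U \<subseteq> W \<Longrightarrow> conjugate g U \<subseteq> conjugate g W"
  unfolding conjugate_def by blast

lemma conjugate_card:
  assumes "g \<in> carrier G" "U \<subseteq> carrier G"
  shows "card (conjugate g U) = card U"
  unfolding conjugate_def using assms by (intro card_image inj_onI) (auto simp: subset_iff)

lemma conjugate_subgroup:
  assumes "g \<in> carrier G" "subgroup U G"
  shows "subgroup (conjugate g U) G"
proof -
  have U: "U \<subseteq> carrier G" using assms(2) by (rule subgroup.subset)
  have "group_hom G G (\<lambda>x. g \<otimes> x \<otimes> inv g)"
  proof (unfold_locales, rule homI)
    fix x y assume xy: "x \<in> carrier G" "y \<in> carrier G"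
    have "inv g \<otimes> (g \<otimes> (y \<otimes> inv g)) = y \<otimes> inv g" using assms xy by (simp flip: m_assoc)
    then show "g \<otimes> (x \<otimes> y) \<otimes> inv g = (g \<otimes> x \<otimes> inv g) \<otimes> (g \<otimes> y \<otimes> inv g)"
      using assms xy by (simp add: m_assoc)
  qed (use assms in auto)
  then show ?thesis unfolding conjugate_def using group_hom.subgroup_img_is_subgroup assms(2) by fastforce
qed

theorem finite_subgroup_conjugate_into_clique:
  assumes "S \<subseteq> V" "subgroup U G" "finite U" "U \<subseteq> gen S"
  shows "\<exists>g\<in>carrier G. \<exists>C. clique C \<and> conjugate g U \<subseteq> gen C"
  using finite_subset[OF assms(1) finite_V] assms
proof (induction S arbitrary: U rule: finite_psubset_induct)
  case (psubset S)
  have U: "U \<subseteq> carrier G" using psubset.prems subgroup.subset by blast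
  show ?case
  proof (cases "clique S")
    case True
    then show ?thesis using psubset.prems conjugate_one[OF U] by (intro bexI[of _ \<one>]) auto
  next
    case False
    \<comment> \<open>The missing edge to \<open>u\<close> makes both \<open>S - {v}\<close> and the
      star \<open>insert v link\<close> proper subsets of \<open>S\<close>, so the induction
      hypothesis covers either outcome of the splitting.\<close>
    then obtain u v where uv: "u \<in> S" "v \<in> S" "u \<noteq> v" "{v, u} \<notin> E"
      using psubset.prems(1) unfolding clique_def by blast
    interpret vertex_splitting G V E H S v by unfold_locales (use psubset.prems uv in auto)
    have IH: "\<exists>g\<in>carrier G. \<exists>C. clique C \<and> conjugate g U \<subseteq> gen C"
      if h: "h \<in> carrier G" "conjugate h U \<subseteq> gen T" "T \<subset> S" for h T
    proof -
      have "T \<subseteq> V" "finite (conjugate h U)" using h(3) psubset.prems(1,3) by (auto simp: conjugate_def)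
      then obtain g C where "g \<in> carrier G" "clique C" "conjugate g (conjugate h U) \<subseteq> gen C"
        using psubset.IH[OF h(3) _ conjugate_subgroup[OF h(1) psubset.prems(2)] _ h(2)] by blast
      then show ?thesis using h(1) U by (auto simp: conjugate_mult)
    qed
    obtain g where g: "g \<in> gen S" "\<And>k. k \<in> U \<Longrightarrow> len (inv g \<otimes> k \<otimes> g) \<le> 1"
      using finite_subgroup_small_displacement[OF psubset.prems(2-4)] by blast
    have gG: "g \<in> carrier G" using g inG by blast
    let ?U = "conjugate (inv g) U"
    have small: "len k \<le> 1" if "k \<in> ?U" for k
      using that g(2) gG by (auto simp: conjugate_def)
    have "?U \<subseteq> gen S" using psubset.prems(4) g(1) gG genS_closed by (auto simp: conjugate_def)
    moreover have "subgroup ?U G" using conjugate_subgroup psubset.prems(2) gG by blast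
    ultimately consider "?U \<subseteq> Q" | p where "p \<in> Q" "conjugate (inv p) ?U \<subseteq> gen (insert v link)"
      using small_displacement_cases[OF _ _ small] by blast
    then show ?thesis
    proof cases
      case 1
      then show ?thesis using IH[of "inv g" "S - {v}"] gG uv by (auto simp: Q_def)
    next
      case 2
      then have "p \<in> carrier G" using inG by blast
      moreover have "insert v link \<subset> S" using uv by (auto simp: link_def)
      ultimately show ?thesis using IH[of "inv p \<otimes> inv g" "insert v link"] 2 gG U by (simp add: conjugate_mult)
    qed
  qed
qed

end

section \<open>Maximal cliques and the isomorphism of graphs of groups\<close>

lemma card_superset_fibres:
  assumes "finite M" "finite V" "\<And>v. v \<in> V \<Longrightarrow> f v \<subseteq> M" "S \<subseteq> M"
  shows "card {v \<in> V. S \<subseteq> f v \<and> P v} =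
    card {v \<in> V. f v = S \<and> P v} + (\<Sum>T | S \<subset> T \<and> T \<subseteq> M. card {v \<in> V. f v = T \<and> P v})"
proof -
  have fin: "finite {T. S \<subset> T \<and> T \<subseteq> M}" using assms(1) by simp
  have "{v \<in> V. S \<subseteq> f v \<and> P v} = {v \<in> V. f v = S \<and> P v} \<union> (\<Union>T\<in>{T. S \<subset> T \<and> T \<subseteq> M}. {v \<in> V. f v = T \<and> P v})"
    using assms(3) by fastforce
  moreover have "card \<dots> = card {v \<in> V. f v = S \<and> P v} + card (\<Union>T\<in>{T. S \<subset> T \<and> T \<subseteq> M}. {v \<in> V. f v = T \<and> P v})"
    using assms(2) fin by (intro card_Un_disjoint) auto
  moreover have "card (\<Union>T\<in>{T. S \<subset> T \<and> T \<subseteq> M}. {v \<in> V. f v = T \<and> P v}) =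
      (\<Sum>T | S \<subset> T \<and> T \<subseteq> M. card {v \<in> V. f v = T \<and> P v})"
    using assms(2) fin by (intro card_UN_disjoint) auto
  ultimately show ?thesis by simp
qed

text \<open>Inverts the sums over supersets, from large sets downwards. Equal counts are assumed
  only for nonempty \<open>S\<close>, as an empty family of cliques does not intersect in a clique;
  the induction stays among nonempty sets.\<close>

lemma card_fibres_eq:
  assumes "finite M" "finite V" "finite W"
    and "\<And>v. v \<in> V \<Longrightarrow> f v \<subseteq> M" "\<And>w. w \<in> W \<Longrightarrow> g w \<subseteq> M"
    and eq: "\<And>S. S \<subseteq> M \<Longrightarrow> S \<noteq> {} \<Longrightarrow> card {v \<in> V. S \<subseteq> f v \<and> P v} = card {w \<in> W. S \<subseteq> g w \<and> P' w}"
    and "S \<subseteq> M" "S \<noteq> {}"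
  shows "card {v \<in> V. f v = S \<and> P v} = card {w \<in> W. g w = S \<and> P' w}"
  using assms(7,8)
proof (induction "card (M - S)" arbitrary: S rule: less_induct)
  case less
  have "card {v \<in> V. f v = T \<and> P v} = card {w \<in> W. g w = T \<and> P' w}" if "S \<subset> T" "T \<subseteq> M" for T
  proof (rule less.hyps)
    show "card (M - T) < card (M - S)" using that assms(1) by (intro psubset_card_mono) auto
  qed (use that in auto)
  then have "(\<Sum>T | S \<subset> T \<and> T \<subseteq> M. card {v \<in> V. f v = T \<and> P v}) =
      (\<Sum>T | S \<subset> T \<and> T \<subseteq> M. card {w \<in> W. g w = T \<and> P' w})"
    by (intro sum.cong) auto
  then show ?case
    using eq[OF less.prems] card_superset_fibres[where P = P, OF assms(1,2,4) less.prems(1)]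
      card_superset_fibres[where P = P', OF assms(1,3,5) less.prems(1)] by simp
qed

lemma bij_betw_of_card_fibres:
  assumes "finite V" "finite W" and eq: "\<And>y. card {v \<in> V. f v = y} = card {w \<in> W. g w = y}"
  shows "\<exists>\<phi>. bij_betw \<phi> V W \<and> (\<forall>v\<in>V. g (\<phi> v) = f v)"
proof -
  have "\<exists>b. bij_betw b {v \<in> V. f v = y} {w \<in> W. g w = y}" for y
    using assms by (intro finite_same_card_bij) auto
  then obtain b where b: "\<And>y. bij_betw (b y) {v \<in> V. f v = y} {w \<in> W. g w = y}" by metis
  have \<phi>: "b (f v) v \<in> W" "g (b (f v) v) = f v" if "v \<in> V" for v
    using bij_betwE[OF b, of "f v"] that by auto
  have "bij_betw (\<lambda>v. b (f v) v) V W"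
  proof (rule bij_betw_imageI)
    show "inj_on (\<lambda>v. b (f v) v) V"
    proof (rule inj_onI)
      fix v w assume h: "v \<in> V" "w \<in> V" "b (f v) v = b (f w) w"
      then have "f v = f w" using \<phi>(2) by metis
      then show "v = w" using h inj_onD[OF bij_betw_imp_inj_on[OF b[of "f v"]], of v w] by simp
    qed
    show "(\<lambda>v. b (f v) v) ` V = W"
    proof (intro equalityI subsetI)
      fix w assume "w \<in> W"
      then have "w \<in> b (g w) ` {v \<in> V. f v = g w}" using bij_betw_imp_surj_on[OF b[of "g w"]] by simp
      then show "w \<in> (\<lambda>v. b (f v) v) ` V" by force
    qed (use \<phi>(1) in auto)
  qed
  then show ?thesis using \<phi>(2) by (intro exI[of _ "\<lambda>v. b (f v) v"]) auto
qed

context graph_product_group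
begin

section \<open>Maximal cliques\<close>

definition "max_clique C \<longleftrightarrow> clique C \<and> (\<forall>D. clique D \<longrightarrow> C \<subseteq> D \<longrightarrow> C = D)"

lemma clique_V: "clique C \<Longrightarrow> C \<subseteq> V"
  by (simp add: clique_def)

lemma max_clique_clique: "max_clique C \<Longrightarrow> clique C"
  by (simp add: max_clique_def)

lemma max_clique_V: "max_clique C \<Longrightarrow> C \<subseteq> V"
  using clique_V max_clique_clique by blast

lemma finite_max_cliques: "finite {C. max_clique C}"
  by (rule finite_subset[of _ "Pow V"]) (use max_clique_V finite_V in auto)

lemma clique_extends:
  assumes "clique C"
  shows "\<exists>D. max_clique D \<and> C \<subseteq> D"
proof -
  have "finite {D. clique D}" by (rule finite_subset[of _ "Pow V"]) (use clique_V finite_V in auto)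
  from finite_has_maximal2[OF this, of C] assms show ?thesis by (auto simp: max_clique_def)
qed

lemma edge_iff_max_clique:
  assumes "u \<in> V" "v \<in> V"
  shows "{u, v} \<in> E \<longleftrightarrow> u \<noteq> v \<and> (\<exists>C. max_clique C \<and> u \<in> C \<and> v \<in> C)"
proof
  assume e: "{u, v} \<in> E"
  then have "clique {u, v}" using assms by (auto simp: clique_def insert_commute)
  then show "u \<noteq> v \<and> (\<exists>C. max_clique C \<and> u \<in> C \<and> v \<in> C)"
    using clique_extends e not_loop by blast
qed (auto simp: max_clique_def clique_def)

lemma vertex_in_max_clique: "v \<in> V \<Longrightarrow> \<exists>C. max_clique C \<and> v \<in> C"
  using clique_extends[of "{v}"] by (auto simp: clique_def)

text \<open>After conjugating \<open>U\<close> into one clique \<open>C0\<close>, the retractions onto vertices outside the other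
  cliques still kill it, so no further conjugation is needed.\<close>

lemma conjugate_into_Inter:
  assumes "\<C> \<noteq> {}" "\<And>C. C \<in> \<C> \<Longrightarrow> clique C" "U \<subseteq> carrier G"
    and conj: "\<And>C. C \<in> \<C> \<Longrightarrow> \<exists>g\<in>carrier G. conjugate g U \<subseteq> gen C"
  shows "\<exists>g\<in>carrier G. conjugate g U \<subseteq> gen (\<Inter>\<C>)"
proof -
  obtain C0 where C0: "C0 \<in> \<C>" using assms(1) by blast
  obtain g0 where g0: "g0 \<in> carrier G" "conjugate g0 U \<subseteq> gen C0" using conj C0 by blast
  have "g0 \<otimes> k \<otimes> inv g0 \<in> gen (\<Inter>\<C>)" if k: "k \<in> U" for k
  proof -
    have kG: "k \<in> carrier G" using k assms(3) by blast
    have "g0 \<otimes> k \<otimes> inv g0 \<in> gen (C0 \<inter> \<Inter>\<C>)"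
    proof (rule gen_Int)
      show "clique C0" using assms(2) C0 by blast
      show "g0 \<otimes> k \<otimes> inv g0 \<in> gen C0" using g0(2) k by (auto simp: conjugate_def)
      fix v assume v: "v \<in> C0 - \<Inter>\<C>"
      then obtain C where C: "C \<in> \<C>" "v \<notin> C" by blast
      obtain g where g: "g \<in> carrier G" "conjugate g U \<subseteq> gen C" using conj C by blast
      have vV: "v \<in> V" using v C0 assms(2) clique_V by blast
      interpret \<rho>: group_hom G G "\<rho> v" using vV by (rule group_hom_\<rho>)
      have "g \<otimes> k \<otimes> inv g \<in> gen C" using g k by (auto simp: conjugate_def)
      then have "\<rho> v (g \<otimes> k \<otimes> inv g) = \<one>"
        using \<rho>_gen[OF vV _ C(2)] C(1) assms(2) clique_V by blast
      then have "\<rho> v g \<otimes> \<rho> v k \<otimes> inv (\<rho> v g) = \<one>" using g kG by simp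
      then have "\<rho> v k = \<one>"
        using conj_eq_one[OF \<rho>.hom_closed[OF g(1)] \<rho>.hom_closed[OF kG]] by blast
      then show "\<rho> v (g0 \<otimes> k \<otimes> inv g0) = \<one>" using g0(1) kG by simp
    qed
    moreover have "C0 \<inter> \<Inter>\<C> = \<Inter>\<C>" using C0 by blast
    ultimately show ?thesis by simp
  qed
  then show ?thesis using g0(1) by (auto simp: conjugate_def)
qed

definition "conjugate_cliques C D \<longleftrightarrow> (\<exists>g\<in>carrier G. conjugate g (gen C) = gen D)"

lemma conjugate_iso:
  assumes "g \<in> carrier G" "subgroup U G" "conjugate g U = W"
  shows "subgroup_as_group G U \<cong> subgroup_as_group G W"
proof -
  have U: "U \<subseteq> carrier G" using assms(2) by (rule subgroup.subset)
  have "(\<lambda>x. g \<otimes> x \<otimes> inv g) \<in> iso (subgroup_as_group G U) (subgroup_as_group G W)"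
  proof (intro isoI homI)
    fix x y assume "x \<in> carrier (subgroup_as_group G U)" "y \<in> carrier (subgroup_as_group G U)"
    then have xy: "x \<in> carrier G" "y \<in> carrier G" using U by auto
    have "inv g \<otimes> (g \<otimes> (y \<otimes> inv g)) = y \<otimes> inv g" using assms xy by (simp flip: m_assoc)
    then show "g \<otimes> (x \<otimes>\<^bsub>subgroup_as_group G U\<^esub> y) \<otimes> inv g =
        (g \<otimes> x \<otimes> inv g) \<otimes>\<^bsub>subgroup_as_group G W\<^esub> (g \<otimes> y \<otimes> inv g)"
      using assms xy by (simp add: m_assoc)
  next
    show "bij_betw (\<lambda>x. g \<otimes> x \<otimes> inv g) (carrier (subgroup_as_group G U)) (carrier (subgroup_as_group G W))"
      using U assms by (auto simp: bij_betw_def conjugate_def inj_on_def subset_iff)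
  qed (use assms(3) in \<open>auto simp: conjugate_def\<close>)
  then show ?thesis by (rule is_isoI)
qed

end

text \<open>\<open>gen\<close>, \<open>conjugate\<close> and \<open>conjugate_cliques\<close> depend
  on \<open>G\<close> and \<open>H\<close> but not on the graph, so \<open>A.gen D\<close> is also
  the subgroup belonging to a clique \<open>D\<close> of the second graph.\<close>

locale two_graph_products =
  A: graph_product_group G V E H + B: graph_product_group G V' E' H
  for G :: "('a, 'x) monoid_scheme" (structure) and V :: "'v set" and E V' E' H +
  assumes finite_H: "v \<in> V \<union> V' \<Longrightarrow> finite (H v)"
    and nontrivial_H: "v \<in> V \<union> V' \<Longrightarrow> H v \<noteq> {\<one>}"
begin

lemma finite_gen: "A.clique C \<Longrightarrow> finite (A.gen C)" "B.clique D \<Longrightarrow> finite (A.gen D)"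
  using A.finite_gen[of C] B.finite_gen[of D] A.clique_V[of C] B.clique_V[of D] finite_H by blast+

lemma clique_conjugate:
  assumes "A.clique C"
  shows "\<exists>g\<in>carrier G. \<exists>D. B.max_clique D \<and> A.conjugate g (A.gen C) \<subseteq> A.gen D"
proof -
  have C: "C \<subseteq> V" using assms A.clique_V by blast
  have "A.gen C \<subseteq> A.gen V'"
    using A.gen_closed[OF C] B.carrier_eq_gen by blast
  then obtain g D where g: "g \<in> carrier G" "B.clique D" "A.conjugate g (A.gen C) \<subseteq> A.gen D"
    using B.finite_subgroup_conjugate_into_clique[OF subset_refl A.subgroup_gen[OF C] finite_gen(1)[OF assms]]
    by blast
  obtain D' where "B.max_clique D'" "D \<subseteq> D'" using B.clique_extends g by blast
  then show ?thesis using g A.gen_mono[of D D'] by blast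
qed

end

lemma (in two_graph_products) swap: "two_graph_products G V' E' V E H"
  by unfold_locales (use finite_H nontrivial_H in auto)

text \<open>Conjugate \<open>C\<close> into a maximal clique \<open>D\<close>, and \<open>D\<close>
  back into some \<open>C'\<close>. The retractions give \<open>C \<subseteq> C'\<close>, maximality
  gives equality, and comparing finite cardinalities turns the first inclusion into an
  equality.\<close>

lemma (in two_graph_products) max_clique_match:
  assumes "A.max_clique C"
  shows "\<exists>D. B.max_clique D \<and> A.conjugate_cliques C D"
proof -
  have C: "A.clique C" "C \<subseteq> V" using assms A.max_clique_clique A.max_clique_V by auto
  obtain g D where g: "g \<in> carrier G" "B.max_clique D" "A.conjugate g (A.gen C) \<subseteq> A.gen D"
    using clique_conjugate[OF C(1)] by blast
  interpret BA: two_graph_products G V' E' V E H by (rule swap)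
  have D: "B.clique D" "D \<subseteq> V'" using g B.max_clique_clique B.max_clique_V by auto
  obtain h C' where h: "h \<in> carrier G" "A.max_clique C'" "A.conjugate h (A.gen D) \<subseteq> A.gen C'"
    using BA.clique_conjugate[OF D(1)] by blast
  have sub: "A.gen C \<subseteq> carrier G" "A.gen D \<subseteq> carrier G"
    using A.gen_closed[OF C(2)] B.gen_closed[OF D(2)] by auto
  have C': "A.clique C'" "C' \<subseteq> V" using h A.max_clique_clique A.max_clique_V by auto
  have "A.conjugate (h \<otimes> g) (A.gen C) \<subseteq> A.gen C'"
    using A.conjugate_mono[OF g(3), of h] h(1,3) g(1) sub by (simp add: A.conjugate_mult)
  then have "C \<subseteq> C'"
    using A.conj_subset_clique[OF C(2) C'(2), of "h \<otimes> g"] nontrivial_H C(2) g(1) h(1) by blast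
  then have "C = C'" using assms C'(1) by (simp add: A.max_clique_def)
  have "card (A.gen D) \<le> card (A.gen C)"
    using card_mono[OF finite_gen(1)[OF C'(1)] h(3)] A.conjugate_card[OF h(1) sub(2)] \<open>C = C'\<close> by simp
  then have "A.conjugate g (A.gen C) = A.gen D"
    using A.conjugate_card[OF g(1) sub(1)] by (intro card_seteq finite_gen(2) D g(3)) simp
  then show ?thesis using g unfolding A.conjugate_cliques_def by blast
qed

lemma (in two_graph_products) conjugate_cliques_sym:
  assumes "C \<subseteq> V" "A.conjugate_cliques C D"
  shows "A.conjugate_cliques D C"
proof -
  obtain g where g: "g \<in> carrier G" "A.conjugate g (A.gen C) = A.gen D"
    using assms by (auto simp: A.conjugate_cliques_def)
  have "A.gen C \<subseteq> carrier G" using A.gen_closed[OF assms(1)] by blast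
  then have "A.conjugate (inv g) (A.gen D) = A.gen C"
    using g by (simp add: A.conjugate_mult A.conjugate_one flip: g(2))
  then show ?thesis using g(1) A.inv_closed unfolding A.conjugate_cliques_def by blast
qed

text \<open>Composing the two conjugations takes \<open>gen D\<close> to \<open>gen D'\<close>, so
  the retractions give \<open>D \<subseteq> D'\<close> and maximality applies. Used in both
  directions, this makes the matching bijective.\<close>

lemma (in two_graph_products) max_clique_match_unique:
  assumes "C \<subseteq> V" "B.max_clique D" "B.max_clique D'" "A.conjugate_cliques C D" "A.conjugate_cliques C D'"
  shows "D = D'"
proof -
  obtain g where g: "g \<in> carrier G" "A.conjugate g (A.gen D) = A.gen C"
    using conjugate_cliques_sym[OF assms(1,4)] by (auto simp: A.conjugate_cliques_def)
  obtain h where h: "h \<in> carrier G" "A.conjugate h (A.gen C) = A.gen D'"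
    using assms(5) by (auto simp: A.conjugate_cliques_def)
  have D: "D \<subseteq> V'" "D' \<subseteq> V'" "B.clique D'" using assms B.max_clique_V B.max_clique_clique by auto
  then have "A.gen D \<subseteq> carrier G" using B.gen_closed by blast
  then have "A.conjugate (h \<otimes> g) (A.gen D) \<subseteq> A.gen D'"
    using g h by (simp flip: A.conjugate_mult)
  then have "D \<subseteq> D'"
    using B.conj_subset_clique[OF D(1,2), of "h \<otimes> g"] nontrivial_H D g(1) h(1) by blast
  then show ?thesis using assms(2) D(3) by (simp add: B.max_clique_def)
qed

text \<open>Each clique of the family brings its own conjugating element;
  \<open>conjugate_into_Inter\<close> replaces them by a single one.\<close>

lemma (in two_graph_products) Inter_conjugate_into:
  assumes "\<C> \<noteq> {}" "\<And>C. C \<in> \<C> \<Longrightarrow> C \<subseteq> V \<and> B.clique (\<beta> C) \<and> A.conjugate_cliques C (\<beta> C)"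
  shows "\<exists>g\<in>carrier G. A.conjugate g (A.gen (\<Inter>\<C>)) \<subseteq> A.gen (\<Inter>(\<beta> ` \<C>))"
proof (rule B.conjugate_into_Inter)
  show "A.gen (\<Inter>\<C>) \<subseteq> carrier G" using assms A.gen_closed[of "\<Inter>\<C>"] by blast
  fix D assume "D \<in> \<beta> ` \<C>"
  then obtain C where C: "C \<in> \<C>" "D = \<beta> C" by blast
  obtain g where g: "g \<in> carrier G" "A.conjugate g (A.gen C) = A.gen D"
    using assms(2)[OF C(1)] C(2) by (auto simp: A.conjugate_cliques_def)
  have "A.gen (\<Inter>\<C>) \<subseteq> A.gen C" using C(1) by (intro A.gen_mono) blast
  then have "A.conjugate g (A.gen (\<Inter>\<C>)) \<subseteq> A.gen D" using A.conjugate_mono g(2) by blast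
  then show "\<exists>g\<in>carrier G. A.conjugate g (A.gen (\<Inter>\<C>)) \<subseteq> A.gen D" using g(1) by blast
qed (use assms in auto)

text \<open>Conjugating in both directions and comparing cardinalities gives equality. Injectivity
  of \<open>\<beta>\<close> ensures that the way back ends in the intersection of the same family
  \<open>\<C>\<close>.\<close>

lemma (in two_graph_products) Inter_iso:
  assumes "\<C> \<noteq> {}" "\<And>C. C \<in> \<C> \<Longrightarrow> A.clique C \<and> B.clique (\<beta> C) \<and> A.conjugate_cliques C (\<beta> C)"
    and "inj_on \<beta> \<C>"
  shows "subgroup_as_group G (A.gen (\<Inter>\<C>)) \<cong> subgroup_as_group G (A.gen (\<Inter>(\<beta> ` \<C>)))"
proof -
  let ?I = "\<Inter>\<C>" and ?J = "\<Inter>(\<beta> ` \<C>)"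
  have I: "A.clique ?I" "B.clique ?J"
    using assms(1,2) A.clique_subset[of _ ?I] B.clique_subset[of _ ?J] by blast+
  have sub: "?I \<subseteq> V" "?J \<subseteq> V'" using I A.clique_V B.clique_V by auto
  then have c: "A.gen ?I \<subseteq> carrier G" "A.gen ?J \<subseteq> carrier G" using A.gen_closed B.gen_closed by blast+
  obtain g where g: "g \<in> carrier G" "A.conjugate g (A.gen ?I) \<subseteq> A.gen ?J"
    using Inter_conjugate_into[OF assms(1), of \<beta>] assms(2) A.clique_V by blast
  interpret BA: two_graph_products G V' E' V E H by (rule swap)
  have \<beta>\<beta>: "inv_into \<C> \<beta> ` \<beta> ` \<C> = \<C>" using assms(3) by (simp add: inv_into_image_cancel)
  have "\<exists>h\<in>carrier G. A.conjugate h (A.gen ?J) \<subseteq> A.gen (\<Inter>(inv_into \<C> \<beta> ` \<beta> ` \<C>))"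
  proof (rule BA.Inter_conjugate_into)
    fix D assume "D \<in> \<beta> ` \<C>"
    then obtain C where C: "C \<in> \<C>" "D = \<beta> C" by blast
    have "C \<subseteq> V" "D \<subseteq> V'" "A.clique C" "A.conjugate_cliques C D"
      using assms(2)[OF C(1)] C(2) A.clique_V B.clique_V by auto
    moreover have "inv_into \<C> \<beta> D = C" using C assms(3) by simp
    ultimately show "D \<subseteq> V' \<and> A.clique (inv_into \<C> \<beta> D) \<and> A.conjugate_cliques D (inv_into \<C> \<beta> D)"
      using conjugate_cliques_sym by simp
  qed (use assms(1) in auto)
  then obtain h where h: "h \<in> carrier G" "A.conjugate h (A.gen ?J) \<subseteq> A.gen ?I" unfolding \<beta>\<beta> by blast
  have "card (A.gen ?J) \<le> card (A.gen ?I)"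
    using card_mono[OF finite_gen(1)[OF I(1)] h(2)] A.conjugate_card[OF h(1) c(2)] by simp
  then have "A.conjugate g (A.gen ?I) = A.gen ?J"
    using A.conjugate_card[OF g(1) c(1)] by (intro card_seteq finite_gen(2) I g(2)) simp
  then show ?thesis using A.conjugate_iso[OF g(1) A.subgroup_gen[OF sub(1)]] by blast
qed

theorem theorem5p4:
  fixes G :: "('a, 'x) monoid_scheme"
    and V V' :: "'v set" and E E' :: "'v set set"
    and H :: "'v \<Rightarrow> 'a set"
  assumes "finite V" and "is_graph V E"
    and "finite V'" and "is_graph V' E'"
    and "V \<inter> V' = {}"
    and "group G"
    and "\<And>v. v \<in> V \<union> V' \<Longrightarrow> subgroup (H v) G \<and> finite (H v) \<and> H v \<noteq> {\<one>\<^bsub>G\<^esub>}"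
    and "internal_graph_product G V E H"
    and "internal_graph_product G V' E' H"
    and "\<And>v. v \<in> V \<union> V' \<Longrightarrow> directly_indecomposable (subgroup_as_group G (H v))"
  shows "isomorphic_graphs_of_groups
           V E (\<lambda>v. subgroup_as_group G (H v)) V' E' (\<lambda>v. subgroup_as_group G (H v))"
proof -
  interpret group G by fact
  interpret two_graph_products G V E V' E' H
    by unfold_locales (use assms in auto)
  interpret BA: two_graph_products G V' E' V E H by (rule swap)
  let ?M = "{C. A.max_clique C}" and ?M' = "{D. B.max_clique D}"
  define \<beta> where "\<beta> C = (SOME D. B.max_clique D \<and> A.conjugate_cliques C D)" for C
  have \<beta>: "B.max_clique (\<beta> C)" "A.conjugate_cliques C (\<beta> C)" if "A.max_clique C" for C
    using someI_ex[OF max_clique_match[OF that], folded \<beta>_def] by auto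
  have bij: "bij_betw \<beta> ?M ?M'"
  proof (rule bij_betw_imageI)
    show "inj_on \<beta> ?M"
    proof (rule inj_onI)
      fix C D assume h: "C \<in> ?M" "D \<in> ?M" "\<beta> C = \<beta> D"
      have "A.conjugate_cliques (\<beta> C) C" "A.conjugate_cliques (\<beta> C) D"
        using h \<beta>[of C] \<beta>[of D] conjugate_cliques_sym A.max_clique_V by auto
      then show "C = D"
        using BA.max_clique_match_unique[of "\<beta> C" C D] h \<beta>(1)[of C] B.max_clique_V by auto
    qed
    show "\<beta> ` ?M = ?M'"
    proof (intro equalityI subsetI)
      fix D assume D: "D \<in> ?M'"
      then obtain C where C: "A.max_clique C" "A.conjugate_cliques D C" using BA.max_clique_match by blast
      have "A.conjugate_cliques C D" using BA.conjugate_cliques_sym[of D C] C D B.max_clique_V by auto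
      then have "\<beta> C = D"
        using max_clique_match_unique[of C "\<beta> C" D] C D \<beta>[of C] A.max_clique_V by auto
      then show "D \<in> \<beta> ` ?M" using C by blast
    qed (use \<beta> in auto)
  qed
  let ?K = "\<lambda>v. subgroup_as_group G (H v)"
  \<comment> \<open>The isomorphism type of a vertex group, encoded as the set of all vertices of
    both graphs with isomorphic group, so that types can be compared by equality.\<close>
  define t where "t v = {w \<in> V \<union> V'. ?K v \<cong> ?K w}" for v
  have gK: "group (?K v)" if "v \<in> V \<union> V'" for v using assms(10)[OF that] by (simp add: directly_indecomposable_def)
  have t_iso: "t v = t w" if "v \<in> V \<union> V'" "w \<in> V \<union> V'" "?K v \<cong> ?K w" for v w
    using iso_trans[OF group.iso_sym[OF gK[OF that(1)] that(3)]] iso_trans[OF that(3)] unfolding t_def by blast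
  have iso_t: "?K v \<cong> ?K w" if "w \<in> V \<union> V'" "t v = t w" for v w
  proof -
    have "w \<in> t w" using that(1) by (simp add: t_def)
    then have "w \<in> t v" using that(2) by simp
    then show ?thesis by (simp add: t_def)
  qed
  \<comment> \<open>Vertices of both graphs are labelled by sets of maximal cliques of the first
    graph; \<open>\<beta>\<close> transports the labels to the second.\<close>
  define f where "f v = {C \<in> ?M. v \<in> C}" for v
  define f' where "f' w = {C \<in> ?M. w \<in> \<beta> C}" for w
  have f'V: "\<exists>C. A.max_clique C \<and> \<beta> C = D" if "B.max_clique D" for D
  proof -
    have "D \<in> \<beta> ` ?M" using bij that by (simp add: bij_betw_def)
    then show ?thesis by blast
  qed
  have count: "card {v \<in> V. \<C> \<subseteq> f v \<and> t v = y} = card {w \<in> V'. \<C> \<subseteq> f' w \<and> t w = y}"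
    if \<C>: "\<C> \<subseteq> ?M" "\<C> \<noteq> {}" for \<C> y
  proof -
    let ?I = "\<Inter>\<C>" and ?J = "\<Inter>(\<beta> ` \<C>)"
    have cl: "A.clique C \<and> B.clique (\<beta> C) \<and> A.conjugate_cliques C (\<beta> C)" if "C \<in> \<C>" for C
      using that \<C>(1) \<beta>[of C] A.max_clique_clique[of C] B.max_clique_clique[of "\<beta> C"] by blast
    have I: "A.clique ?I" "B.clique ?J"
      using \<C>(2) cl A.clique_subset[of _ ?I] B.clique_subset[of _ ?J] by blast+
    have sub: "?I \<subseteq> V" "?J \<subseteq> V'" using I A.clique_V B.clique_V by auto
    have iso: "subgroup_as_group G (A.gen ?I) \<cong> subgroup_as_group G (A.gen ?J)"
      using \<C>(1) bij by (intro Inter_iso \<C>(2) cl) (auto simp: bij_betw_def intro: inj_on_subset)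
    have "decomposition ?K ?I (subgroup_as_group G (A.gen ?I))" by (rule A.gen_decomposition[OF I(1)])
    \<comment> \<open>The isomorphism is used to decompose one and the same group along
      \<open>?I\<close> and along \<open>?J\<close>.\<close>
    moreover have "decomposition ?K ?J (subgroup_as_group G (A.gen ?I))"
      by (rule decomposition_iso[OF B.gen_decomposition[OF I(2)]])
        (use sub A.subgroup_gen group.iso_sym[OF _ iso] in
          \<open>auto intro: subgroup.subgroup_is_group is_group\<close>)
    moreover have "directly_indecomposable (?K i) \<and> finite (carrier (?K i))" if "i \<in> ?I \<union> ?J" for i
      using assms(7)[of i] assms(10)[of i] that sub by auto
    ultimately obtain \<sigma> where \<sigma>: "bij_betw \<sigma> ?I ?J" "\<forall>i\<in>?I. ?K i \<cong> ?K (\<sigma> i)"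
      using Krull_Schmidt[of ?K ?I _ ?K ?J] by blast
    have \<sigma>t: "t (\<sigma> i) = t i" if "i \<in> ?I" for i
      using t_iso[of i "\<sigma> i"] that \<sigma> sub bij_betwE[OF \<sigma>(1)] by blast
    have "\<sigma> ` {v \<in> ?I. t v = y} = {w \<in> ?J. t w = y}"
      using \<sigma>t bij_betw_imp_surj_on[OF \<sigma>(1)] by (auto 0 4)
    then have "bij_betw \<sigma> {v \<in> ?I. t v = y} {w \<in> ?J. t w = y}"
      using \<sigma>(1) by (auto intro: bij_betw_subset)
    moreover have "{v \<in> V. \<C> \<subseteq> f v \<and> t v = y} = {v \<in> ?I. t v = y}"
      using sub \<C> unfolding f_def by blast
    moreover have "{w \<in> V'. \<C> \<subseteq> f' w \<and> t w = y} = {w \<in> ?J. t w = y}"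
      using sub \<C> unfolding f'_def by blast
    ultimately show ?thesis by (simp add: bij_betw_same_card)
  qed
  have ne: "f v \<noteq> {}" if "v \<in> V" for v
    using A.vertex_in_max_clique[OF that] by (auto simp: f_def)
  have ne': "f' w \<noteq> {}" if "w \<in> V'" for w
    using B.vertex_in_max_clique[OF that] f'V by (auto simp: f'_def)
  have "card {v \<in> V. (f v, t v) = p} = card {w \<in> V'. (f' w, t w) = p}" for p
  proof (cases p)
    case (Pair \<C> y)
    show ?thesis
    proof (cases "\<C> \<subseteq> ?M \<and> \<C> \<noteq> {}")
      case True
      have "card {v \<in> V. f v = \<C> \<and> t v = y} = card {w \<in> V'. f' w = \<C> \<and> t w = y}"
        by (rule card_fibres_eq[OF A.finite_max_cliques assms(1,3) _ _ count])
          (use True in \<open>auto simp: f_def f'_def\<close>)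
      then show ?thesis by (simp add: Pair)
    next
      \<comment> \<open>Such a label occurs on neither side: labels consist of maximal cliques, and
        every vertex lies in at least one.\<close>
      case False
      then have "{v \<in> V. (f v, t v) = p} = {}" "{w \<in> V'. (f' w, t w) = p} = {}"
        using ne ne' by (auto simp: Pair f_def f'_def)
      then show ?thesis by (simp only: card.empty)
    qed
  qed
  then obtain \<phi> where \<phi>: "bij_betw \<phi> V V'" "\<And>v. v \<in> V \<Longrightarrow> (f' (\<phi> v), t (\<phi> v)) = (f v, t v)"
    using bij_betw_of_card_fibres[OF assms(1,3), of "\<lambda>v. (f v, t v)" "\<lambda>w. (f' w, t w)"] by blast
  have \<phi>V: "\<phi> v \<in> V'" if "v \<in> V" for v using bij_betwE[OF \<phi>(1)] that by blast
  have "{u, v} \<in> E \<longleftrightarrow> {\<phi> u, \<phi> v} \<in> E'" if uv: "u \<in> V" "v \<in> V" for u v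
  proof -
    have "u = v \<longleftrightarrow> \<phi> u = \<phi> v" using \<phi>(1) uv by (auto simp: bij_betw_def inj_on_def)
    moreover have "(\<exists>C. A.max_clique C \<and> u \<in> C \<and> v \<in> C) \<longleftrightarrow> f u \<inter> f v \<noteq> {}"
      by (auto simp: f_def)
    moreover have "(\<exists>D. B.max_clique D \<and> \<phi> u \<in> D \<and> \<phi> v \<in> D) \<longleftrightarrow> f' (\<phi> u) \<inter> f' (\<phi> v) \<noteq> {}"
      unfolding f'_def using f'V \<beta>(1) by blast
    ultimately show ?thesis
      using A.edge_iff_max_clique[OF uv] B.edge_iff_max_clique[OF \<phi>V[OF uv(1)] \<phi>V[OF uv(2)]] \<phi>(2)[OF uv(1)] \<phi>(2)[OF uv(2)]
      by auto
  qed
  moreover have "?K v \<cong> ?K (\<phi> v)" if "v \<in> V" for v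
    using iso_t[of "\<phi> v" v] \<phi>V[OF that] \<phi>(2)[OF that] by auto
  ultimately show ?thesis
    using \<phi>(1) unfolding isomorphic_graphs_of_groups_def graph_iso_def by blast
qed

end
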